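(* Let $\Lambda=\Lambda_{\log}$ be the logarithmic mean, let $K\in\mathbb{R}$ and $N\in(0,\infty)$, and let $(P_t)_{t\ge0}$ be an ergodic tracially symmetric quantum Markov semigroup on $\mathcal{M}$ whose generator has the Lindblad form $\mathcal{L}=\sum_{j=1}^d\partial_j^\dagger\partial_j$. If $(P_t)$ satisfies $\mathrm{GE}(K,N)$ (with respect to $\Lambda_{\log}$), then the following hold: (a) ($\mathcal{W}$-expansion bound) For all $\rho_0,\rho_1\in\mathcal{S}_+(\mathcal{M})$ and $s,t\ge0$, $$s_{K/N}\left(\tfrac12\mathcal{W}(P_t\rho_0,P_s\rho_1)\right)^2\le e^{-K(s+t)}s_{K/N}\left(\tfrac12\mathcal{W}(\rho_0,\rho_1)\right)^2+\frac NK\left(1-e^{-K(s+t)}\right)\frac{(\sqrt t-\sqrt s)^2}{2(s+t)}.$$ (b) ($N$-HWI inequality) For all $\rho_0,\rho_1\in\mathcal{S}_+(\mathcal{M})$, $$\frac{U_N(\rho_1)}{U_N(\rho_0)}\le c_{K/N}(\mathcal{W}(\rho_0,\rho_1))+\frac1N\,s_{K/N}(\mathcal{W}(\rho_0,\rho_1))\sqrt{\mathcal{I}(\rho_0)}.$$ If $K>0$, then additionally: (c) ($N$-MLSI) For all $\rho\in\mathcal{S}_+(\mathcal{M})$, $$KN\left(U_N(\rho)^{-2}-1\right)\le\mathcal{I}(\rho).$$ (d) ($N$-Talagrand inequality) For all $\rho\in\mathcal{S}_+(\mathcal{M})$, $$\mathrm{Ent}(\rho)\ge-N\log\cos\left(\sqrt{\tfrac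 KN}\,\mathcal{W}(\rho,\mathbf 1)\right).$$
   Context: $\mathcal{M}$ is a finite-dimensional von Neumann algebra with faithful tracial state $\tau$ and unit $\mathbf 1$; $\langle x,y\rangle=\tau(x^*y)$, and $T^\dagger$ is the adjoint of a linear map $T:\mathcal{M}\to\mathcal{M}$. $\mathcal{S}(\mathcal{M})$ is the set of positive $\rho\in\mathcal{M}$ with $\tau(\rho)=1$ and $\mathcal{S}_+(\mathcal{M})$ the subset of invertible ones. For $\rho\in\mathcal{S}_+(\mathcal{M})$: $\mathrm{Ent}(\rho)=\tau(\rho\log\rho)$, $U_N(\rho)=\exp\left(-\frac1N\mathrm{Ent}(\rho)\right)$, and the Fisher information is $\mathcal{I}(\rho)=\tau((\mathcal{L}\rho)\log\rho)$. A quantum Markov semigroup on $\mathcal M$ is a family $(P_t)_{t\ge0}$ of linear maps on $\mathcal{M}$ with $P_0=\mathrm{id}$, $P_{s+t}=P_sP_t$, each $P_t$ completely positive and unital, and $t\mapsto P_t$ continuous. Its generator is $\mathcal{L}x=\lim_{t\searrow0}\frac1t(x-P_tx)$, so $P_t=e^{-t\mathcal{L}}$. It is tracially symmetric if $\tau(P_t(x)y)=\tau(xP_t(y))$ for all $x,y\in\mathcal{M}$, $t\ge0$; then $\mathcal{E}(a,b):=\langle a,\mathcal{L}b\rangle$. A tracially symmetric $(P_t)$ is ergodic if $\mathbf 1$ is its unique invariant state in $\mathcal{S}(\mathcal{M})$. Lindblad form: $\mathcal{L}=\sum_{j=1}^d\partial_j^\dagger\partial_j$ where $\partial_j=[v_j,\cdot\,]$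 with $v_j\in\mathcal{M}$ (so $\partial_j^\dagger=[v_j^*,\cdot\,]$), and for every index $j$ there is a unique index $j^*$ with $v_j^*=v_{j^*}$. Put $\partial=(\partial_1,\dots,\partial_d):\mathcal{M}\to\hat{\mathcal{M}}:=\bigoplus_{j=1}^d\mathcal{M}$, where $\hat{\mathcal M}$ has inner product $\langle(x_j),(y_j)\rangle=\sum_j\langle x_j,y_j\rangle$. Logarithmic mean: for $\rho\in\mathcal{S}_+(\mathcal{M})$, $\hat\rho=\Lambda_{\log}(L(\rho),R(\rho))=\int_0^1L(\rho)^sR(\rho)^{1-s}\,ds$, i.e. $\hat\rho\,x=\int_0^1\rho^sx\rho^{1-s}ds$, acting componentwise on $\hat{\mathcal{M}}$; here $L(\rho),R(\rho)$ are left and right multiplication by $\rho$. $\|\xi\|_\rho^2=\langle\hat\rho\,\xi,\xi\rangle$ for $\xi\in\hat{\mathcal{M}}$. $(P_t)$ satisfies $\mathrm{GE}(K,N)$ (with respect to $\Lambda_{\log}$) if $$\|\partial P_ta\|_\rho^2\le e^{-2Kt}\|\partial a\|_{P_t\rho}^2-\frac{1-e^{-2Kt}}{KN}|\mathcal{E}(a,P_t\rho)|^2$$ for all $t\ge0$, $a\in\mathcal{M}$, $\rho\in\mathcal{S}_+(\mathcal{M})$ (with $\frac{1-e^{-2Kt}}{K}$ read as $2t$ if $K=0$). Metric: $\mathcal{S}_+(\mathcal{M})$ is a smooth manifold whose tangent space at each point is the space of traceless self-adjoint elements of $\mathcal{M}$. For $\rho\in\mathcal{S}_+(\mathcal{M})$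 let $\mathcal{K}_\rho^\Lambda x=\partial^\dagger\hat\rho\,\partial x=\sum_{j=1}^d\partial_j^\dagger(\hat\rho\,\partial_jx)$, invertible on traceless elements by ergodicity, and $g_\rho^\Lambda(\dot\rho_1,\dot\rho_2)=\langle\dot\rho_1,(\mathcal{K}_\rho^\Lambda)^{-1}\dot\rho_2\rangle$. $\mathcal{W}$ is the Riemannian distance of $g^\Lambda$ on $\mathcal{S}_+(\mathcal{M})$. For $\kappa,\theta\in\mathbb{R}$: $c_\kappa(\theta)=\cos(\sqrt\kappa\,\theta)$ if $\kappa\ge0$ and $\cosh(\sqrt{-\kappa}\,\theta)$ if $\kappa<0$; $s_\kappa(\theta)=\kappa^{-1/2}\sin(\sqrt\kappa\,\theta)$ if $\kappa>0$, $s_0(\theta)=\theta$, $s_\kappa(\theta)=(-\kappa)^{-1/2}\sinh(\sqrt{-\kappa}\,\theta)$ if $\kappa<0$. In (a), $\frac{1-e^{-K(s+t)}}K$ is read as $s+t$ if $K=0$, and the last term is read as $0$ if $s=t=0$. *)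

theory Defs
  imports "HOL-Analysis.Analysis"
begin

text \<open>A finite-dimensional von Neumann algebra is represented, without loss of generality, as a
  unital *-subalgebra \<open>M\<close> of the complex \<open>n \<times> n\<close> matrices. The matrix product is \<open>**\<close> and the unit
  is \<open>mat 1\<close>; the class operation \<open>*\<close> on \<^typ>\<open>complex ^ 'n ^ 'n\<close> is componentwise and is never
  used. Maps on \<open>M\<close> are total functions of which only the values on \<open>M\<close> matter.\<close>

type_synonym 'n cmat = "complex ^ 'n ^ 'n"

definition cadj :: "'n::finite cmat \<Rightarrow> 'n cmat" where
  "cadj x = (\<chi> i j. cnj (x $ j $ i))"

definition cscale :: "complex \<Rightarrow> 'n::finite cmat \<Rightarrow> 'n cmat" where
  "cscale c x = (\<chi> i j. c * x $ i $ j)"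

definition fd_vN_algebra :: "'n::finite cmat set \<Rightarrow> bool" where
  "fd_vN_algebra M \<longleftrightarrow>
     mat 1 \<in> M \<and>
     (\<forall>x\<in>M. \<forall>y\<in>M. x + y \<in> M \<and> x ** y \<in> M) \<and>
     (\<forall>c. \<forall>x\<in>M. cscale c x \<in> M) \<and>
     (\<forall>x\<in>M. cadj x \<in> M)"

definition faithful_tracial_state :: "'n::finite cmat set \<Rightarrow> ('n cmat \<Rightarrow> complex) \<Rightarrow> bool" where
  "faithful_tracial_state M \<tau> \<longleftrightarrow>
     (\<forall>x\<in>M. \<forall>y\<in>M. \<tau> (x + y) = \<tau> x + \<tau> y) \<and>
     (\<forall>c. \<forall>x\<in>M. \<tau> (cscale c x) = c * \<tau> x) \<and>
     \<tau> (mat 1) = 1 \<and>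
     (\<forall>x\<in>M. \<tau> (cadj x ** x) \<in> \<real> \<and> 0 \<le> Re (\<tau> (cadj x ** x))) \<and>
     (\<forall>x\<in>M. \<tau> (cadj x ** x) = 0 \<longrightarrow> x = 0) \<and>
     (\<forall>x\<in>M. \<forall>y\<in>M. \<tau> (x ** y) = \<tau> (y ** x))"

definition ip :: "('n::finite cmat \<Rightarrow> complex) \<Rightarrow> 'n cmat \<Rightarrow> 'n cmat \<Rightarrow> complex" where
  "ip \<tau> x y = \<tau> (cadj x ** y)"

text \<open>The adjoint with respect to \<^const>\<open>ip\<close> of a linear map \<open>T\<close> on \<open>M\<close>.\<close>

definition adj_map ::
  "'n::finite cmat set \<Rightarrow> ('n cmat \<Rightarrow> complex) \<Rightarrow> ('n cmat \<Rightarrow> 'n cmat) \<Rightarrow> 'n cmat \<Rightarrow> 'n cmat" where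
  "adj_map M \<tau> T x = (THE y. y \<in> M \<and> (\<forall>z\<in>M. ip \<tau> (T z) x = ip \<tau> z y))"

definition positive_in :: "'n::finite cmat set \<Rightarrow> 'n cmat \<Rightarrow> bool" where
  "positive_in M x \<longleftrightarrow> (\<exists>y\<in>M. x = cadj y ** y)"

definition invertible_in :: "'n::finite cmat set \<Rightarrow> 'n cmat \<Rightarrow> bool" where
  "invertible_in M x \<longleftrightarrow> (\<exists>y\<in>M. x ** y = mat 1 \<and> y ** x = mat 1)"

definition states :: "'n::finite cmat set \<Rightarrow> ('n cmat \<Rightarrow> complex) \<Rightarrow> 'n cmat set" where
  "states M \<tau> = {\<rho> \<in> M. positive_in M \<rho> \<and> \<tau> \<rho> = 1}"

definition states_pos :: "'n::finite cmat set \<Rightarrow> ('n cmat \<Rightarrow> complex) \<Rightarrow> 'n cmat set" where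
  "states_pos M \<tau> = {\<rho> \<in> states M \<tau>. invertible_in M \<rho>}"


subsection \<open>Functional calculus for self-adjoint elements\<close>

text \<open>For self-adjoint \<open>x\<close> with spectral decomposition \<open>x = (\<Sum>r. r p\<^sub>r)\<close>, where \<open>p\<^sub>r\<close> is the
  orthogonal projection onto the eigenspace for \<open>r\<close>, we have \<open>f(x) = (\<Sum>r. f(r) p\<^sub>r)\<close>; this is
  again an element of any unital *-subalgebra that contains \<open>x\<close>.\<close>

definition real_eigenvalues :: "'n::finite cmat \<Rightarrow> real set" where
  "real_eigenvalues x = {r. \<exists>w. w \<noteq> 0 \<and> x *v w = complex_of_real r *s w}"

definition eigenprojection :: "'n::finite cmat \<Rightarrow> real \<Rightarrow> 'n cmat" where
  "eigenprojection x r =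
     (THE p. p ** p = p \<and> cadj p = p \<and> range ((*v) p) = {w. x *v w = complex_of_real r *s w})"

definition fun_calc :: "(real \<Rightarrow> real) \<Rightarrow> 'n::finite cmat \<Rightarrow> 'n cmat" where
  "fun_calc f x = (\<Sum>r\<in>real_eigenvalues x. f r *\<^sub>R eigenprojection x r)"

definition mlog :: "'n::finite cmat \<Rightarrow> 'n cmat" where
  "mlog \<rho> = fun_calc ln \<rho>"

definition mpowr :: "'n::finite cmat \<Rightarrow> real \<Rightarrow> 'n cmat" where
  "mpowr \<rho> s = fun_calc (\<lambda>r. r powr s) \<rho>"

definition Ent :: "('n::finite cmat \<Rightarrow> complex) \<Rightarrow> 'n cmat \<Rightarrow> real" where
  "Ent \<tau> \<rho> = Re (\<tau> (\<rho> ** mlog \<rho>))"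

definition U :: "('n::finite cmat \<Rightarrow> complex) \<Rightarrow> real \<Rightarrow> 'n cmat \<Rightarrow> real" where
  "U \<tau> N \<rho> = exp (- (1 / N) * Ent \<tau> \<rho>)"


subsection \<open>Quantum Markov semigroups\<close>

definition linear_map_on :: "'n::finite cmat set \<Rightarrow> ('n cmat \<Rightarrow> 'n cmat) \<Rightarrow> bool" where
  "linear_map_on M T \<longleftrightarrow>
     (\<forall>x\<in>M. T x \<in> M) \<and>
     (\<forall>x\<in>M. \<forall>y\<in>M. T (x + y) = T x + T y) \<and>
     (\<forall>c. \<forall>x\<in>M. T (cscale c x) = cscale c (T x))"

text \<open>Positivity in the *-algebra of \<open>k \<times> k\<close> matrices over \<open>M\<close>, i.e. \<open>A = X\<^sup>* X\<close> for some such
  matrix \<open>X\<close>; matrices over \<open>M\<close> are functions of two indices below \<open>k\<close>.\<close>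

definition positive_matrix_over ::
  "'n::finite cmat set \<Rightarrow> nat \<Rightarrow> (nat \<Rightarrow> nat \<Rightarrow> 'n cmat) \<Rightarrow> bool" where
  "positive_matrix_over M k A \<longleftrightarrow>
     (\<exists>X. (\<forall>i<k. \<forall>j<k. X i j \<in> M) \<and>
          (\<forall>i<k. \<forall>j<k. A i j = (\<Sum>l<k. cadj (X l i) ** X l j)))"

definition completely_positive_on :: "'n::finite cmat set \<Rightarrow> ('n cmat \<Rightarrow> 'n cmat) \<Rightarrow> bool" where
  "completely_positive_on M T \<longleftrightarrow>
     (\<forall>k A. positive_matrix_over M k A \<longrightarrow> positive_matrix_over M k (\<lambda>i j. T (A i j)))"

text \<open>Since \<open>M\<close> is finite-dimensional, continuity of \<open>t \<mapsto> P\<^sub>t\<close> is pointwise continuity on \<open>M\<close>.\<close>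

definition quantum_Markov_semigroup ::
  "'n::finite cmat set \<Rightarrow> (real \<Rightarrow> 'n cmat \<Rightarrow> 'n cmat) \<Rightarrow> bool" where
  "quantum_Markov_semigroup M P \<longleftrightarrow>
     (\<forall>t\<ge>0. linear_map_on M (P t)) \<and>
     (\<forall>x\<in>M. P 0 x = x) \<and>
     (\<forall>s\<ge>0. \<forall>t\<ge>0. \<forall>x\<in>M. P (s + t) x = P s (P t x)) \<and>
     (\<forall>t\<ge>0. completely_positive_on M (P t)) \<and>
     (\<forall>t\<ge>0. P t (mat 1) = mat 1) \<and>
     (\<forall>x\<in>M. continuous_on {0..} (\<lambda>t. P t x))"

definition generator :: "(real \<Rightarrow> 'n::finite cmat \<Rightarrow> 'n cmat) \<Rightarrow> 'n cmat \<Rightarrow> 'n cmat" where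
  "generator P x = Lim (at_right 0) (\<lambda>t. (1 / t) *\<^sub>R (x - P t x))"

definition tracially_symmetric ::
  "'n::finite cmat set \<Rightarrow> ('n cmat \<Rightarrow> complex) \<Rightarrow> (real \<Rightarrow> 'n cmat \<Rightarrow> 'n cmat) \<Rightarrow> bool" where
  "tracially_symmetric M \<tau> P \<longleftrightarrow>
     (\<forall>t\<ge>0. \<forall>x\<in>M. \<forall>y\<in>M. \<tau> (P t x ** y) = \<tau> (x ** P t y))"

definition ergodic ::
  "'n::finite cmat set \<Rightarrow> ('n cmat \<Rightarrow> complex) \<Rightarrow> (real \<Rightarrow> 'n cmat \<Rightarrow> 'n cmat) \<Rightarrow> bool" where
  "ergodic M \<tau> P \<longleftrightarrow> {\<rho> \<in> states M \<tau>. \<forall>t\<ge>0. P t \<rho> = \<rho>} = {mat 1}"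

definition Dirichlet_form ::
  "('n::finite cmat \<Rightarrow> complex) \<Rightarrow> (real \<Rightarrow> 'n cmat \<Rightarrow> 'n cmat) \<Rightarrow> 'n cmat \<Rightarrow> 'n cmat \<Rightarrow> complex" where
  "Dirichlet_form \<tau> P a b = ip \<tau> a (generator P b)"

definition Fisher ::
  "('n::finite cmat \<Rightarrow> complex) \<Rightarrow> (real \<Rightarrow> 'n cmat \<Rightarrow> 'n cmat) \<Rightarrow> 'n cmat \<Rightarrow> real" where
  "Fisher \<tau> P \<rho> = Re (\<tau> (generator P \<rho> ** mlog \<rho>))"

definition commutator :: "'n::finite cmat \<Rightarrow> 'n cmat \<Rightarrow> 'n cmat" where
  "commutator w x = w ** x - x ** w"

definition Lindblad_form ::
  "'n::finite cmat set \<Rightarrow> ('n cmat \<Rightarrow> complex) \<Rightarrow> (real \<Rightarrow> 'n cmat \<Rightarrow> 'n cmat) \<Rightarrow>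
   nat \<Rightarrow> (nat \<Rightarrow> 'n cmat) \<Rightarrow> bool" where
  "Lindblad_form M \<tau> P d v \<longleftrightarrow>
     (\<forall>j\<in>{1..d}. v j \<in> M) \<and>
     (\<forall>j\<in>{1..d}. \<exists>!k. k \<in> {1..d} \<and> cadj (v j) = v k) \<and>
     (\<forall>x\<in>M. generator P x = (\<Sum>j=1..d. adj_map M \<tau> (commutator (v j)) (commutator (v j) x)))"


subsection \<open>Logarithmic mean and gradient estimate\<close>

text \<open>Elements of the direct sum of \<open>d\<close> copies of \<open>M\<close> are functions on the indices \<open>1, \<dots>, d\<close>.\<close>

definition grad :: "(nat \<Rightarrow> 'n::finite cmat) \<Rightarrow> 'n cmat \<Rightarrow> nat \<Rightarrow> 'n cmat" where
  "grad v a = (\<lambda>j. commutator (v j) a)"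

definition ip_hat ::
  "('n::finite cmat \<Rightarrow> complex) \<Rightarrow> nat \<Rightarrow> (nat \<Rightarrow> 'n cmat) \<Rightarrow> (nat \<Rightarrow> 'n cmat) \<Rightarrow> complex" where
  "ip_hat \<tau> d \<xi> \<eta> = (\<Sum>j=1..d. ip \<tau> (\<xi> j) (\<eta> j))"

definition log_mean :: "'n::finite cmat \<Rightarrow> 'n cmat \<Rightarrow> 'n cmat" where
  "log_mean \<rho> x = integral {0..1} (\<lambda>s. mpowr \<rho> s ** x ** mpowr \<rho> (1 - s))"

definition normsq_hat ::
  "('n::finite cmat \<Rightarrow> complex) \<Rightarrow> nat \<Rightarrow> 'n cmat \<Rightarrow> (nat \<Rightarrow> 'n cmat) \<Rightarrow> real" where
  "normsq_hat \<tau> d \<rho> \<xi> = Re (ip_hat \<tau> d (\<lambda>j. log_mean \<rho> (\<xi> j)) \<xi>)"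

text \<open>\<open>(1 - e\<^sup>-\<^sup>K\<^sup>r) / K\<close>, with its limit \<open>r\<close> at \<open>K = 0\<close>.\<close>

definition exp_quot :: "real \<Rightarrow> real \<Rightarrow> real" where
  "exp_quot K r = (if K = 0 then r else (1 - exp (- K * r)) / K)"

definition GE ::
  "'n::finite cmat set \<Rightarrow> ('n cmat \<Rightarrow> complex) \<Rightarrow> (real \<Rightarrow> 'n cmat \<Rightarrow> 'n cmat) \<Rightarrow>
   nat \<Rightarrow> (nat \<Rightarrow> 'n cmat) \<Rightarrow> real \<Rightarrow> real \<Rightarrow> bool" where
  "GE M \<tau> P d v K N \<longleftrightarrow>
     (\<forall>t\<ge>0. \<forall>a\<in>M. \<forall>\<rho>\<in>states_pos M \<tau>.
        normsq_hat \<tau> d \<rho> (grad v (P t a))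
          \<le> exp (- 2 * K * t) * normsq_hat \<tau> d (P t \<rho>) (grad v a)
            - exp_quot K (2 * t) / N * (cmod (Dirichlet_form \<tau> P a (P t \<rho>)))\<^sup>2)"


subsection \<open>Riemannian metric and distance\<close>

definition K_op ::
  "'n::finite cmat set \<Rightarrow> ('n cmat \<Rightarrow> complex) \<Rightarrow> nat \<Rightarrow> (nat \<Rightarrow> 'n cmat) \<Rightarrow>
   'n cmat \<Rightarrow> 'n cmat \<Rightarrow> 'n cmat" where
  "K_op M \<tau> d v \<rho> x =
     (\<Sum>j=1..d. adj_map M \<tau> (commutator (v j)) (log_mean \<rho> (commutator (v j) x)))"

definition metric ::
  "'n::finite cmat set \<Rightarrow> ('n cmat \<Rightarrow> complex) \<Rightarrow> nat \<Rightarrow> (nat \<Rightarrow> 'n cmat) \<Rightarrow>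
   'n cmat \<Rightarrow> 'n cmat \<Rightarrow> 'n cmat \<Rightarrow> real" where
  "metric M \<tau> d v \<rho> x y =
     Re (ip \<tau> x (the_inv_into {z \<in> M. \<tau> z = 0} (K_op M \<tau> d v \<rho>) y))"

text \<open>Piecewise \<open>C\<^sup>1\<close> curves on \<open>[0,1]\<close>: \<open>C\<^sup>1\<close> up to the end points of each piece. The library's
  \<^const>\<open>piecewise_C1_differentiable_on\<close> does not bound the derivative near the break points,
  so the speed of such a curve need not be integrable.\<close>

definition piecewise_C1_curve :: "(real \<Rightarrow> 'a::real_normed_vector) \<Rightarrow> bool" where
  "piecewise_C1_curve \<gamma> \<longleftrightarrow>
     (\<exists>(m::nat) t. t 0 = (0::real) \<and> t m = 1 \<and> (\<forall>i<m. t i < t (Suc i)) \<and>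
        (\<forall>i<m. \<exists>\<gamma>'. continuous_on {t i..t (Suc i)} \<gamma>' \<and>
           (\<forall>r\<in>{t i..t (Suc i)}.
              (\<gamma> has_vector_derivative \<gamma>' r) (at r within {t i..t (Suc i)}))))"

definition curve_length ::
  "'n::finite cmat set \<Rightarrow> ('n cmat \<Rightarrow> complex) \<Rightarrow> nat \<Rightarrow> (nat \<Rightarrow> 'n cmat) \<Rightarrow>
   (real \<Rightarrow> 'n cmat) \<Rightarrow> real" where
  "curve_length M \<tau> d v \<gamma> =
     integral {0..1} (\<lambda>r. sqrt (metric M \<tau> d v (\<gamma> r)
                            (vector_derivative \<gamma> (at r)) (vector_derivative \<gamma> (at r))))"

definition W ::
  "'n::finite cmat set \<Rightarrow> ('n cmat \<Rightarrow> complex) \<Rightarrow> nat \<Rightarrow> (nat \<Rightarrow> 'n cmat) \<Rightarrow>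
   'n cmat \<Rightarrow> 'n cmat \<Rightarrow> real" where
  "W M \<tau> d v \<rho>\<^sub>0 \<rho>\<^sub>1 =
     Inf {curve_length M \<tau> d v \<gamma> | \<gamma>.
            piecewise_C1_curve \<gamma> \<and> (\<forall>r\<in>{0..1}. \<gamma> r \<in> states_pos M \<tau>) \<and>
            \<gamma> 0 = \<rho>\<^sub>0 \<and> \<gamma> 1 = \<rho>\<^sub>1}"


subsection \<open>Generalized sine and cosine\<close>

definition c_fun :: "real \<Rightarrow> real \<Rightarrow> real" where
  "c_fun \<kappa> \<theta> = (if \<kappa> \<ge> 0 then cos (sqrt \<kappa> * \<theta>) else cosh (sqrt (- \<kappa>) * \<theta>))"

definition s_fun :: "real \<Rightarrow> real \<Rightarrow> real" where
  "s_fun \<kappa> \<theta> =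
     (if \<kappa> > 0 then sin (sqrt \<kappa> * \<theta>) / sqrt \<kappa>
      else if \<kappa> = 0 then \<theta>
      else sinh (sqrt (- \<kappa>) * \<theta>) / sqrt (- \<kappa>))"

end

theory Submission
  imports Defs
begin

text \<open>The chain rule \<open>\<partial>\<^sup>\<dagger> (\<rho>^ \<partial> log \<rho>) = L \<rho>\<close> makes \<open>P\<close> the gradient flow of the entropy. Let \<open>\<gamma>\<close> be a curve in the
  states and \<open>\<eta>(r) = P\<^sub>T \<gamma>(r)\<close> with a time \<open>T = T(r)\<close> that depends on the position. Dualising GE(K,N) and applying
  Cauchy-Schwarz gives, for the metric speeds and for \<open>E(r) = Ent(\<eta>(r))\<close>,
  \<open>\<bar>\<eta>'\<bar>\<^sup>2 \<le> exp(- 2 K T) \<bar>\<gamma>'\<bar>\<^sup>2 - 2 T' E' - (exp(2 K T) - 1) / (K N) E'\<^sup>2\<close>.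
  For \<open>T = h \<sigma>\<close>, an almost minimising \<open>\<gamma>\<close> and an optimal profile \<open>\<sigma>\<close> from \<open>t\<close> to \<open>s\<close>, integration yields, to first
  order in \<open>h\<close> and with \<open>\<kappa> = K / N\<close>, \<open>w = W(\<rho>\<^sub>0, \<rho>\<^sub>1)\<close> and \<open>u\<^sub>i = U\<^sub>N(\<rho>\<^sub>i)\<close>,
  \<open>W(P\<^sub>h\<^sub>t \<rho>\<^sub>0, P\<^sub>h\<^sub>s \<rho>\<^sub>1)\<^sup>2 \<le> w\<^sup>2 + 2 N h w / s\<^sub>\<kappa>(w) ((s + t) c\<^sub>\<kappa>(w) - s u\<^sub>0 / u\<^sub>1 - t u\<^sub>1 / u\<^sub>0)\<close>.
  No geodesics are needed. With \<open>s = 0\<close> and the bound \<open>W(\<rho>, P\<^sub>h \<rho>) \<le> h sqrt(I(\<rho>)) + o(h)\<close> this is the HWI inequality,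
  which contains the logarithmic Sobolev and Talagrand inequalities as the cases \<open>\<rho>\<^sub>1 = 1\<close> and \<open>\<rho>\<^sub>0 = 1\<close>. Bounding the two
  quotients below by \<open>2 sqrt(s t)\<close> and applying Gronwall's lemma along \<open>h\<close> gives the expansion bound.\<close>

subsection \<open>Matrices and the spectral theorem\<close>

text \<open>What replaces it is that the optimal profile depends on a curve only through its
  normalised arc length and the entropies at the two ends, so any almost minimising curve will do.
  The profile is a product of two solutions of the Jacobi equation: one interpolates the values of
  \<open>U\<close> at the ends, the other makes the running time go from t to s. With this choice
  the energy bound is an exact derivative minus a perfect square, and first derivatives of the
  entropy suffice. A second obstacle is an apparent circle: positivity of \<open>s_fun\<close> needs
  a distance below pi / sqrt \<kappa>, but this diameter bound is itself a consequence of the HWI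
  inequality. Therefore HWI is proved for pairs below the threshold, and continuity of the distance
  along straight segments excludes pairs beyond it.\<close>

lemma of_real_smult [simp]: "complex_of_real r *s (w :: complex^'n) = r *\<^sub>R w"
  unfolding vec_eq_iff vector_smult_component vector_scaleR_component by (simp add: scaleR_conv_of_real)

lemma bounded_bilinear_mmul: "bounded_bilinear ((**) :: 'n::finite cmat \<Rightarrow> 'n cmat \<Rightarrow> 'n cmat)"
  unfolding bilinear_conv_bounded_bilinear[symmetric] bilinear_def
  by (auto intro!: linearI simp: matrix_matrix_mult_def vec_eq_iff sum.distrib algebra_simps
      scaleR_sum_right)

lemma bounded_bilinear_mvmul:
  "bounded_bilinear ((*v) :: 'n::finite cmat \<Rightarrow> complex^'n \<Rightarrow> complex^'n)"
  unfolding bilinear_conv_bounded_bilinear[symmetric] bilinear_def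
  by (auto intro!: linearI simp: matrix_vector_mult_def vec_eq_iff sum.distrib algebra_simps
      scaleR_sum_right)

interpretation mm: bounded_bilinear "(**) :: 'n::finite cmat \<Rightarrow> 'n cmat \<Rightarrow> 'n cmat"
  by (rule bounded_bilinear_mmul)

interpretation mv: bounded_bilinear "(*v) :: 'n::finite cmat \<Rightarrow> complex^'n \<Rightarrow> complex^'n"
  by (rule bounded_bilinear_mvmul)

lemma bounded_linear_cadj: "bounded_linear (cadj :: 'n::finite cmat \<Rightarrow> 'n cmat)"
  unfolding linear_conv_bounded_linear[symmetric]
  by (auto intro!: linearI simp: cadj_def vec_eq_iff)

lemma cadj_add: "cadj (x + y) = cadj x + cadj y"
  and cadj_diff: "cadj (x - y) = cadj x - cadj y"
  and cadj_scaleR: "cadj (r *\<^sub>R x) = r *\<^sub>R cadj x"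
  and cadj_zero [simp]: "cadj 0 = 0"
  and cadj_sum: "cadj (\<Sum>i\<in>I. f i) = (\<Sum>i\<in>I. cadj (f i))"
  by (simp_all add: linear_add linear_diff linear_neg linear_scale linear_0 linear_sum
      bounded_linear.linear[OF bounded_linear_cadj])

lemma cadj_mult: "cadj (x ** y) = cadj y ** cadj x"
  by (simp add: cadj_def matrix_matrix_mult_def vec_eq_iff mult.commute)

lemma cadj_cadj [simp]: "cadj (cadj x) = x"
  by (simp add: cadj_def vec_eq_iff)

lemma cadj_mat1 [simp]: "cadj (mat 1) = mat 1"
  by (simp add: cadj_def mat_def vec_eq_iff)

lemma cadj_cscale: "cadj (cscale c x) = cscale (cnj c) (cadj x)"
  by (simp add: cadj_def cscale_def vec_eq_iff)

lemma cscale_of_real: "cscale (complex_of_real r) x = r *\<^sub>R x"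
  unfolding cscale_def vec_eq_iff vec_lambda_beta vector_scaleR_component
  by (simp add: scaleR_conv_of_real)

lemma cscale_mult_left: "cscale c x ** y = cscale c (x ** y)"
  and cscale_mult_right: "x ** cscale c y = cscale c (x ** y)"
  by (simp_all add: cscale_def matrix_matrix_mult_def vec_eq_iff sum_distrib_left algebra_simps)

lemma cscale_cscale: "cscale a (cscale b x) = cscale (a * b) x"
  by (simp add: cscale_def vec_eq_iff)

lemma inner_cvec: "(u :: complex^'n) \<bullet> w = (\<Sum>i\<in>UNIV. Re (cnj (u $ i) * w $ i))"
  by (simp add: inner_vec_def inner_complex_def)

lemma inner_mv: "(x *v u) \<bullet> w = u \<bullet> (cadj x *v w)"
proof -
  have "(x *v u) \<bullet> w = (\<Sum>i\<in>UNIV. \<Sum>j\<in>UNIV. Re (cnj (x $ i $ j * u $ j) * w $ i))"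
    by (simp add: inner_cvec matrix_vector_mult_def sum_distrib_right del: complex_cnj_mult)
  also have "\<dots> = (\<Sum>j\<in>UNIV. \<Sum>i\<in>UNIV. Re (cnj (x $ i $ j * u $ j) * w $ i))"
    by (rule sum.swap)
  also have "\<dots> = (\<Sum>j\<in>UNIV. \<Sum>i\<in>UNIV. Re (cnj (u $ j) * (cnj (x $ i $ j) * w $ i)))"
    by (intro sum.cong refl arg_cong[where f = Re]) (simp add: mult_ac)
  also have "\<dots> = u \<bullet> (cadj x *v w)"
    by (simp only: inner_cvec matrix_vector_mult_def cadj_def vec_lambda_beta sum_distrib_left Re_sum)
  finally show ?thesis .
qed

section \<open>Eigenspaces of a self-adjoint matrix\<close>

definition eigenspace :: "'n::finite cmat \<Rightarrow> real \<Rightarrow> (complex^'n) set" where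
  "eigenspace x r = {w. x *v w = r *\<^sub>R w}"

lemma real_eigenvalues_alt: "real_eigenvalues x = {r. \<exists>w\<in>eigenspace x r. w \<noteq> 0}"
  by (auto simp: real_eigenvalues_def eigenspace_def)

lemma eigenspace_orthogonal:
  assumes "cadj x = x" "u \<in> eigenspace x r" "w \<in> eigenspace x s" "r \<noteq> s"
  shows "u \<bullet> w = 0"
proof -
  have "r * (u \<bullet> w) = (x *v u) \<bullet> w" using assms by (simp add: eigenspace_def)
  also have "\<dots> = u \<bullet> (x *v w)" using inner_mv[of x u w] assms by simp
  also have "\<dots> = s * (u \<bullet> w)" using assms by (simp add: eigenspace_def)
  finally show ?thesis using assms by simp
qed

text \<open>One eigenvector per eigenvalue gives an orthogonal, hence independent set. Finiteness
  matters because \<open>fun_calc\<close> sums over the eigenvalues, and a sum over an infinite set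
  would be 0 by default.\<close>

lemma finite_real_eigenvalues:
  assumes "cadj x = x" shows "finite (real_eigenvalues x)"
proof -
  define b where "b r = (SOME w. w \<in> eigenspace x r \<and> w \<noteq> 0)" for r
  have b: "b r \<in> eigenspace x r \<and> b r \<noteq> 0" if "r \<in> real_eigenvalues x" for r
  proof -
    have "\<exists>w. w \<in> eigenspace x r \<and> w \<noteq> 0" using that by (auto simp: real_eigenvalues_alt)
    then show ?thesis unfolding b_def by (rule someI_ex)
  qed
  have ne: "b r \<bullet> b s = 0" if "r \<in> real_eigenvalues x" "s \<in> real_eigenvalues x" "r \<noteq> s" for r s
    using eigenspace_orthogonal[OF assms] b that by blast
  have inj: "inj_on b (real_eigenvalues x)"
    by (rule inj_onI) (metis b inner_eq_zero_iff ne)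
  have "pairwise orthogonal (b ` real_eigenvalues x)"
    unfolding pairwise_def orthogonal_def using ne by (metis imageE)
  moreover have "0 \<notin> b ` real_eigenvalues x" using b by force
  ultimately have "independent (b ` real_eigenvalues x)"
    by (rule pairwise_orthogonal_independent)
  then show ?thesis using inj independent_imp_finite finite_imageD by blast
qed

text \<open>Rayleigh's argument on the orthogonal complement of the eigenvectors.\<close>

lemma span_eigenspaces:
  assumes x: "cadj x = x"
  shows "span (\<Union>r\<in>real_eigenvalues x. eigenspace x r) = UNIV" (is "span ?E = UNIV")
proof (rule ccontr)
  assume "span ?E \<noteq> UNIV"
  define V where "V = {w. \<forall>u\<in>?E. u \<bullet> w = 0}"
  have sV: "subspace V" by (auto simp: V_def subspace_def inner_right_distrib)
  obtain w0 where w0: "w0 \<noteq> 0" "w0 \<in> V"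
  proof -
    obtain z where "z \<noteq> 0" "\<And>y. y \<in> span ?E \<Longrightarrow> orthogonal z y"
      using orthogonal_to_subspace_exists_gen[of ?E UNIV] \<open>span ?E \<noteq> UNIV\<close> by auto
    then have "z \<in> V" using span_base[of _ ?E] by (auto simp: V_def orthogonal_def inner_commute)
    then show ?thesis using that \<open>z \<noteq> 0\<close> by blast
  qed
  have sym: "(x *v u) \<bullet> w = u \<bullet> (x *v w)" for u w using inner_mv[of x u w] x by simp
  have xV: "x *v w \<in> V" if "w \<in> V" for w
    unfolding V_def
  proof (clarify)
    fix u r assume "r \<in> real_eigenvalues x" "u \<in> eigenspace x r"
    then have "u \<bullet> w = 0" "x *v u = r *\<^sub>R u" using that by (auto simp: V_def eigenspace_def)
    then show "u \<bullet> (x *v w) = 0" by (simp add: sym[symmetric])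
  qed
  have "compact (V \<inter> sphere 0 1)" using closed_subspace[OF sV] by (simp add: closed_Int_compact)
  moreover have "V \<inter> sphere 0 1 \<noteq> {}"
  proof -
    have "(1 / norm w0) *\<^sub>R w0 \<in> V \<inter> sphere 0 1" using w0 sV by (simp add: subspace_scale)
    then show ?thesis by blast
  qed
  moreover have "continuous_on (V \<inter> sphere 0 1) (\<lambda>w. w \<bullet> (x *v w))"
    by (intro continuous_intros mv.continuous_on)
  ultimately obtain w1 where w1: "w1 \<in> V" "norm w1 = 1"
    and max: "\<And>w. w \<in> V \<Longrightarrow> norm w = 1 \<Longrightarrow> w \<bullet> (x *v w) \<le> w1 \<bullet> (x *v w1)"
    using continuous_attains_sup[of "V \<inter> sphere 0 1" "\<lambda>w. w \<bullet> (x *v w)"] by force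
  define \<mu> where "\<mu> = w1 \<bullet> (x *v w1)"
  \<comment> \<open>The form of \<mu> - x is nonnegative on \<open>V\<close> because \<mu> is the
    maximum, and it vanishes at \<open>w1\<close>. A nonnegative symmetric form pairs a null vector
    to 0 with everything, which makes \<open>w1\<close> an eigenvector.\<close>
  define B where "B u w = u \<bullet> (\<mu> *\<^sub>R w - x *v w)" for u w
  have Bsym: "B u w = B w u" for u w
    unfolding B_def using sym[of u w] by (simp add: inner_diff_right inner_commute)
  have Bpos: "B w w \<ge> 0" if "w \<in> V" for w
  proof (cases "w = 0")
    case False
    define c where "c = 1 / norm w"
    have "(c *\<^sub>R w) \<bullet> (x *v (c *\<^sub>R w)) \<le> \<mu>"
      unfolding \<mu>_def using that sV False by (intro max) (auto simp: subspace_scale c_def)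
    then have "(w \<bullet> (x *v w)) / (norm w)\<^sup>2 \<le> \<mu>"
      by (simp add: mv.scaleR_right c_def power2_eq_square)
    then show ?thesis using False
      by (simp add: B_def inner_diff_right dot_square_norm field_simps)
  qed (simp add: B_def)
  have B1: "B w1 w1 = 0"
    using w1 by (simp add: B_def \<mu>_def inner_diff_right dot_square_norm)
  have B0: "B w1 u = 0" if "u \<in> V" for u
  proof (rule ccontr)
    assume ne: "B w1 u \<noteq> 0"
    \<comment> \<open>The minimiser of \<open>2 t b + t^2 q\<close> would be - b / q; adding 1 to
      the denominator avoids q = 0 and still leaves a negative value.\<close>
    define t where "t = - B w1 u / (B u u + 1)"
    have "B (w1 + t *\<^sub>R u) (w1 + t *\<^sub>R u) \<ge> 0"
      using that w1 sV by (intro Bpos) (auto intro: subspace_add subspace_scale)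
    also have "B (w1 + t *\<^sub>R u) (w1 + t *\<^sub>R u) = 2 * t * B w1 u + t\<^sup>2 * B u u"
    proof -
      have "B (w1 + t *\<^sub>R u) (w1 + t *\<^sub>R u) = B w1 w1 + t * B w1 u + t * B u w1 + t\<^sup>2 * B u u"
        by (simp add: B_def mv.add_right mv.scaleR_right inner_add_left inner_add_right
            inner_diff_right power2_eq_square algebra_simps)
      then show ?thesis using Bsym[of u w1] B1 by simp
    qed
    finally have "0 \<le> 2 * t * B w1 u + t\<^sup>2 * B u u" .
    moreover have "2 * t * B w1 u + t\<^sup>2 * B u u < 0"
    proof -
      have p: "B u u + 1 > 0" using Bpos[OF that] by simp
      have "2 * t * B w1 u + t\<^sup>2 * B u u = - (B w1 u)\<^sup>2 * (B u u + 2) / (B u u + 1)\<^sup>2"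
      proof -
        have "2 * (- b / q) * b + (- b / q)\<^sup>2 * (q - 1) = - b\<^sup>2 * (q - 1 + 2) / q\<^sup>2"
          if "q \<noteq> 0" for b q :: real
          using that by (simp add: field_simps power2_eq_square)
        from this[of "B u u + 1" "B w1 u"] p show ?thesis by (simp add: t_def)
      qed
      also have "\<dots> < 0" using p ne by (intro divide_neg_pos mult_neg_pos) auto
      finally show ?thesis .
    qed
    ultimately show False by simp
  qed
  have "\<mu> *\<^sub>R w1 - x *v w1 \<in> V" using w1 xV sV by (simp add: subspace_diff subspace_scale)
  then have "B (\<mu> *\<^sub>R w1 - x *v w1) w1 = 0" using B0 Bsym by metis
  then have "w1 \<in> eigenspace x \<mu>" by (simp add: B_def eigenspace_def)
  moreover from this have "\<mu> \<in> real_eigenvalues x"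
    using w1 unfolding real_eigenvalues_alt by (intro CollectI bexI[of _ w1]) auto
  ultimately have "w1 \<bullet> w1 = 0" using w1 by (auto simp: V_def)
  then show False using w1 by simp
qed

text \<open>Eigenvectors span the space, so matrix identities can be checked on them. This reduces
  the algebra of eigenprojections to case distinctions.\<close>

lemma mv_eqI:
  fixes A B x :: "'n::finite cmat"
  assumes "cadj x = x" "\<And>r w. r \<in> real_eigenvalues x \<Longrightarrow> w \<in> eigenspace x r \<Longrightarrow> A *v w = B *v w"
  shows "A = B"
proof -
  have "A *v w = B *v w" for w
  proof -
    have "w \<in> span (\<Union>r\<in>real_eigenvalues x. eigenspace x r)" using span_eigenspaces[OF assms(1)] by simp
    then show ?thesis
      by (induction rule: span_induct_alt) (use assms(2) in \<open>auto simp: mv.add_right mv.scaleR_right\<close>)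
  qed
  then show ?thesis by (simp add: matrix_eq)
qed

section \<open>Unital *-subalgebras and eigenprojections\<close>

lemma vN_closed:
  assumes "fd_vN_algebra M"
  shows vN_1: "mat 1 \<in> M" and vN_add: "x \<in> M \<Longrightarrow> y \<in> M \<Longrightarrow> x + y \<in> M"
    and vN_mult: "x \<in> M \<Longrightarrow> y \<in> M \<Longrightarrow> x ** y \<in> M"
    and vN_cscale: "x \<in> M \<Longrightarrow> cscale c x \<in> M"
    and vN_cadj: "x \<in> M \<Longrightarrow> cadj x \<in> M" and vN_scaleR: "x \<in> M \<Longrightarrow> r *\<^sub>R x \<in> M"
    and vN_subspace: "subspace M"
proof -
  show a: "mat 1 \<in> M" "x \<in> M \<Longrightarrow> y \<in> M \<Longrightarrow> x + y \<in> M" "x \<in> M \<Longrightarrow> y \<in> M \<Longrightarrow> x ** y \<in> M"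
    "x \<in> M \<Longrightarrow> cscale c x \<in> M" "x \<in> M \<Longrightarrow> cadj x \<in> M" for x y c
    using assms by (auto simp: fd_vN_algebra_def)
  then show b: "x \<in> M \<Longrightarrow> r *\<^sub>R x \<in> M" for x r by (simp add: cscale_of_real[symmetric])
  from b[OF a(1), of 0] have "0 \<in> M" by simp
  with a b show "subspace M" by (simp add: subspace_def)
qed

lemma vN_UNIV: "fd_vN_algebra UNIV"
  by (simp add: fd_vN_algebra_def)

text \<open>The witness is the product of the matrices x - s over \<open>R\<close>, built one factor
  at a time. Commutation with \<open>x\<close> is carried along because a product of two
  self-adjoint matrices is self-adjoint only if they commute.\<close>

lemma Lagrange_matrix:
  assumes M: "fd_vN_algebra M" and x: "cadj x = x" "x \<in> M" and "finite R"
  shows "\<exists>q\<in>M. cadj q = q \<and> q ** x = x ** q \<and>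
           (\<forall>r. \<forall>w\<in>eigenspace x r. q *v w = (\<Prod>s\<in>R. r - s) *\<^sub>R w)"
  using \<open>finite R\<close>
proof (induction R)
  case empty
  then show ?case using vN_1[OF M] by (intro bexI[of _ "mat 1"]) auto
next
  case (insert s R)
  then obtain q where q: "q \<in> M" "cadj q = q" "q ** x = x ** q"
    "\<And>r w. w \<in> eigenspace x r \<Longrightarrow> q *v w = (\<Prod>s\<in>R. r - s) *\<^sub>R w" by blast
  let ?q = "q ** (x - s *\<^sub>R mat 1)"
  have "?q \<in> M" using q x M by (simp add: vN_mult vN_1 vN_scaleR subspace_diff[OF vN_subspace[OF M]])
  moreover have "cadj ?q = ?q"
    using q x by (simp add: cadj_mult cadj_diff cadj_scaleR mm.diff_left mm.diff_right
        mm.scaleR_left mm.scaleR_right)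
  moreover have "?q ** x = x ** ?q"
  proof -
    have "(x - s *\<^sub>R mat 1) ** x = x ** (x - s *\<^sub>R mat 1)"
      by (simp add: mm.diff_left mm.diff_right mm.scaleR_left mm.scaleR_right)
    then show ?thesis by (metis matrix_mul_assoc q(3))
  qed
  moreover have "?q *v w = (\<Prod>s\<in>insert s R. r - s) *\<^sub>R w" if "w \<in> eigenspace x r" for r w
  proof -
    have "?q *v w = q *v (x *v w - s *\<^sub>R w)"
      by (simp add: matrix_vector_mul_assoc[symmetric] mv.diff_left mv.scaleR_left)
    also have "\<dots> = q *v ((r - s) *\<^sub>R w)" using that by (simp add: eigenspace_def scaleR_left_diff_distrib)
    also have "\<dots> = (r - s) *\<^sub>R (q *v w)" by (simp add: mv.scaleR_right)
    finally show ?thesis using q(4)[OF that] insert.hyps by simp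
  qed
  ultimately show ?case by blast
qed

text \<open>Lagrange interpolation: the product over the other eigenvalues, divided by its value at
  \<open>r\<close>. Being a polynomial in \<open>x\<close>, the projection belongs to every unital
  subalgebra that contains \<open>x\<close>.\<close>

lemma eigenprojection_exists:
  assumes M: "fd_vN_algebra M" and x: "cadj x = x" "x \<in> M" and r: "r \<in> real_eigenvalues x"
  shows "\<exists>p\<in>M. cadj p = p \<and>
           (\<forall>s\<in>real_eigenvalues x. \<forall>w\<in>eigenspace x s. p *v w = (if s = r then w else 0))"
proof -
  let ?R = "real_eigenvalues x - {r}"
  have fin: "finite ?R" using finite_real_eigenvalues[OF x(1)] by simp
  obtain q where q: "q \<in> M" "cadj q = q"
    "\<And>s w. w \<in> eigenspace x s \<Longrightarrow> q *v w = (\<Prod>s'\<in>?R. s - s') *\<^sub>R w"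
    using Lagrange_matrix[OF M x fin] by blast
  let ?c = "\<Prod>s'\<in>?R. r - s'"
  have c: "?c \<noteq> 0" using fin by simp
  show ?thesis
  proof (intro bexI[of _ "(1 / ?c) *\<^sub>R q"] conjI ballI)
    fix s w assume s: "s \<in> real_eigenvalues x" and w: "w \<in> eigenspace x s"
    show "((1 / ?c) *\<^sub>R q) *v w = (if s = r then w else 0)"
    proof (cases "s = r")
      case False
      then have "(\<Prod>s'\<in>?R. s - s') = 0" using fin s by auto
      then show ?thesis using False q(3)[OF w] by (simp add: mv.scaleR_left)
    qed (use c q(3)[OF w] in \<open>simp add: mv.scaleR_left\<close>)
  qed (use q M in \<open>simp_all add: cadj_scaleR vN_scaleR\<close>)
qed

text \<open>This identifies the \<open>THE\<close> in \<open>eigenprojection\<close>. Two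
  self-adjoint idempotents p, q with the same range satisfy p q = q and q p = p, and taking adjoints
  in one of these identities gives p = q.\<close>

lemma eigenprojection_eqI:
  assumes x: "cadj x = x" and r: "r \<in> real_eigenvalues x" and p: "cadj p = p"
    "\<And>s w. s \<in> real_eigenvalues x \<Longrightarrow> w \<in> eigenspace x s \<Longrightarrow> p *v w = (if s = r then w else 0)"
  shows "eigenprojection x r = p"
proof -
  have es: "{w. x *v w = complex_of_real r *s w} = eigenspace x r" by (simp add: eigenspace_def)
  have xp: "x ** p = r *\<^sub>R p"
    by (rule mv_eqI[OF x])
      (auto simp: matrix_vector_mul_assoc[symmetric] p(2) mv.scaleR_left, auto simp: eigenspace_def)
  have ran: "range ((*v) p) = eigenspace x r"
  proof
    show "range ((*v) p) \<subseteq> eigenspace x r"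
      by (auto simp: eigenspace_def matrix_vector_mul_assoc xp mv.scaleR_left)
    show "eigenspace x r \<subseteq> range ((*v) p)" using p(2)[OF r] by (metis rangeI subsetI)
  qed
  have pp: "p ** p = p"
    by (rule mv_eqI[OF x]) (auto simp: matrix_vector_mul_assoc[symmetric] p(2) p(2)[OF r])
  show ?thesis
    unfolding eigenprojection_def es
  proof (rule the_equality)
    show "p ** p = p \<and> cadj p = p \<and> range ((*v) p) = eigenspace x r" using pp p ran by simp
    fix q assume q: "q ** q = q \<and> cadj q = q \<and> range ((*v) q) = eigenspace x r"
    have "p ** q = q"
    proof (subst matrix_eq, intro allI)
      fix w
      have "q *v w \<in> range ((*v) p)" using q ran by blast
      then obtain u where "q *v w = p *v u" by blast
      then show "p ** q *v w = q *v w" by (simp add: matrix_vector_mul_assoc[symmetric])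
          (simp add: matrix_vector_mul_assoc pp)
    qed
    moreover have "q ** p = p"
    proof (subst matrix_eq, intro allI)
      fix w
      have "p *v w \<in> range ((*v) q)" using q ran by blast
      then obtain u where "p *v w = q *v u" by blast
      then show "q ** p *v w = p *v w" by (simp add: matrix_vector_mul_assoc[symmetric])
          (simp add: matrix_vector_mul_assoc q)
    qed
    ultimately show "q = p" by (metis cadj_mult p(1) q)
  qed
qed

lemma eigenprojection_apply:
  assumes x: "cadj x = x" and r: "r \<in> real_eigenvalues x"
    and "s \<in> real_eigenvalues x" "w \<in> eigenspace x s"
  shows "eigenprojection x r *v w = (if s = r then w else 0)"
  using eigenprojection_exists[OF vN_UNIV x UNIV_I r] eigenprojection_eqI[OF x r] assms by metis

lemma eigenprojection_in:
  assumes "fd_vN_algebra M" "cadj x = x" "x \<in> M" "r \<in> real_eigenvalues x"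
  shows "eigenprojection x r \<in> M"
  using eigenprojection_exists[OF assms] eigenprojection_eqI[OF assms(2,4)] by metis

lemma cadj_eigenprojection:
  assumes x: "cadj x = x" and r: "r \<in> real_eigenvalues x"
  shows "cadj (eigenprojection x r) = eigenprojection x r"
  using eigenprojection_exists[OF vN_UNIV x UNIV_I r] eigenprojection_eqI[OF x r] by metis

lemma eigenprojection_mult:
  assumes "cadj x = x" "r \<in> real_eigenvalues x" "s \<in> real_eigenvalues x"
  shows "eigenprojection x r ** eigenprojection x s = (if r = s then eigenprojection x r else 0)"
  by (rule mv_eqI[OF assms(1)])
    (use assms in \<open>auto simp: matrix_vector_mul_assoc[symmetric] eigenprojection_apply\<close>)

lemma sum_eigenprojection:
  assumes "cadj x = x"
  shows "(\<Sum>r\<in>real_eigenvalues x. eigenprojection x r) = mat 1"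
  by (rule mv_eqI[OF assms])
    (use assms finite_real_eigenvalues[OF assms] in
      \<open>auto simp: mv.sum_left eigenprojection_apply if_distrib cong: if_cong\<close>)

lemma mult_eigenprojection:
  assumes "cadj x = x" "r \<in> real_eigenvalues x"
  shows "x ** eigenprojection x r = r *\<^sub>R eigenprojection x r"
    and "eigenprojection x r ** x = r *\<^sub>R eigenprojection x r"
proof -
  show a: "x ** eigenprojection x r = r *\<^sub>R eigenprojection x r"
    by (rule mv_eqI[OF assms(1)])
      (use assms in \<open>auto simp: matrix_vector_mul_assoc[symmetric] eigenprojection_apply mv.scaleR_left\<close>,
       auto simp: eigenspace_def)
  from arg_cong[OF this, of cadj] show "eigenprojection x r ** x = r *\<^sub>R eigenprojection x r"
    using assms by (simp add: cadj_mult cadj_scaleR cadj_eigenprojection)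
qed

subsection \<open>Double operator calculus and the logarithmic mean\<close>

text \<open>In the notation of the paper, \<open>dop F s r x\<close> is \<open>F(L(s), R(r)) x\<close>.\<close>

definition dop :: "(real \<Rightarrow> real \<Rightarrow> real) \<Rightarrow> 'n::finite cmat \<Rightarrow> 'n cmat \<Rightarrow> 'n cmat \<Rightarrow> 'n cmat" where
  "dop F s r x = (\<Sum>a\<in>real_eigenvalues s. \<Sum>b\<in>real_eigenvalues r.
     F a b *\<^sub>R (eigenprojection s a ** x ** eigenprojection r b))"

lemma linear_dop: "linear (dop F s r)"
  by (auto intro!: linearI simp: dop_def mm.add_left mm.add_right mm.scaleR_left mm.scaleR_right
      sum.distrib scaleR_sum_right algebra_simps)

lemmas dop_simps = linear_add[OF linear_dop] linear_diff[OF linear_dop] linear_scale[OF linear_dop]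
  linear_0[OF linear_dop] linear_neg[OF linear_dop]

lemma dop_add: "dop (\<lambda>a b. F a b + G a b) s r x = dop F s r x + dop G s r x"
  by (simp add: dop_def sum.distrib algebra_simps)

lemma dop_diff: "dop (\<lambda>a b. F a b - G a b) s r x = dop F s r x - dop G s r x"
  by (simp add: dop_def sum_subtractf algebra_simps)

lemma dop_scale: "dop (\<lambda>a b. c * F a b) s r x = c *\<^sub>R dop F s r x"
  by (simp add: dop_def scaleR_sum_right)

lemma dop_cong:
  assumes "\<And>a b. a \<in> real_eigenvalues s \<Longrightarrow> b \<in> real_eigenvalues r \<Longrightarrow> F a b = G a b"
  shows "dop F s r x = dop G s r x"
  using assms by (simp add: dop_def)

text \<open>Orthogonality of the eigenprojections turns \<open>dop\<close> into a Schur multiplier: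
  block (a, b) of \<open>x\<close> gets the factor \<open>F a b\<close>. Multiplicativity and norm
  bounds are read off blockwise.\<close>

lemma eigenprojection_sandwich_dop:
  assumes "cadj s = s" "cadj r = r" "a \<in> real_eigenvalues s" "b \<in> real_eigenvalues r"
  shows "eigenprojection s a ** dop F s r x ** eigenprojection r b
           = F a b *\<^sub>R (eigenprojection s a ** x ** eigenprojection r b)"
proof -
  have "eigenprojection s a ** (eigenprojection s a' ** x ** eigenprojection r b') ** eigenprojection r b
      = (if a = a' then if b = b' then eigenprojection s a ** x ** eigenprojection r b else 0 else 0)"
    if "a' \<in> real_eigenvalues s" "b' \<in> real_eigenvalues r" for a' b'
  proof -
    have "eigenprojection s a ** (eigenprojection s a' ** x ** eigenprojection r b') ** eigenprojection r b
       = (eigenprojection s a ** eigenprojection s a') ** x ** (eigenprojection r b' ** eigenprojection r b)"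
      by (simp add: matrix_mul_assoc)
    then show ?thesis using assms that by (auto simp: eigenprojection_mult mm.zero_left mm.zero_right)
  qed
  then have "eigenprojection s a ** dop F s r x ** eigenprojection r b
    = (\<Sum>a'\<in>real_eigenvalues s. \<Sum>b'\<in>real_eigenvalues r. F a' b' *\<^sub>R
        (if a = a' then if b = b' then eigenprojection s a ** x ** eigenprojection r b else 0 else 0))"
    by (simp add: dop_def mm.sum_left mm.sum_right mm.scaleR_left mm.scaleR_right)
  also have "\<dots> = (\<Sum>a'\<in>real_eigenvalues s. if a = a' then \<Sum>b'\<in>real_eigenvalues r. if b = b' then F a' b' *\<^sub>R
        (eigenprojection s a ** x ** eigenprojection r b) else 0 else 0)"
    by (intro sum.cong refl) (auto intro!: sum.neutral sum.cong)
  also have "\<dots> = F a b *\<^sub>R (eigenprojection s a ** x ** eigenprojection r b)"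
    using assms finite_real_eigenvalues[of s] finite_real_eigenvalues[of r] by simp
  finally show ?thesis .
qed

lemma dop_mult:
  assumes "cadj s = s" "cadj r = r"
  shows "dop (\<lambda>a b. F a b * G a b) s r x = dop F s r (dop G s r x)"
  unfolding dop_def[of F] dop_def[of "\<lambda>a b. F a b * G a b"]
  using assms by (intro sum.cong refl) (simp add: eigenprojection_sandwich_dop)

lemma fun_calc_mult:
  assumes "cadj x = x"
  shows "fun_calc f x ** fun_calc g x = fun_calc (\<lambda>r. f r * g r) x"
proof -
  have "fun_calc f x ** fun_calc g x = (\<Sum>r\<in>real_eigenvalues x. \<Sum>s\<in>real_eigenvalues x.
      if r = s then (f r * g s) *\<^sub>R eigenprojection x r else 0)"
    unfolding fun_calc_def using assms
    by (auto simp: mm.sum_left mm.sum_right mm.scaleR_left mm.scaleR_right eigenprojection_mult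
        scaleR_sum_right intro!: sum.cong)
  also have "\<dots> = fun_calc (\<lambda>r. f r * g r) x"
    unfolding fun_calc_def using finite_real_eigenvalues[OF assms] by (simp add: sum.delta')
  finally show ?thesis .
qed

lemma fun_calc_const: "cadj x = x \<Longrightarrow> fun_calc (\<lambda>_. c) x = c *\<^sub>R mat 1"
  by (simp add: fun_calc_def scaleR_sum_right[symmetric] sum_eigenprojection)

lemma fun_calc_id:
  assumes "cadj x = x" shows "fun_calc (\<lambda>r. r) x = x"
proof -
  have "fun_calc (\<lambda>r. r) x = (\<Sum>r\<in>real_eigenvalues x. x ** eigenprojection x r)"
    using assms by (simp add: fun_calc_def mult_eigenprojection)
  also have "\<dots> = x" using assms by (simp add: mm.sum_right[symmetric] sum_eigenprojection)
  finally show ?thesis .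
qed

lemma fun_calc_cong:
  "(\<And>r. r \<in> real_eigenvalues x \<Longrightarrow> f r = g r) \<Longrightarrow> fun_calc f x = fun_calc g x"
  by (simp add: fun_calc_def)

lemma cadj_fun_calc: "cadj x = x \<Longrightarrow> cadj (fun_calc f x) = fun_calc f x"
  by (simp add: fun_calc_def cadj_sum cadj_scaleR cadj_eigenprojection)

lemma fun_calc_in:
  assumes "fd_vN_algebra M" "cadj x = x" "x \<in> M"
  shows "fun_calc f x \<in> M"
  unfolding fun_calc_def
  by (intro subspace_sum[OF vN_subspace[OF assms(1)]] vN_scaleR[OF assms(1)] eigenprojection_in assms)

lemma dop_left_fun:
  assumes "cadj r = r" shows "dop (\<lambda>a b. f a) s r x = fun_calc f s ** x"
proof -
  have "dop (\<lambda>a b. f a) s r x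
      = (\<Sum>a\<in>real_eigenvalues s. f a *\<^sub>R (eigenprojection s a ** x ** (\<Sum>b\<in>real_eigenvalues r. eigenprojection r b)))"
    by (simp add: dop_def mm.sum_right scaleR_sum_right)
  then show ?thesis
    by (simp add: sum_eigenprojection[OF assms] fun_calc_def mm.sum_left mm.scaleR_left)
qed

lemma dop_const:
  assumes "cadj s = s" "cadj r = r" shows "dop (\<lambda>_ _. c) s r x = c *\<^sub>R x"
  unfolding dop_left_fun[OF assms(2), of "\<lambda>_. c" s x] fun_calc_const[OF assms(1)]
  by (simp add: mm.scaleR_left)

lemma dop_right_fun:
  assumes "cadj s = s" shows "dop (\<lambda>a b. f b) s r x = x ** fun_calc f r"
proof -
  have "dop (\<lambda>a b. f b) s r x
      = (\<Sum>b\<in>real_eigenvalues r. f b *\<^sub>R ((\<Sum>a\<in>real_eigenvalues s. eigenprojection s a) ** x ** eigenprojection r b))"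
    unfolding dop_def by (subst sum.swap) (simp add: mm.sum_left scaleR_sum_right)
  then show ?thesis
    by (simp add: sum_eigenprojection[OF assms] fun_calc_def mm.sum_right mm.scaleR_right)
qed

lemma dop_in:
  assumes "fd_vN_algebra M" "cadj s = s" "s \<in> M" "cadj r = r" "r \<in> M" "x \<in> M"
  shows "dop F s r x \<in> M"
  unfolding dop_def
  by (intro subspace_sum[OF vN_subspace[OF assms(1)]] vN_scaleR[OF assms(1)] vN_mult[OF assms(1)]
      eigenprojection_in assms)

section \<open>Block orthogonality and norm bounds\<close>

lemma inner_mat: "(x :: 'n::finite cmat) \<bullet> y = (\<Sum>i\<in>UNIV. \<Sum>j\<in>UNIV. Re (cnj (x $ i $ j) * y $ i $ j))"
  by (simp add: inner_vec_def inner_complex_def)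

lemma inner_mmul_left:
  fixes A x y :: "'n::finite cmat"
  shows "(A ** x) \<bullet> y = x \<bullet> (cadj A ** y)"
proof -
  have "(A ** x) \<bullet> y = (\<Sum>i\<in>UNIV. \<Sum>j\<in>UNIV. \<Sum>k\<in>UNIV. Re (cnj (A $ i $ k * x $ k $ j) * y $ i $ j))"
    by (simp only: inner_mat matrix_matrix_mult_def vec_lambda_beta cnj_sum sum_distrib_right Re_sum)
  also have "\<dots> = (\<Sum>k\<in>UNIV. \<Sum>j\<in>UNIV. \<Sum>i\<in>UNIV. Re (cnj (x $ k $ j) * (cnj (A $ i $ k) * y $ i $ j)))"
    by (subst sum.swap, subst (2) sum.swap, subst sum.swap)
      (intro sum.cong refl arg_cong[where f = Re], simp add: mult_ac)
  also have "\<dots> = x \<bullet> (cadj A ** y)"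
    by (simp only: inner_mat matrix_matrix_mult_def cadj_def vec_lambda_beta sum_distrib_left Re_sum)
  finally show ?thesis .
qed

lemma inner_cadj:
  fixes x y :: "'n::finite cmat"
  shows "cadj x \<bullet> cadj y = x \<bullet> y"
  unfolding inner_mat by (subst sum.swap) (simp add: cadj_def mult.commute)

lemma inner_mmul_right:
  fixes A x y :: "'n::finite cmat"
  shows "(x ** A) \<bullet> y = x \<bullet> (y ** cadj A)"
  using inner_mmul_left[of "cadj A" "cadj x" "cadj y"] inner_cadj[of "x ** A" y]
    inner_cadj[of x "y ** cadj A"]
  by (simp add: cadj_mult)

text \<open>The blocks of a matrix are mutually orthogonal in the Euclidean inner product of the
  type, which is the real part of the Hilbert-Schmidt product. This product does not involve
  \<open>\<tau>\<close> and serves for norm bounds; the analogue for \<open>\<tau>\<close> is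
  \<open>br_dop\<close>.\<close>

lemma inner_dop:
  assumes "cadj s = s" "cadj r = r"
  shows "y \<bullet> dop F s r x = (\<Sum>a\<in>real_eigenvalues s. \<Sum>b\<in>real_eigenvalues r.
     F a b * ((eigenprojection s a ** y ** eigenprojection r b) \<bullet> (eigenprojection s a ** x ** eigenprojection r b)))"
proof -
  have "y \<bullet> (eigenprojection s a ** x ** eigenprojection r b)
     = (eigenprojection s a ** y ** eigenprojection r b) \<bullet> (eigenprojection s a ** x ** eigenprojection r b)"
    if "a \<in> real_eigenvalues s" "b \<in> real_eigenvalues r" for a b
  proof -
    have "eigenprojection s a ** (eigenprojection s a ** x ** eigenprojection r b ** eigenprojection r b)
      = (eigenprojection s a ** eigenprojection s a) ** x ** (eigenprojection r b ** eigenprojection r b)"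
      by (simp add: matrix_mul_assoc)
    also have "\<dots> = eigenprojection s a ** x ** eigenprojection r b"
      using assms that by (simp add: eigenprojection_mult)
    finally show ?thesis using assms that
      by (simp only: inner_mmul_right[of "eigenprojection s a ** y"] inner_mmul_left[of "eigenprojection s a" y]
          cadj_eigenprojection)
  qed
  then show ?thesis by (simp add: dop_def inner_sum_right)
qed

text \<open>Since the blocks are orthogonal, a bound on the multiplier over the spectra bounds the
  operator without a dimension factor. Uniform approximation of \<open>F\<close> thus becomes
  uniform approximation of \<open>dop F\<close>.\<close>

lemma norm_dop_le:
  assumes s: "cadj s = s" "cadj r = r"
    and le: "\<And>a b. a \<in> real_eigenvalues s \<Longrightarrow> b \<in> real_eigenvalues r \<Longrightarrow> \<bar>F a b\<bar> \<le> e"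
    and "0 \<le> e"
  shows "norm (dop F s r x) \<le> e * norm x"
proof -
  let ?n = "\<lambda>a b. (eigenprojection s a ** x ** eigenprojection r b)"
  have "dop F s r x \<bullet> dop F s r x = (\<Sum>a\<in>real_eigenvalues s. \<Sum>b\<in>real_eigenvalues r. (F a b)\<^sup>2 * (?n a b \<bullet> ?n a b))"
    using s by (simp add: inner_dop[OF s] eigenprojection_sandwich_dop power2_eq_square mult.assoc)
  also have "\<dots> \<le> (\<Sum>a\<in>real_eigenvalues s. \<Sum>b\<in>real_eigenvalues r. e\<^sup>2 * (?n a b \<bullet> ?n a b))"
    using le by (intro sum_mono mult_right_mono) (auto simp: abs_le_square_iff[symmetric] \<open>0 \<le> e\<close>)
  also have "\<dots> = x \<bullet> dop (\<lambda>_ _. e\<^sup>2) s r x" by (simp add: inner_dop[OF s])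
  also have "dop (\<lambda>_ _. e\<^sup>2) s r x = e\<^sup>2 *\<^sub>R x"
    by (rule dop_const[OF s])
  also have "x \<bullet> (e\<^sup>2 *\<^sub>R x) = e\<^sup>2 * (x \<bullet> x)" by simp
  finally have "(norm (dop F s r x))\<^sup>2 \<le> (e * norm x)\<^sup>2"
    by (simp add: dot_square_norm power_mult_distrib)
  then show ?thesis by (rule power2_le_imp_le) (use \<open>0 \<le> e\<close> in simp)
qed

section \<open>Positive definite matrices and continuity of double operator functions\<close>

definition posdef :: "'n::finite cmat \<Rightarrow> bool" where
  "posdef x \<longleftrightarrow> cadj x = x \<and> (\<forall>w. w \<noteq> 0 \<longrightarrow> 0 < w \<bullet> (x *v w))"

lemma posdef_cadj [simp]: "posdef x \<Longrightarrow> cadj x = x"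
  by (simp add: posdef_def)

lemma posdef_eigenvalue_bounds:
  assumes "\<And>w. norm w = 1 \<Longrightarrow> c \<le> w \<bullet> (x *v w)" "r \<in> real_eigenvalues x"
  shows "c \<le> r"
proof -
  obtain w where w: "w \<noteq> 0" "w \<in> eigenspace x r" using assms by (auto simp: real_eigenvalues_alt)
  have "c \<le> ((1 / norm w) *\<^sub>R w) \<bullet> (x *v ((1 / norm w) *\<^sub>R w))" using w by (intro assms) simp
  also have "\<dots> = r" using w
    by (simp add: mv.scaleR_right eigenspace_def dot_square_norm power2_eq_square)
  finally show ?thesis .
qed

lemma posdef_eigenvalue:
  assumes "posdef x" "r \<in> real_eigenvalues x" shows "r > 0"
proof -
  obtain w where w: "w \<noteq> 0" "w \<in> eigenspace x r" using assms by (auto simp: real_eigenvalues_alt)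
  have "0 < w \<bullet> (x *v w)" using assms w by (simp add: posdef_def)
  also have "\<dots> = r * (w \<bullet> w)" using w by (simp add: eigenspace_def)
  finally show ?thesis using w inner_gt_zero_iff[of w] zero_less_mult_pos2 by blast
qed

text \<open>The quadratic form is continuous on the compact product of \<open>T\<close> with the
  unit sphere. Its extremes there confine all spectra to one compact interval inside the positive
  axis, the domain for a uniform polynomial approximation.\<close>

lemma eigenvalues_in_compact:
  fixes \<sigma> :: "'a::topological_space \<Rightarrow> 'n::finite cmat"
  assumes T: "compact T" and c: "continuous_on T \<sigma>" and pos: "\<And>t. t \<in> T \<Longrightarrow> posdef (\<sigma> t)"
  obtains l u where "0 < l" "\<And>t r. t \<in> T \<Longrightarrow> r \<in> real_eigenvalues (\<sigma> t) \<Longrightarrow> l \<le> r \<and> r \<le> u"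
proof (cases "T = {}")
  case False
  let ?S = "T \<times> sphere (0 :: complex^'n) 1"
  have ne: "?S \<noteq> {}" using False by simp
  have cS: "compact ?S" using T by (simp add: compact_Times)
  have cont: "continuous_on ?S (\<lambda>p. snd p \<bullet> (\<sigma> (fst p) *v snd p))"
    by (intro continuous_intros mv.continuous_on continuous_on_compose2[OF c]) auto
  obtain p where p: "p \<in> ?S" "\<And>q. q \<in> ?S \<Longrightarrow> snd p \<bullet> (\<sigma> (fst p) *v snd p) \<le> snd q \<bullet> (\<sigma> (fst q) *v snd q)"
    using continuous_attains_inf[OF cS ne cont] by blast
  obtain p' where p': "p' \<in> ?S" "\<And>q. q \<in> ?S \<Longrightarrow> snd q \<bullet> (\<sigma> (fst q) *v snd q) \<le> snd p' \<bullet> (\<sigma> (fst p') *v snd p')"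
    using continuous_attains_sup[OF cS ne cont] by blast
  show ?thesis
  proof (rule that[of "snd p \<bullet> (\<sigma> (fst p) *v snd p)" "snd p' \<bullet> (\<sigma> (fst p') *v snd p')"])
    have "snd p \<noteq> 0" using p(1) by (cases p) auto
    then show "0 < snd p \<bullet> (\<sigma> (fst p) *v snd p)"
      using pos[of "fst p"] p(1) by (auto simp: posdef_def)
    fix t r assume t: "t \<in> T" "r \<in> real_eigenvalues (\<sigma> t)"
    have "snd p \<bullet> (\<sigma> (fst p) *v snd p) \<le> r"
    proof (rule posdef_eigenvalue_bounds[OF _ t(2)])
      fix w :: "complex^'n" assume "norm w = 1"
      then show "snd p \<bullet> (\<sigma> (fst p) *v snd p) \<le> w \<bullet> (\<sigma> t *v w)"
        using p(2)[of "(t, w)"] t by simp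
    qed
    moreover have "- r \<in> real_eigenvalues (- \<sigma> t)"
      using t(2) by (simp add: real_eigenvalues_alt eigenspace_def mv.minus_left)
    then have "- (snd p' \<bullet> (\<sigma> (fst p') *v snd p')) \<le> - r"
    proof (rule posdef_eigenvalue_bounds[rotated])
      fix w :: "complex^'n" assume "norm w = 1"
      then have "w \<bullet> (\<sigma> t *v w) \<le> snd p' \<bullet> (\<sigma> (fst p') *v snd p')"
        using p'(2)[of "(t, w)"] t by simp
      then show "- (snd p' \<bullet> (\<sigma> (fst p') *v snd p')) \<le> w \<bullet> (- \<sigma> t *v w)"
        by (simp add: mv.minus_left)
    qed
    ultimately show "snd p \<bullet> (\<sigma> (fst p) *v snd p) \<le> r \<and> r \<le> snd p' \<bullet> (\<sigma> (fst p') *v snd p')" by simp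
  qed
qed (use that[of 1] in auto)

text \<open>For polynomial \<open>F\<close> no spectral data are left: the coordinates become
  multiplication by \<sigma> from the left and by \<rho> from the right, and products of multipliers
  become compositions. The last point is why the induction keeps \<open>x\<close> arbitrary.\<close>

lemma continuous_on_dop_polynomial:
  assumes "real_polynomial_function q" "continuous_on T \<sigma>" "continuous_on T \<rho>" "continuous_on T x"
    and "\<And>t. t \<in> T \<Longrightarrow> cadj (\<sigma> t) = \<sigma> t" "\<And>t. t \<in> T \<Longrightarrow> cadj (\<rho> t) = \<rho> t"
  shows "continuous_on T (\<lambda>t. dop (\<lambda>a b. q (a, b)) (\<sigma> t) (\<rho> t) (x t))"
  using assms(1,4)
proof (induction q arbitrary: x rule: real_polynomial_function.induct)
  case (linear f)
  define c1 c2 where "c1 = f (1, 0)" and "c2 = f (0, 1)"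
  have f: "f (a, b) = c1 * a + c2 * b" for a b
  proof -
    have "f (a, b) = f (a *\<^sub>R (1, 0) + b *\<^sub>R (0, 1))" by simp
    also have "\<dots> = a *\<^sub>R c1 + b *\<^sub>R c2"
      unfolding c1_def c2_def linear_add[OF bounded_linear.linear[OF linear(1)]]
        linear_scale[OF bounded_linear.linear[OF linear(1)]] ..
    finally show ?thesis by simp
  qed
  have "continuous_on T (\<lambda>t. c1 *\<^sub>R (\<sigma> t ** x t) + c2 *\<^sub>R (x t ** \<rho> t))"
    using linear assms by (intro continuous_intros mm.continuous_on)
  then show ?case
    by (rule continuous_on_eq)
      (use assms in \<open>simp add: f dop_add dop_scale dop_left_fun dop_right_fun fun_calc_id\<close>)
next
  case (const c)
  have "continuous_on T (\<lambda>t. c *\<^sub>R x t)" using const by (intro continuous_intros)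
  then show ?case
    by (rule continuous_on_eq) (use assms in \<open>simp add: dop_const\<close>)
next
  case (add f g)
  then show ?case by (simp add: dop_add continuous_on_add)
next
  case (mult f g)
  have "continuous_on T (\<lambda>t. dop (\<lambda>a b. f (a, b)) (\<sigma> t) (\<rho> t) (dop (\<lambda>a b. g (a, b)) (\<sigma> t) (\<rho> t) (x t)))"
    by (intro mult.IH mult.prems)
  then show ?case by (rule continuous_on_eq) (use assms in \<open>simp add: dop_mult\<close>)
qed

text \<open>Eigenprojections may jump where eigenvalues cross, so continuity cannot be proved term
  by term. Instead \<open>F\<close> is a uniform limit of polynomials on a box that contains all the
  spectra.\<close>

lemma continuous_on_dop:
  fixes \<sigma> \<rho> x :: "'a::topological_space \<Rightarrow> 'n::finite cmat"
  assumes T: "compact T" and c: "continuous_on T \<sigma>" "continuous_on T \<rho>" "continuous_on T x"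
    and pos: "\<And>t. t \<in> T \<Longrightarrow> posdef (\<sigma> t)" "\<And>t. t \<in> T \<Longrightarrow> posdef (\<rho> t)"
    and F: "continuous_on ({0<..} \<times> {0<..}) (\<lambda>p. F (fst p) (snd p))"
  shows "continuous_on T (\<lambda>t. dop F (\<sigma> t) (\<rho> t) (x t))"
proof -
  obtain l u where lu: "0 < l" "\<And>t r. t \<in> T \<Longrightarrow> r \<in> real_eigenvalues (\<sigma> t) \<Longrightarrow> l \<le> r \<and> r \<le> u"
    using eigenvalues_in_compact[OF T c(1) pos(1)] by blast
  obtain l' u' where lu': "0 < l'" "\<And>t r. t \<in> T \<Longrightarrow> r \<in> real_eigenvalues (\<rho> t) \<Longrightarrow> l' \<le> r \<and> r \<le> u'"
    using eigenvalues_in_compact[OF T c(2) pos(2)] by blast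
  let ?S = "{l..u} \<times> {l'..u'}"
  have cF: "continuous_on ?S (\<lambda>p. F (fst p) (snd p))"
    by (rule continuous_on_subset[OF F]) (use lu(1) lu'(1) in auto)
  obtain B where B: "B > 0" "\<And>t. t \<in> T \<Longrightarrow> norm (x t) \<le> B"
    using compact_imp_bounded[OF compact_continuous_image[OF c(3) T]] by (auto simp: bounded_pos)
  have "\<exists>q. real_polynomial_function q \<and> (\<forall>p\<in>?S. \<bar>F (fst p) (snd p) - q p\<bar> < 1 / real (Suc n))" for n
  proof -
    have "compact ?S" by (simp add: compact_Times)
    moreover have "0 < 1 / real (Suc n)" by simp
    ultimately obtain q where "real_polynomial_function q" "\<And>p. p \<in> ?S \<Longrightarrow> \<bar>F (fst p) (snd p) - q p\<bar> < 1 / real (Suc n)"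
      using Stone_Weierstrass_real_polynomial_function[OF _ cF] by blast
    then show ?thesis by blast
  qed
  then obtain q where q: "\<And>n. real_polynomial_function (q n)"
    "\<And>n p. p \<in> ?S \<Longrightarrow> \<bar>F (fst p) (snd p) - q n p\<bar> < 1 / real (Suc n)" by metis
  show ?thesis
  proof (rule uniform_limit_theorem)
    show "\<forall>\<^sub>F n in sequentially. continuous_on T (\<lambda>t. dop (\<lambda>a b. q n (a, b)) (\<sigma> t) (\<rho> t) (x t))"
      using pos by (intro always_eventually allI continuous_on_dop_polynomial q c) auto
    show "uniform_limit T (\<lambda>n t. dop (\<lambda>a b. q n (a, b)) (\<sigma> t) (\<rho> t) (x t)) (\<lambda>t. dop F (\<sigma> t) (\<rho> t) (x t)) sequentially"
    proof (rule uniform_limitI)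
      fix e :: real assume "e > 0"
      have "\<forall>\<^sub>F n in sequentially. inverse (real (Suc n)) < e / B"
        using LIMSEQ_inverse_real_of_nat \<open>e > 0\<close> B(1)
        by (intro order_tendstoD[OF LIMSEQ_inverse_real_of_nat]) simp
      then show "\<forall>\<^sub>F n in sequentially. \<forall>t\<in>T. dist (dop (\<lambda>a b. q n (a, b)) (\<sigma> t) (\<rho> t) (x t)) (dop F (\<sigma> t) (\<rho> t) (x t)) < e"
      proof eventually_elim
        case (elim n)
        show ?case
        proof
          fix t assume t: "t \<in> T"
          have "dist (dop (\<lambda>a b. q n (a, b)) (\<sigma> t) (\<rho> t) (x t)) (dop F (\<sigma> t) (\<rho> t) (x t))
             = norm (dop (\<lambda>a b. F a b - q n (a, b)) (\<sigma> t) (\<rho> t) (x t))"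
            by (simp add: dist_norm norm_minus_commute dop_diff)
          also have "\<dots> \<le> (1 / real (Suc n)) * norm (x t)"
            using lu(2)[OF t] lu'(2)[OF t] q(2)[of "(_, _)"] pos[OF t]
            by (intro norm_dop_le) (auto intro!: less_imp_le)
          also have "\<dots> \<le> (1 / real (Suc n)) * B"
            using B(2)[OF t] by (intro mult_left_mono) auto
          also have "\<dots> < e" using elim B(1) by (simp add: field_simps)
          finally show "dist (dop (\<lambda>a b. q n (a, b)) (\<sigma> t) (\<rho> t) (x t)) (dop F (\<sigma> t) (\<rho> t) (x t)) < e" .
        qed
      qed
    qed
  qed simp
qed

section \<open>The logarithmic mean\<close>

definition Lam :: "real \<Rightarrow> real \<Rightarrow> real" where
  "Lam a b = integral {0..1} (\<lambda>s. a powr s * b powr (1 - s))"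

lemma integrable_Lam:
  fixes a b :: real
  assumes "a > 0" "b > 0" shows "(\<lambda>s. a powr s * b powr (1 - s)) integrable_on {0..1}"
  using assms by (intro integrable_continuous_real continuous_intros) auto

lemma Lam_ge: assumes "0 < c" "c \<le> a" "c \<le> b" shows "c \<le> Lam a b"
proof -
  have "c = integral {0..1} (\<lambda>s::real. c)" by simp
  also have "\<dots> \<le> Lam a b"
    unfolding Lam_def
  proof (rule integral_le)
    fix s :: real assume s: "s \<in> {0..1}"
    have "c = c powr s * c powr (1 - s)" using assms by (simp add: powr_add[symmetric])
    also have "\<dots> \<le> a powr s * b powr (1 - s)"
      using assms s by (intro mult_mono powr_mono2) auto
    finally show "c \<le> a powr s * b powr (1 - s)" .
  qed (use assms in \<open>auto intro!: integrable_Lam\<close>)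
  finally show ?thesis .
qed

text \<open>The function a^s b^(1-s) has derivative (ln a - ln b) times itself in s, so the integral
  telescopes. The multiplied form also covers a = b, where the usual quotient is undefined.\<close>

lemma Lam_ln:
  assumes "a > 0" "b > 0" shows "Lam a b * (ln a - ln b) = a - b"
proof -
  have "((\<lambda>s. a powr s * b powr (1 - s) * (ln a - ln b)) has_integral
      (a powr 1 * b powr (1 - 1) - a powr 0 * b powr (1 - 0))) {0..1}"
    using assms by (intro fundamental_theorem_of_calculus)
      (auto intro!: derivative_eq_intros simp: powr_def has_real_derivative_iff_has_vector_derivative[symmetric] algebra_simps)
  moreover have "((\<lambda>s. a powr s * b powr (1 - s) * (ln a - ln b)) has_integral (Lam a b * (ln a - ln b))) {0..1}"
    unfolding Lam_def by (intro has_integral_mult_left integrable_integral integrable_Lam assms)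
  ultimately show ?thesis using assms by (auto dest: has_integral_unique)
qed

lemma continuous_on_Lam: "continuous_on ({0<..} \<times> {0<..}) (\<lambda>p. Lam (fst p) (snd p))"
proof -
  have "continuous_on (({0<..} \<times> {0<..}) \<times> cbox 0 (1::real)) (\<lambda>(p, s). fst p powr s * snd p powr (1 - s) :: real)"
    unfolding split_beta by (intro continuous_intros) auto
  from integral_continuous_on_param[OF this] show ?thesis by (simp add: Lam_def)
qed

text \<open>For fixed \<rho> the eigenprojections do not depend on the integration variable, so the
  integral acts on the scalar coefficients.\<close>

lemma log_mean_dop:
  assumes "posdef \<rho>" shows "log_mean \<rho> x = dop Lam \<rho> \<rho> x"
proof -
  let ?E = "real_eigenvalues \<rho>"
  have c: "cadj \<rho> = \<rho>" using assms by simp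
  have "mpowr \<rho> s ** x ** mpowr \<rho> (1 - s) = dop (\<lambda>a b. a powr s * b powr (1 - s)) \<rho> \<rho> x" for s
    using c by (simp add: dop_mult dop_left_fun[where f = "\<lambda>a. a powr s"]
        dop_right_fun[where f = "\<lambda>a. a powr (1 - s)"] mpowr_def matrix_mul_assoc)
  then have "log_mean \<rho> x = integral {0..1} (\<lambda>s. dop (\<lambda>a b. a powr s * b powr (1 - s)) \<rho> \<rho> x)"
    by (simp add: log_mean_def)
  also have "\<dots> = dop Lam \<rho> \<rho> x"
    unfolding dop_def
    by (intro integral_unique has_integral_sum has_integral_scaleR_left finite_real_eigenvalues c)
      (use posdef_eigenvalue[OF assms] in \<open>auto simp: Lam_def intro!: integrable_integral integrable_Lam\<close>)
  finally show ?thesis .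
qed

text \<open>The noncommutative chain rule. Both commutators are multipliers applied to
  \<open>w\<close>, with symbols ln b - ln a and b - a, and the logarithmic mean carries the first
  into the second.\<close>

lemma log_mean_commutator_mlog:
  assumes "posdef \<rho>"
  shows "log_mean \<rho> (commutator w (mlog \<rho>)) = commutator w \<rho>"
proof -
  have c: "cadj \<rho> = \<rho>" using assms by simp
  have lg: "commutator w (mlog \<rho>) = dop (\<lambda>a b. ln b - ln a) \<rho> \<rho> w"
    using c by (simp add: dop_diff dop_left_fun[where f = ln] dop_right_fun[where f = ln]
        mlog_def commutator_def)
  have "log_mean \<rho> (commutator w (mlog \<rho>)) = dop (\<lambda>a b. Lam a b * (ln b - ln a)) \<rho> \<rho> w"
    using assms c by (simp add: log_mean_dop lg dop_mult)
  also have "\<dots> = dop (\<lambda>a b. b - a) \<rho> \<rho> w"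
  proof (rule dop_cong)
    fix a b assume "a \<in> real_eigenvalues \<rho>" "b \<in> real_eigenvalues \<rho>"
    then show "Lam a b * (ln b - ln a) = b - a"
      using Lam_ln[of a b] posdef_eigenvalue[OF assms] by (simp add: algebra_simps)
  qed
  also have "\<dots> = commutator w \<rho>"
    using c by (simp add: dop_diff dop_left_fun dop_right_fun fun_calc_id commutator_def)
  finally show ?thesis .
qed

text \<open>Applying the calculus to the unit makes continuity of the logarithm along curves an
  instance of \<open>continuous_on_dop\<close>.\<close>

lemma mlog_dop: "cadj \<rho> = \<rho> \<Longrightarrow> mlog \<rho> = dop (\<lambda>a b. ln a) \<rho> \<rho> (mat 1)"
  by (simp add: dop_left_fun mlog_def)

subsection \<open>Traces, states and entropy\<close>

lemma subspace_coordinates: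
  fixes M :: "'a::euclidean_space set"
  assumes "subspace M"
  obtains B where "finite B" "B \<subseteq> M" "\<And>x. x \<in> M \<Longrightarrow> (\<Sum>b\<in>B. (x \<bullet> b) *\<^sub>R b) = x"
proof -
  obtain B where B: "B \<subseteq> M" "pairwise orthogonal B" "\<And>x. x \<in> B \<Longrightarrow> norm x = 1"
    "independent B" "span B = M" using orthonormal_basis_subspace[OF assms] by metis
  have fin: "finite B" using B independent_imp_finite by blast
  show ?thesis
  proof (rule that[OF fin B(1)])
    fix x assume "x \<in> M"
    then have "x \<in> span B" using B by simp
    then show "(\<Sum>b\<in>B. (x \<bullet> b) *\<^sub>R b) = x"
    proof (induction rule: span_induct_alt)
      case (step c y z)
      have "(\<Sum>b\<in>B. (y \<bullet> b) *\<^sub>R b) = (\<Sum>b\<in>B. if b = y then y else 0)"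
        using B step(1) by (intro sum.cong refl) (auto simp: pairwise_def orthogonal_def dot_square_norm)
      then show ?case using step fin
        by (simp add: inner_add_left scaleR_left_distrib sum.distrib scaleR_scaleR[symmetric]
            scaleR_sum_right[symmetric] del: scaleR_scaleR)
    qed simp
  qed
qed

lemma sum_in_coordinates:
  fixes f :: "'a::euclidean_space \<Rightarrow> 'b::real_normed_vector"
  assumes "subspace M" "finite B" "B \<subseteq> M" "(\<Sum>b\<in>B. (x \<bullet> b) *\<^sub>R b) = x"
    and add: "\<And>x y. x \<in> M \<Longrightarrow> y \<in> M \<Longrightarrow> f (x + y) = f x + f y"
    and scale: "\<And>r x. x \<in> M \<Longrightarrow> f (r *\<^sub>R x) = r *\<^sub>R f x"
  shows "(\<Sum>b\<in>B. (x \<bullet> b) *\<^sub>R f b) = f x"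
proof -
  have f0: "f 0 = 0" using scale[of 0 0] subspace_0[OF assms(1)] by (metis scaleR_zero_left)
  have "f (\<Sum>b\<in>C. c b *\<^sub>R b) = (\<Sum>b\<in>C. c b *\<^sub>R f b)" if "C \<subseteq> B" for C c
    using finite_subset[OF that \<open>finite B\<close>] that
  proof (induction C)
    case (insert b C)
    then have "b \<in> M" "(\<Sum>b\<in>C. c b *\<^sub>R b) \<in> M" using assms(1,3)
      by (auto intro!: subspace_sum subspace_scale)
    then show ?case using insert assms(1) by (simp add: add scale subspace_scale)
  qed (simp add: f0)
  from this[of B "\<lambda>b. x \<bullet> b"] show ?thesis using assms(4) by simp
qed

text \<open>\<open>\<tau>\<close> and \<open>P t\<close> have arbitrary values off \<open>M\<close>,
  so limit and derivative rules do not apply to them directly. Expansion in an orthonormal basis of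
  \<open>M\<close> replaces them by bounded linear maps of the whole space.\<close>

lemma extend_linear_on:
  fixes M :: "'a::euclidean_space set" and f :: "'a \<Rightarrow> 'b::real_normed_vector"
  assumes "subspace M"
    and "\<And>x y. x \<in> M \<Longrightarrow> y \<in> M \<Longrightarrow> f (x + y) = f x + f y"
    and "\<And>r x. x \<in> M \<Longrightarrow> f (r *\<^sub>R x) = r *\<^sub>R f x"
  obtains g where "bounded_linear g" "\<And>x. x \<in> M \<Longrightarrow> g x = f x"
proof -
  obtain B where B: "finite B" "B \<subseteq> M" "\<And>x. x \<in> M \<Longrightarrow> (\<Sum>b\<in>B. (x \<bullet> b) *\<^sub>R b) = x"
    using subspace_coordinates[OF assms(1)] by metis
  show ?thesis
  proof (rule that[of "\<lambda>x. \<Sum>b\<in>B. (x \<bullet> b) *\<^sub>R f b"])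
    show "bounded_linear (\<lambda>x. \<Sum>b\<in>B. (x \<bullet> b) *\<^sub>R f b)"
      by (intro bounded_linear_sum bounded_linear_compose[OF bounded_linear_scaleR_left]
          bounded_linear_inner_left)
  qed (use sum_in_coordinates[OF assms(1) B(1,2)] B(3) assms in blast)
qed

lemma has_vector_derivative_quotient:
  assumes "(f has_vector_derivative D) (at t within T)"
  shows "((\<lambda>u. (1 / (u - t)) *\<^sub>R (f u - f t)) \<longlongrightarrow> D) (at t within T)"
proof -
  have *: "((\<lambda>u. (1 / norm (u - t)) *\<^sub>R (f u - (f t + (u - t) *\<^sub>R D))) \<longlongrightarrow> 0) (at t within T)"
    using assms by (simp add: has_vector_derivative_def has_derivative_within)
  have "((\<lambda>u. (1 / (u - t)) *\<^sub>R (f u - f t) - D) \<longlongrightarrow> 0) (at t within T)"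
  proof (rule Lim_null_comparison[OF _ tendsto_norm_zero[OF *]])
    have "norm ((1 / (u - t)) *\<^sub>R (f u - f t) - D) = norm ((1 / norm (u - t)) *\<^sub>R (f u - (f t + (u - t) *\<^sub>R D)))"
      if "u \<noteq> t" for u
    proof -
      have "(1 / (u - t)) *\<^sub>R (f u - f t) - D = (1 / (u - t)) *\<^sub>R (f u - (f t + (u - t) *\<^sub>R D))"
        using that by (simp add: scaleR_right_diff_distrib scaleR_right_distrib)
      then show ?thesis by simp
    qed
    then show "\<forall>\<^sub>F u in at t within T. norm ((1 / (u - t)) *\<^sub>R (f u - f t) - D)
       \<le> norm ((1 / norm (u - t)) *\<^sub>R (f u - (f t + (u - t) *\<^sub>R D)))"
      unfolding eventually_at_filter by (intro always_eventually) auto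
  qed
  then show ?thesis using LIM_zero_iff by blast
qed

section \<open>Commutators, the trace form and adjoints\<close>

lemma commutator_simps:
  "commutator w (x + y) = commutator w x + commutator w y"
  "commutator w (x - y) = commutator w x - commutator w y"
  "commutator w (r *\<^sub>R x) = r *\<^sub>R commutator w x"
  "commutator w (cscale c x) = cscale c (commutator w x)"
  "commutator w 0 = 0" "commutator w (mat 1) = 0"
  by (simp_all add: commutator_def mm.add_left mm.add_right mm.diff_left mm.diff_right
      mm.scaleR_left mm.scaleR_right mm.zero_left mm.zero_right algebra_simps cscale_mult_left cscale_mult_right)
    (simp add: cscale_def vec_eq_iff algebra_simps)

lemma cadj_commutator: "cadj (commutator w x) = - commutator (cadj w) (cadj x)"
  by (simp add: commutator_def cadj_diff cadj_mult)

text \<open>The metric, the entropy and the Fisher information are defined through real parts. The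
  form is real bilinear and symmetric on \<open>M\<close>, so Cauchy-Schwarz can be proved with a
  real parameter and no phases.\<close>

definition bra :: "('n::finite cmat \<Rightarrow> complex) \<Rightarrow> 'n cmat \<Rightarrow> 'n cmat \<Rightarrow> real" where
  "bra \<tau> x y = Re (ip \<tau> x y)"

locale trace_algebra =
  fixes M :: "'n::finite cmat set" and \<tau> :: "'n cmat \<Rightarrow> complex"
  assumes vN: "fd_vN_algebra M" and trace: "faithful_tracial_state M \<tau>"
begin

lemmas M_1 [simp] = vN_1[OF vN] and M_add [simp] = vN_add[OF vN] and M_mult [simp] = vN_mult[OF vN]
  and M_cscale [simp] = vN_cscale[OF vN] and M_cadj [simp] = vN_cadj[OF vN] and M_scaleR [simp] = vN_scaleR[OF vN]
  and M_subspace = vN_subspace[OF vN]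

lemma M_0 [simp]: "0 \<in> M" and M_diff [simp]: "x \<in> M \<Longrightarrow> y \<in> M \<Longrightarrow> x - y \<in> M"
  and M_minus [simp]: "x \<in> M \<Longrightarrow> - x \<in> M" and M_sum: "(\<And>i. i \<in> I \<Longrightarrow> f i \<in> M) \<Longrightarrow> sum f I \<in> M"
  using M_subspace by (auto simp: subspace_0 subspace_diff subspace_neg subspace_sum)

lemma M_commutator [simp]: "w \<in> M \<Longrightarrow> x \<in> M \<Longrightarrow> commutator w x \<in> M"
  by (simp add: commutator_def)

lemma tr_add: "x \<in> M \<Longrightarrow> y \<in> M \<Longrightarrow> \<tau> (x + y) = \<tau> x + \<tau> y"
  and tr_cscale: "x \<in> M \<Longrightarrow> \<tau> (cscale c x) = c * \<tau> x"
  and tr_1 [simp]: "\<tau> (mat 1) = 1"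
  and tr_commute: "x \<in> M \<Longrightarrow> y \<in> M \<Longrightarrow> \<tau> (x ** y) = \<tau> (y ** x)"
  and tr_pos: "x \<in> M \<Longrightarrow> Re (\<tau> (cadj x ** x)) \<ge> 0"
  and tr_real: "x \<in> M \<Longrightarrow> Im (\<tau> (cadj x ** x)) = 0"
  and tr_faithful: "x \<in> M \<Longrightarrow> \<tau> (cadj x ** x) = 0 \<Longrightarrow> x = 0"
  using trace by (auto simp: faithful_tracial_state_def complex_is_Real_iff)

lemma tr_scaleR: "x \<in> M \<Longrightarrow> \<tau> (r *\<^sub>R x) = r *\<^sub>R \<tau> x"
  by (simp add: cscale_of_real[symmetric] tr_cscale scaleR_conv_of_real)

lemma tr_0 [simp]: "\<tau> 0 = 0" using tr_scaleR[of 0 0] by simp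

lemma tr_minus: "x \<in> M \<Longrightarrow> \<tau> (- x) = - \<tau> x" using tr_scaleR[of x "-1"] by simp

lemma tr_diff: "x \<in> M \<Longrightarrow> y \<in> M \<Longrightarrow> \<tau> (x - y) = \<tau> x - \<tau> y"
  using tr_add[of x "- y"] by (simp add: tr_minus)

lemma tr_sum: "finite I \<Longrightarrow> (\<And>i. i \<in> I \<Longrightarrow> f i \<in> M) \<Longrightarrow> \<tau> (sum f I) = (\<Sum>i\<in>I. \<tau> (f i))"
  by (induction I rule: finite_induct) (auto simp: tr_add M_sum)

abbreviation br where "br \<equiv> bra \<tau>"

lemma br_add_left: "\<lbrakk>x \<in> M; y \<in> M; z \<in> M\<rbrakk> \<Longrightarrow> br (x + y) z = br x z + br y z"
  and br_add_right: "\<lbrakk>x \<in> M; y \<in> M; z \<in> M\<rbrakk> \<Longrightarrow> br z (x + y) = br z x + br z y"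
  and br_diff_left: "\<lbrakk>x \<in> M; y \<in> M; z \<in> M\<rbrakk> \<Longrightarrow> br (x - y) z = br x z - br y z"
  and br_diff_right: "\<lbrakk>x \<in> M; y \<in> M; z \<in> M\<rbrakk> \<Longrightarrow> br z (x - y) = br z x - br z y"
  and br_scaleR_left: "\<lbrakk>x \<in> M; z \<in> M\<rbrakk> \<Longrightarrow> br (r *\<^sub>R x) z = r * br x z"
  and br_scaleR_right: "\<lbrakk>x \<in> M; z \<in> M\<rbrakk> \<Longrightarrow> br z (r *\<^sub>R x) = r * br z x"
  and br_0_left [simp]: "br 0 z = 0" and br_0_right [simp]: "br z 0 = 0"
  by (simp_all add: bra_def ip_def cadj_add cadj_diff cadj_scaleR mm.add_left mm.add_right
      mm.diff_left mm.diff_right mm.scaleR_left mm.scaleR_right mm.zero_left mm.zero_right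
      tr_add tr_diff tr_scaleR)

lemma br_sum_right: "finite I \<Longrightarrow> (\<And>i. i \<in> I \<Longrightarrow> f i \<in> M) \<Longrightarrow> z \<in> M \<Longrightarrow> br z (sum f I) = (\<Sum>i\<in>I. br z (f i))"
  by (induction I rule: finite_induct) (auto simp: br_add_right M_sum)

lemma br_pos: "x \<in> M \<Longrightarrow> br x x \<ge> 0" by (simp add: bra_def ip_def tr_pos)

lemma br_eq_0: "x \<in> M \<Longrightarrow> br x x = 0 \<Longrightarrow> x = 0"
  by (rule tr_faithful) (simp_all add: bra_def ip_def tr_real complex_eq_iff)

text \<open>Polarisation: the trace of \<open>cadj z ** z\<close> is real for z = x + i y, and its
  imaginary part is the difference of the two sides.\<close>

lemma br_commute:
  assumes "x \<in> M" "y \<in> M" shows "br x y = br y x"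
proof -
  let ?z = "x + cscale \<i> y"
  have "cadj ?z ** ?z = cadj x ** x + cscale \<i> (cadj x ** y) + (cscale (- \<i>) (cadj y ** x) + cadj y ** y)"
    by (simp add: cadj_add cadj_cscale mm.add_left mm.add_right cscale_mult_left cscale_mult_right cscale_cscale)
      (simp add: cscale_def vec_eq_iff algebra_simps)
  then have "\<tau> (cadj ?z ** ?z) = \<tau> (cadj x ** x) + \<i> * \<tau> (cadj x ** y) + (- \<i> * \<tau> (cadj y ** x) + \<tau> (cadj y ** y))"
    using assms by (simp add: tr_add tr_cscale)
  with tr_real[of ?z] show ?thesis
    using assms by (simp add: tr_real bra_def ip_def)
qed

lemma br_mult_left: "br (a ** x) y = br x (cadj a ** y)"
  by (simp add: bra_def ip_def cadj_mult matrix_mul_assoc)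

lemma br_mult_right: "\<lbrakk>a \<in> M; x \<in> M; y \<in> M\<rbrakk> \<Longrightarrow> br (x ** a) y = br x (y ** cadj a)"
  using tr_commute[of "cadj a" "cadj x ** y"] by (simp add: bra_def ip_def cadj_mult matrix_mul_assoc)

lemma br_commutator: "\<lbrakk>w \<in> M; x \<in> M; y \<in> M\<rbrakk> \<Longrightarrow> br (commutator w x) y = br x (commutator (cadj w) y)"
  by (simp add: commutator_def br_diff_left br_diff_right br_mult_left[of w x] br_mult_right[of w x])

text \<open>Traciality moves the adjoint of \<open>w\<close> around the product, and faithfulness
  makes the adjoint map unique, as the \<open>THE\<close> in \<open>adj_map\<close>
  requires.\<close>

lemma adj_map_commutator:
  assumes "w \<in> M" "x \<in> M"
  shows "adj_map M \<tau> (commutator w) x = commutator (cadj w) x"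
  unfolding adj_map_def
proof (rule the_equality)
  have 1: "ip \<tau> (commutator w z) x = ip \<tau> z (commutator (cadj w) x)" if "z \<in> M" for z
  proof -
    have "\<tau> (cadj w ** (cadj z ** x)) = \<tau> (cadj z ** x ** cadj w)"
      using that assms by (intro tr_commute) auto
    then show ?thesis using that assms
      by (simp add: ip_def commutator_def cadj_diff cadj_mult mm.diff_left mm.diff_right tr_diff matrix_mul_assoc)
  qed
  then show "commutator (cadj w) x \<in> M \<and> (\<forall>z\<in>M. ip \<tau> (commutator w z) x = ip \<tau> z (commutator (cadj w) x))"
    using assms by simp
  fix y assume y: "y \<in> M \<and> (\<forall>z\<in>M. ip \<tau> (commutator w z) x = ip \<tau> z y)"
  let ?u = "y - commutator (cadj w) x"
  have "?u \<in> M" using y assms by simp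
  then have "ip \<tau> ?u y = ip \<tau> ?u (commutator (cadj w) x)" using y 1 by metis
  then have "br ?u ?u = 0" using y assms \<open>?u \<in> M\<close>
    by (subst br_diff_right) (auto simp: bra_def)
  then show "y = commutator (cadj w) x" using br_eq_0[OF \<open>?u \<in> M\<close>] by simp
qed

text \<open>Orthogonality of the blocks for the trace form; traciality is what moves the right
  eigenprojection to the other side. Symmetry and lower bounds of real multipliers follow
  blockwise.\<close>

lemma br_dop:
  assumes s: "cadj s = s" "s \<in> M" "cadj r = r" "r \<in> M" and xy: "x \<in> M" "y \<in> M"
  shows "br y (dop F s r x) = (\<Sum>a\<in>real_eigenvalues s. \<Sum>b\<in>real_eigenvalues r.
     F a b * br (eigenprojection s a ** y ** eigenprojection r b) (eigenprojection s a ** x ** eigenprojection r b))"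
proof -
  have e: "\<And>a. a \<in> real_eigenvalues s \<Longrightarrow> eigenprojection s a \<in> M"
    "\<And>b. b \<in> real_eigenvalues r \<Longrightarrow> eigenprojection r b \<in> M"
    using eigenprojection_in[OF vN] s by auto
  have "br y (eigenprojection s a ** x ** eigenprojection r b)
     = br (eigenprojection s a ** y ** eigenprojection r b) (eigenprojection s a ** x ** eigenprojection r b)"
    if ab: "a \<in> real_eigenvalues s" "b \<in> real_eigenvalues r" for a b
  proof -
    have "eigenprojection s a ** (eigenprojection s a ** x ** eigenprojection r b ** eigenprojection r b)
      = (eigenprojection s a ** eigenprojection s a) ** x ** (eigenprojection r b ** eigenprojection r b)"
      by (simp add: matrix_mul_assoc)
    also have "\<dots> = eigenprojection s a ** x ** eigenprojection r b"
      using s ab by (simp add: eigenprojection_mult)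
    finally show ?thesis using s ab e(1)[OF ab(1)] e(2)[OF ab(2)] xy
      by (simp add: br_mult_right[of "eigenprojection r b" "eigenprojection s a ** y"]
          br_mult_left[of "eigenprojection s a" y] cadj_eigenprojection)
  qed
  then show ?thesis
    using e xy finite_real_eigenvalues[OF s(1)] finite_real_eigenvalues[OF s(3)]
    by (simp add: dop_def br_sum_right br_scaleR_right M_sum)
qed

lemma br_dop_commute:
  assumes "cadj s = s" "s \<in> M" "cadj r = r" "r \<in> M" "x \<in> M" "y \<in> M"
  shows "br y (dop F s r x) = br x (dop F s r y)"
  using assms eigenprojection_in[OF vN]
  by (simp add: br_dop) (intro sum.cong refl arg_cong2[where f = "(*)"] br_commute, auto)

lemma br_dop_ge:
  assumes s: "cadj s = s" "s \<in> M" "cadj r = r" "r \<in> M" and x: "x \<in> M"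
    and F: "\<And>a b. a \<in> real_eigenvalues s \<Longrightarrow> b \<in> real_eigenvalues r \<Longrightarrow> c \<le> F a b"
  shows "c * br x x \<le> br x (dop F s r x)"
proof -
  have "c * br x x = br x (dop (\<lambda>_ _. c) s r x)"
    using s x by (simp add: dop_const br_scaleR_right)
  also have "\<dots> \<le> br x (dop F s r x)"
    unfolding br_dop[OF s x x] using F s x eigenprojection_in[OF vN]
    by (intro sum_mono mult_right_mono br_pos) auto
  finally show ?thesis .
qed

section \<open>Positive elements and states\<close>

lemma posdef_positive_in:
  assumes x: "cadj x = x" "x \<in> M" "\<And>r. r \<in> real_eigenvalues x \<Longrightarrow> r \<ge> 0"
  shows "positive_in M x"
  unfolding positive_in_def
proof
  show "fun_calc sqrt x \<in> M" using fun_calc_in[OF vN] x by blast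
  have "fun_calc sqrt x ** fun_calc sqrt x = fun_calc (\<lambda>r. r) x"
    using x by (subst fun_calc_mult) (auto intro!: fun_calc_cong)
  then show "x = cadj (fun_calc sqrt x) ** fun_calc sqrt x"
    using x by (simp add: cadj_fun_calc fun_calc_id)
qed

lemma positive_in_form:
  assumes "positive_in M x"
  shows "x \<in> M" "cadj x = x" "0 \<le> w \<bullet> (x *v w)" "w \<bullet> (x *v w) = 0 \<Longrightarrow> x *v w = 0"
proof -
  obtain y where y: "y \<in> M" "x = cadj y ** y" using assms by (auto simp: positive_in_def)
  then show "x \<in> M" "cadj x = x" by (simp_all add: cadj_mult)
  have *: "w \<bullet> (x *v w) = (y *v w) \<bullet> (y *v w)" for w
    by (simp add: y inner_mv matrix_vector_mul_assoc)
  show "0 \<le> w \<bullet> (x *v w)" by (simp add: *)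
  show "x *v w = 0" if "w \<bullet> (x *v w) = 0"
    using that by (simp only: *) (simp add: y matrix_vector_mul_assoc[symmetric] mv.zero_right)
qed

text \<open>Strict positivity of the quadratic form does not refer to \<open>M\<close> and suits
  compactness arguments. One direction holds because a positive element annihilates every vector on
  which its form vanishes, the other because the square root and the inverse of \<rho> are functions
  of \<rho>, hence in \<open>M\<close>.\<close>

lemma states_pos_iff: "\<rho> \<in> states_pos M \<tau> \<longleftrightarrow> \<rho> \<in> M \<and> posdef \<rho> \<and> \<tau> \<rho> = 1"
proof
  assume "\<rho> \<in> states_pos M \<tau>"
  then have pos: "positive_in M \<rho>" and "\<tau> \<rho> = 1" and inv: "invertible_in M \<rho>"
    by (auto simp: states_pos_def states_def)
  obtain y where y: "y ** \<rho> = mat 1" using inv by (auto simp: invertible_in_def)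
  have "0 < w \<bullet> (\<rho> *v w)" if "w \<noteq> 0" for w
  proof (rule ccontr)
    assume "\<not> ?thesis"
    then have "\<rho> *v w = 0" using positive_in_form[OF pos] by (metis less_eq_real_def)
    then have "y ** \<rho> *v w = 0" by (simp add: matrix_vector_mul_assoc[symmetric] mv.zero_right)
    then show False using y that by simp
  qed
  then show "\<rho> \<in> M \<and> posdef \<rho> \<and> \<tau> \<rho> = 1"
    using positive_in_form[OF pos] \<open>\<tau> \<rho> = 1\<close> by (simp add: posdef_def)
next
  assume \<rho>: "\<rho> \<in> M \<and> posdef \<rho> \<and> \<tau> \<rho> = 1"
  then have c: "cadj \<rho> = \<rho>" by simp
  have "positive_in M \<rho>" using \<rho> c posdef_eigenvalue by (intro posdef_positive_in) (auto intro: less_imp_le)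
  moreover have "invertible_in M \<rho>"
    unfolding invertible_in_def
  proof (intro bexI conjI)
    show "fun_calc inverse \<rho> \<in> M" using fun_calc_in[OF vN] \<rho> by auto
    have "fun_calc (\<lambda>r. r * inverse r) \<rho> = fun_calc (\<lambda>_. 1) \<rho>"
      using \<rho> posdef_eigenvalue[of \<rho>] by (intro fun_calc_cong right_inverse) force
    then have *: "fun_calc (\<lambda>r. r * inverse r) \<rho> = mat 1" using c by (simp add: fun_calc_const)
    have **: "fun_calc (\<lambda>r. inverse r * r) \<rho> = mat 1" using * by (simp add: mult.commute)
    show "\<rho> ** fun_calc inverse \<rho> = mat 1"
      using fun_calc_mult[OF c, of "\<lambda>r. r" inverse] * by (simp add: fun_calc_id c)
    show "fun_calc inverse \<rho> ** \<rho> = mat 1"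
      using fun_calc_mult[OF c, of inverse "\<lambda>r. r"] ** by (simp add: fun_calc_id c)
  qed
  ultimately show "\<rho> \<in> states_pos M \<tau>" using \<rho> by (simp add: states_pos_def states_def)
qed

lemma states_posD:
  assumes "\<rho> \<in> states_pos M \<tau>" shows "\<rho> \<in> M" "posdef \<rho>" "\<tau> \<rho> = 1" "cadj \<rho> = \<rho>"
  using assms by (auto simp: states_pos_iff)

lemma mat1_states_pos [simp]: "mat 1 \<in> states_pos M \<tau>"
  by (simp add: states_pos_iff posdef_def)

lemma states_pos_convex:
  assumes "\<rho> \<in> states_pos M \<tau>" "\<sigma> \<in> states_pos M \<tau>" "0 \<le> r" "r \<le> 1"
  shows "(1 - r) *\<^sub>R \<rho> + r *\<^sub>R \<sigma> \<in> states_pos M \<tau>"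
proof -
  note a = states_posD[OF assms(1)] states_posD[OF assms(2)]
  have "0 < (1 - r) * (w \<bullet> (\<rho> *v w)) + r * (w \<bullet> (\<sigma> *v w))" if "w \<noteq> 0" for w
  proof -
    have p: "0 < w \<bullet> (\<rho> *v w)" "0 < w \<bullet> (\<sigma> *v w)" using a that by (auto simp: posdef_def)
    show ?thesis
    proof (cases "r = 0")
      case False
      then show ?thesis using p assms by (intro add_nonneg_pos mult_nonneg_nonneg mult_pos_pos) auto
    qed (use p in simp)
  qed
  then show ?thesis using a assms
    by (simp add: states_pos_iff posdef_def cadj_add cadj_scaleR mv.add_left mv.scaleR_left
        inner_add_right tr_add tr_scaleR)
qed

section \<open>Logarithm and entropy\<close>

lemma mlog_in: "\<rho> \<in> states_pos M \<tau> \<Longrightarrow> mlog \<rho> \<in> M"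
  using fun_calc_in[OF vN] by (auto simp: mlog_def states_pos_iff)

lemma cadj_mlog: "\<rho> \<in> states_pos M \<tau> \<Longrightarrow> cadj (mlog \<rho>) = mlog \<rho>"
  by (simp add: mlog_def cadj_fun_calc states_posD)

text \<open>The scalar a ln a - a ln b - (a - b) is nonnegative. Used as a multiplier on the unit,
  it has the relative entropy as its trace, since the linear term vanishes for two elements of equal
  trace.\<close>

lemma Klein:
  assumes \<sigma>: "\<sigma> \<in> states_pos M \<tau>" and \<rho>: "\<rho> \<in> states_pos M \<tau>"
  shows "Re (\<tau> (\<sigma> ** mlog \<rho>)) \<le> Ent \<tau> \<sigma>"
proof -
  note a = states_posD[OF \<sigma>] states_posD[OF \<rho>]
  let ?F = "\<lambda>a b. a * ln a - a * ln b - (a - b)"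
  have "dop (\<lambda>a b. a * ln a) \<sigma> \<rho> (mat 1) = \<sigma> ** mlog \<sigma>"
    using a fun_calc_mult[of \<sigma> "\<lambda>a. a" ln]
    by (simp add: dop_left_fun[where f = "\<lambda>a. a * ln a"] fun_calc_id mlog_def)
  moreover have "dop (\<lambda>a b. a * ln b) \<sigma> \<rho> (mat 1) = \<sigma> ** mlog \<rho>"
    using a by (simp add: dop_mult dop_left_fun dop_right_fun fun_calc_id mlog_def)
  moreover have "dop (\<lambda>a b. a - b) \<sigma> \<rho> (mat 1) = \<sigma> - \<rho>"
    using a by (simp add: dop_diff dop_left_fun dop_right_fun fun_calc_id)
  ultimately have d: "dop ?F \<sigma> \<rho> (mat 1) = \<sigma> ** mlog \<sigma> - \<sigma> ** mlog \<rho> - (\<sigma> - \<rho>)"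
    by (simp only: dop_diff[of _ "\<lambda>a b. a - b"] dop_diff[of "\<lambda>a b. a * ln a"])
  have "0 * br (mat 1) (mat 1) \<le> br (mat 1) (dop ?F \<sigma> \<rho> (mat 1))"
  proof (rule br_dop_ge)
    fix x y assume "x \<in> real_eigenvalues \<sigma>" "y \<in> real_eigenvalues \<rho>"
    then have p: "x > 0" "y > 0" using posdef_eigenvalue a by blast+
    have "ln (y / x) \<le> y / x - 1" using p by (intro ln_le_minus_one) simp
    then have "x * ln (y / x) \<le> y - x" using p by (simp add: field_simps)
    then show "0 \<le> x * ln x - x * ln y - (x - y)" using p by (simp add: ln_div algebra_simps)
  qed (use a in auto)
  then show ?thesis
    using a mlog_in[OF \<sigma>] mlog_in[OF \<rho>]
    by (simp add: d bra_def ip_def tr_diff Ent_def)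
qed

lemma Ent_1 [simp]: "Ent \<tau> (mat 1) = 0"
proof -
  have "real_eigenvalues (mat 1 :: 'n cmat) \<subseteq> {1}"
    by (auto simp: real_eigenvalues_alt eigenspace_def) (metis scaleR_cancel_right scaleR_one)
  then have "fun_calc ln (mat 1 :: 'n cmat) = fun_calc (\<lambda>_. 0) (mat 1)"
    by (intro fun_calc_cong) auto
  then show ?thesis by (simp add: Ent_def mlog_def fun_calc_const mm.zero_right)
qed

lemma continuous_on_mlog:
  assumes "compact T" "continuous_on T \<gamma>" "\<And>t. t \<in> T \<Longrightarrow> \<gamma> t \<in> states_pos M \<tau>"
  shows "continuous_on T (\<lambda>t. mlog (\<gamma> t))"
proof -
  have "continuous_on T (\<lambda>t. dop (\<lambda>a b. ln a) (\<gamma> t) (\<gamma> t) (mat 1))"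
    using assms by (intro continuous_on_dop) (auto simp: states_pos_iff intro!: continuous_intros)
  then show ?thesis by (rule continuous_on_eq) (use assms in \<open>simp add: mlog_dop states_posD\<close>)
qed

lemma Re_tr_extension:
  obtains T where "bounded_linear T" "\<And>x. x \<in> M \<Longrightarrow> T x = Re (\<tau> x)"
  using extend_linear_on[OF M_subspace, of "\<lambda>x. Re (\<tau> x)"] by (auto simp: tr_add tr_scaleR)

lemma continuous_on_Re_tr:
  assumes "continuous_on T x" "\<And>t. t \<in> T \<Longrightarrow> x t \<in> M"
  shows "continuous_on T (\<lambda>t. Re (\<tau> (x t)))"
proof -
  obtain g where g: "bounded_linear g" "\<And>x. x \<in> M \<Longrightarrow> g x = Re (\<tau> x)" using Re_tr_extension by metis
  have "continuous_on T (\<lambda>t. g (x t))" by (rule bounded_linear.continuous_on[OF g(1) assms(1)])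
  then show ?thesis by (rule continuous_on_eq) (use g assms in auto)
qed

lemma continuous_on_br:
  assumes "continuous_on T x" "\<And>t. t \<in> T \<Longrightarrow> x t \<in> M" "continuous_on T y" "\<And>t. t \<in> T \<Longrightarrow> y t \<in> M"
  shows "continuous_on T (\<lambda>t. br (x t) (y t))"
  unfolding bra_def ip_def using assms
  by (intro continuous_on_Re_tr mm.continuous_on bounded_linear.continuous_on[OF bounded_linear_cadj]) auto

lemma continuous_on_Ent:
  assumes "compact T" "continuous_on T \<gamma>" "\<And>t. t \<in> T \<Longrightarrow> \<gamma> t \<in> states_pos M \<tau>"
  shows "continuous_on T (\<lambda>t. Ent \<tau> (\<gamma> t))"
  unfolding Ent_def
  by (intro continuous_on_Re_tr mm.continuous_on continuous_on_mlog assms)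
    (use assms(3) mlog_in in \<open>auto simp: states_pos_iff\<close>)

text \<open>Klein's inequality squeezes the difference quotient, so no derivative of the logarithm is needed.\<close>

lemma Ent_has_derivative:
  assumes T: "compact T" "continuous_on T \<gamma>" "\<And>t. t \<in> T \<Longrightarrow> \<gamma> t \<in> states_pos M \<tau>" and t: "t \<in> T"
    and d: "(\<gamma> has_vector_derivative \<gamma>') (at t within T)" and "\<gamma>' \<in> M"
  shows "((\<lambda>t. Ent \<tau> (\<gamma> t)) has_real_derivative br \<gamma>' (mlog (\<gamma> t))) (at t within T)"
proof -
  obtain g where g: "bounded_linear g" "\<And>x. x \<in> M \<Longrightarrow> g x = Re (\<tau> x)" using Re_tr_extension by metis
  define q where "q u = (1 / (u - t)) *\<^sub>R (\<gamma> u - \<gamma> t)" for u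
  have q: "(q \<longlongrightarrow> \<gamma>') (at t within T)"
    using has_vector_derivative_quotient[OF d] by (simp add: q_def[abs_def])
  have l: "((\<lambda>u. mlog (\<gamma> u)) \<longlongrightarrow> mlog (\<gamma> t)) (at t within T)"
    using continuous_on_mlog[OF T] t by (simp add: continuous_on)
  have A: "((\<lambda>u. g (q u ** mlog (\<gamma> t))) \<longlongrightarrow> g (\<gamma>' ** mlog (\<gamma> t))) (at t within T)"
    by (intro bounded_linear.tendsto[OF g(1)] mm.tendsto q tendsto_const)
  have B: "((\<lambda>u. g (q u ** mlog (\<gamma> u))) \<longlongrightarrow> g (\<gamma>' ** mlog (\<gamma> t))) (at t within T)"
    by (intro bounded_linear.tendsto[OF g(1)] mm.tendsto q l)
  define Q where "Q u = (Ent \<tau> (\<gamma> u) - Ent \<tau> (\<gamma> t)) / (u - t)" for u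
  \<comment> \<open>\<open>Q u\<close> lies between the quotients with the logarithm frozen at
    \<open>t\<close> and with the moving one. Their order depends on the sign of u - t, whence the
    absolute values.\<close>
  have le: "\<bar>Q u - g (q u ** mlog (\<gamma> t))\<bar> \<le> \<bar>g (q u ** mlog (\<gamma> u)) - g (q u ** mlog (\<gamma> t))\<bar>"
    if u: "u \<in> T" "u \<noteq> t" for u
  proof -
    have m: "\<gamma> u \<in> M" "\<gamma> t \<in> M" "mlog (\<gamma> u) \<in> M" "mlog (\<gamma> t) \<in> M"
      using T(3)[OF u(1)] T(3)[OF t] mlog_in by (auto simp: states_pos_iff)
    have gq: "g (q u ** w) = (Re (\<tau> (\<gamma> u ** w)) - Re (\<tau> (\<gamma> t ** w))) / (u - t)" if "w \<in> M" for w
      using m that g(2)[of "\<gamma> u ** w"] g(2)[of "\<gamma> t ** w"]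
      by (simp add: q_def mm.scaleR_left mm.diff_left linear_scale[OF bounded_linear.linear[OF g(1)]]
          linear_diff[OF bounded_linear.linear[OF g(1)]] divide_simps)
    have k: "Re (\<tau> (\<gamma> u ** mlog (\<gamma> t))) \<le> Ent \<tau> (\<gamma> u)" "Re (\<tau> (\<gamma> t ** mlog (\<gamma> u))) \<le> Ent \<tau> (\<gamma> t)"
      using Klein T(3) u t by auto
    show ?thesis
      unfolding Q_def gq[OF m(3)] gq[OF m(4)] diff_divide_distrib[symmetric] abs_divide
      using k by (intro divide_right_mono) (auto simp: Ent_def)
  qed
  have "((\<lambda>u. Q u - g (q u ** mlog (\<gamma> t))) \<longlongrightarrow> 0) (at t within T)"
  proof (rule Lim_null_comparison)
    show "\<forall>\<^sub>F u in at t within T. norm (Q u - g (q u ** mlog (\<gamma> t))) \<le> \<bar>g (q u ** mlog (\<gamma> u)) - g (q u ** mlog (\<gamma> t))\<bar>"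
      using le by (auto simp: eventually_at_filter)
    show "((\<lambda>u. \<bar>g (q u ** mlog (\<gamma> u)) - g (q u ** mlog (\<gamma> t))\<bar>) \<longlongrightarrow> 0) (at t within T)"
      using tendsto_rabs[OF tendsto_diff[OF B A]] by simp
  qed
  from tendsto_add[OF this A] have "(Q \<longlongrightarrow> g (\<gamma>' ** mlog (\<gamma> t))) (at t within T)" by simp
  moreover have "g (\<gamma>' ** mlog (\<gamma> t)) = br \<gamma>' (mlog (\<gamma> t))"
  proof -
    have m: "mlog (\<gamma> t) \<in> M" "cadj (mlog (\<gamma> t)) = mlog (\<gamma> t)" using mlog_in cadj_mlog T(3) t by auto
    have "br \<gamma>' (mlog (\<gamma> t)) = br (mlog (\<gamma> t)) \<gamma>'" using br_commute m \<open>\<gamma>' \<in> M\<close> by blast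
    also have "\<dots> = Re (\<tau> (\<gamma>' ** mlog (\<gamma> t)))"
      using m \<open>\<gamma>' \<in> M\<close> by (simp add: bra_def ip_def tr_commute)
    finally show ?thesis using g(2) m \<open>\<gamma>' \<in> M\<close> by simp
  qed
  ultimately show ?thesis by (simp add: has_field_derivative_iff Q_def[abs_def])
qed

end

subsection \<open>The semigroup and its generator\<close>

locale qms = trace_algebra M \<tau> for M :: "'n::finite cmat set" and \<tau> +
  fixes P :: "real \<Rightarrow> 'n cmat \<Rightarrow> 'n cmat" and d :: nat and v :: "nat \<Rightarrow> 'n cmat"
  assumes QMS: "quantum_Markov_semigroup M P" and symm: "tracially_symmetric M \<tau> P"
    and erg: "ergodic M \<tau> P" and Lindblad: "Lindblad_form M \<tau> P d v"
begin

abbreviation L where "L \<equiv> generator P"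
abbreviation S where "S \<equiv> states_pos M \<tau>"

lemma P_in [simp]: "t \<ge> 0 \<Longrightarrow> x \<in> M \<Longrightarrow> P t x \<in> M"
  and P_add: "t \<ge> 0 \<Longrightarrow> x \<in> M \<Longrightarrow> y \<in> M \<Longrightarrow> P t (x + y) = P t x + P t y"
  and P_0 [simp]: "x \<in> M \<Longrightarrow> P 0 x = x"
  and P_P: "s \<ge> 0 \<Longrightarrow> t \<ge> 0 \<Longrightarrow> x \<in> M \<Longrightarrow> P (s + t) x = P s (P t x)"
  and P_1 [simp]: "t \<ge> 0 \<Longrightarrow> P t (mat 1) = mat 1"
  and P_continuous: "x \<in> M \<Longrightarrow> continuous_on {0..} (\<lambda>t. P t x)"
  and P_cp: "t \<ge> 0 \<Longrightarrow> completely_positive_on M (P t)"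
  using QMS by (auto simp: quantum_Markov_semigroup_def linear_map_on_def)

lemma P_scaleR: "t \<ge> 0 \<Longrightarrow> x \<in> M \<Longrightarrow> P t (r *\<^sub>R x) = r *\<^sub>R P t x"
  using QMS by (simp add: quantum_Markov_semigroup_def linear_map_on_def cscale_of_real[symmetric])

lemma P_diff: "t \<ge> 0 \<Longrightarrow> x \<in> M \<Longrightarrow> y \<in> M \<Longrightarrow> P t (x - y) = P t x - P t y"
  using P_add[of t x "- y"] P_scaleR[of t y "-1"] by simp

lemma P_cscale: "t \<ge> 0 \<Longrightarrow> x \<in> M \<Longrightarrow> P t (cscale c x) = cscale c (P t x)"
  using QMS by (simp add: quantum_Markov_semigroup_def linear_map_on_def)

lemma P_positive:
  assumes "t \<ge> 0" "positive_in M x" shows "positive_in M (P t x)"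
proof -
  obtain y where "y \<in> M" "x = cadj y ** y" using assms by (auto simp: positive_in_def)
  then have "positive_matrix_over M 1 (\<lambda>_ _. x)"
    unfolding positive_matrix_over_def by (intro exI[of _ "\<lambda>_ _. y"]) simp
  then have "positive_matrix_over M 1 (\<lambda>_ _. P t x)"
    using P_cp[OF assms(1)] by (auto simp: completely_positive_on_def)
  then show ?thesis by (auto simp: positive_matrix_over_def positive_in_def)
qed

lemma real_eigenvalues_shift:
  "r \<in> real_eigenvalues (x - l *\<^sub>R mat 1) \<Longrightarrow> r + l \<in> real_eigenvalues x"
  by (auto simp: real_eigenvalues_alt eigenspace_def mv.diff_left mv.scaleR_left algebra_simps)

text \<open>A self-adjoint element becomes positive after subtracting a real number below its
  spectrum, and positive elements have self-adjoint images. A general element is split as a - i b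
  with \<open>a\<close> and \<open>b\<close> self-adjoint.\<close>

lemma P_cadj:
  assumes "t \<ge> 0" "x \<in> M" shows "cadj (P t x) = P t (cadj x)"
proof -
  have sa: "cadj (P t x) = P t x" if x: "x \<in> M" "cadj x = x" for x
  proof -
    obtain l where l: "\<And>r. r \<in> real_eigenvalues x \<Longrightarrow> l \<le> r"
      using finite_real_eigenvalues[OF x(2)] by (meson Min_le)
    have "positive_in M (x - l *\<^sub>R mat 1)"
      using l real_eigenvalues_shift x by (intro posdef_positive_in) (force simp: cadj_diff cadj_scaleR)+
    then have "cadj (P t (x - l *\<^sub>R mat 1)) = P t (x - l *\<^sub>R mat 1)"
      using P_positive[OF assms(1)] positive_in_form(2) by blast
    then show ?thesis using x assms(1) by (simp add: P_diff P_scaleR cadj_diff cadj_scaleR)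
  qed
  define a b where "a = (1/2) *\<^sub>R (x + cadj x)" and "b = cscale \<i> ((1/2) *\<^sub>R (x - cadj x))"
  have ab: "a \<in> M" "b \<in> M" "cadj a = a" "cadj b = b"
    using assms unfolding a_def b_def
    by (simp_all add: cadj_scaleR cadj_add cadj_cscale cadj_diff add.commute)
      (simp add: cscale_def vec_eq_iff scaleR_conv_of_real algebra_simps)
  have x: "x = a - cscale \<i> b"
  proof -
    have "x = (1/2) *\<^sub>R (x + cadj x) + (1/2) *\<^sub>R (x - cadj x)"
      by (simp add: scaleR_right_distrib scaleR_right_diff_distrib scaleR_left_distrib[symmetric])
    moreover have "cscale \<i> b = - ((1/2) *\<^sub>R (x - cadj x))"
      unfolding b_def cscale_cscale by (simp add: cscale_def vec_eq_iff scaleR_right_diff_distrib)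
    ultimately show ?thesis by (simp add: a_def)
  qed
  have m: "cscale (- c) y = - cscale c y" for c and y :: "'n cmat" by (simp add: cscale_def vec_eq_iff)
  have "cadj x = a + cscale \<i> b" using ab by (simp add: x cadj_diff cadj_cscale m)
  then show ?thesis using ab sa assms(1)
    by (simp add: x P_diff P_add P_cscale cadj_diff cadj_cscale m)
qed

lemma P_br:
  assumes "t \<ge> 0" "x \<in> M" "y \<in> M" shows "br (P t x) y = br x (P t y)"
  using symm assms M_cadj[OF assms(2)] by (simp add: bra_def ip_def P_cadj tracially_symmetric_def)

lemma P_extension:
  assumes "t \<ge> 0"
  obtains g where "bounded_linear g" "\<And>x. x \<in> M \<Longrightarrow> g x = P t x"
  using extend_linear_on[OF M_subspace, of "P t"] assms by (auto simp: P_add P_scaleR)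

lemma at_0_within_nontrivial [simp]: "at (0::real) within {0..} \<noteq> bot"
proof -
  have "{0<..} \<subseteq> {0::real..}" by auto
  from at_le[OF this, of 0] show ?thesis
    using trivial_limit_at_right_real[of 0] by (auto simp: bot_unique)
qed

section \<open>Differentiability of orbits\<close>

lemma P_integral_derivative:
  assumes "y \<in> M" "t \<ge> 0"
  shows "((\<lambda>u. integral {0..u} (\<lambda>s. P s y)) has_vector_derivative P t y) (at t within {0..})"
proof -
  have "((\<lambda>u. integral {0..u} (\<lambda>s. P s y)) has_vector_derivative P t y) (at t within {0..t + 1})"
    using assms continuous_on_subset[OF P_continuous[OF assms(1)]]
    by (intro integral_has_vector_derivative) auto
  moreover have "at t within {0..t + 1} = at t within {0..}"
    by (rule at_within_nhd[of _ "{..<t + 1}"]) auto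
  ultimately show ?thesis by simp
qed

text \<open>The coordinate projection onto \<open>M\<close> fixes every point of the orbit and
  commutes with the integral.\<close>

lemma P_integral_in:
  assumes "y \<in> M" shows "integral {0..t} (\<lambda>s. P s y) \<in> M"
proof -
  obtain B where B: "finite B" "B \<subseteq> M" "\<And>x. x \<in> M \<Longrightarrow> (\<Sum>b\<in>B. (x \<bullet> b) *\<^sub>R b) = x"
    by (rule subspace_coordinates[OF M_subspace]) (rule that, assumption+)
  define g where "g x = (\<Sum>b\<in>B. (x \<bullet> b) *\<^sub>R b)" for x
  have g: "bounded_linear g"
    unfolding g_def by (intro bounded_linear_sum bounded_linear_compose[OF bounded_linear_scaleR_left]
        bounded_linear_inner_left)
  have "(\<lambda>s. P s y) integrable_on {0..t}"
    by (intro integrable_continuous_real continuous_on_subset[OF P_continuous[OF assms]]) auto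
  then have "integral {0..t} (g \<circ> (\<lambda>s. P s y)) = g (integral {0..t} (\<lambda>s. P s y))"
    by (rule integral_linear[OF _ g])
  also have "integral {0..t} (g \<circ> (\<lambda>s. P s y)) = integral {0..t} (\<lambda>s. P s y)"
    by (rule integral_cong) (use assms B in \<open>simp add: g_def\<close>)
  finally have "integral {0..t} (\<lambda>s. P s y) = g (integral {0..t} (\<lambda>s. P s y))" .
  moreover have "g x \<in> M" for x unfolding g_def using B by (intro M_sum) auto
  ultimately show ?thesis by metis
qed

text \<open>Both sides have the same derivative in \<open>t\<close> by the semigroup law, and they
  agree at 0.\<close>

lemma P_integral_shift:
  assumes y: "y \<in> M" and "h \<ge> 0" "t \<ge> 0"
  defines "G \<equiv> \<lambda>u. integral {0..u} (\<lambda>s. P s y)"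
  shows "P h (G t) = G (t + h) - G h"
proof -
  obtain g where g: "bounded_linear g" "\<And>x. x \<in> M \<Longrightarrow> g x = P h x" using P_extension \<open>h \<ge> 0\<close> by metis
  let ?\<phi> = "\<lambda>u. G (u + h) - g (G u)"
  have "(?\<phi> has_vector_derivative 0) (at u within {0..})" if "u \<in> {0..}" for u
  proof -
    have "((G \<circ> (\<lambda>u. u + h)) has_vector_derivative 1 *\<^sub>R P (u + h) y) (at u within {0..})"
    proof (rule vector_diff_chain_within)
      show "((\<lambda>u. u + h) has_vector_derivative 1) (at u within {0..})"
        by (auto intro!: derivative_eq_intros)
      show "(G has_vector_derivative P (u + h) y) (at (u + h) within (\<lambda>u. u + h) ` {0..})"
        unfolding G_def
        by (rule has_vector_derivative_within_subset[OF P_integral_derivative]) (use that y \<open>h \<ge> 0\<close> in auto)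
    qed
    moreover have "((\<lambda>u. g (G u)) has_vector_derivative g (P u y)) (at u within {0..})"
      unfolding G_def
      by (rule bounded_linear.has_vector_derivative[OF g(1) P_integral_derivative]) (use that y in auto)
    moreover have "P (u + h) y = g (P u y)"
      using g(2) y that \<open>h \<ge> 0\<close> P_P[of h u y] by (simp add: add.commute)
    ultimately show ?thesis
      by (auto intro!: derivative_eq_intros simp: o_def)
  qed
  then obtain c where "\<And>u. u \<in> {0..} \<Longrightarrow> ?\<phi> u = c"
    using has_vector_derivative_zero_constant[of "{0..}" ?\<phi>] by (auto simp: convex_real_interval)
  from this[of t] this[of 0] \<open>t \<ge> 0\<close> have "?\<phi> t = ?\<phi> 0" by simp
  moreover have "g (G 0) = 0" by (simp add: G_def linear_0 bounded_linear.linear g)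
  ultimately have "g (G t) = G (t + h) - G h" by (simp add: algebra_simps)
  then show ?thesis using g(2) P_integral_in[OF y] by (simp add: G_def)
qed

text \<open>The vectors with differentiable orbit form a subspace, hence a closed one; it contains all
  the averages of orbits, which are dense.\<close>

lemma orbit_differentiable:
  assumes "y \<in> M"
  shows "\<exists>z\<in>M. \<forall>h\<ge>0. ((\<lambda>t. P t y) has_vector_derivative P h z) (at h within {0..})"
proof -
  define D where "D = {x \<in> M. \<exists>z\<in>M. \<forall>h\<ge>0. ((\<lambda>t. P t x) has_vector_derivative P h z) (at h within {0..})}"
  have "subspace D"
    unfolding subspace_def
  proof (intro conjI ballI allI)
    show "0 \<in> D"
    proof -
      have "P t 0 = 0" if "t \<ge> 0" for t using P_scaleR[OF that M_0, of 0] by simp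
      note P0 = this
      have "\<forall>h\<ge>0. ((\<lambda>t. P t 0) has_vector_derivative P h 0) (at h within {0..})"
      proof (intro allI impI)
        fix h :: real assume "h \<ge> 0"
        then show "((\<lambda>t. P t 0) has_vector_derivative P h 0) (at h within {0..})"
          by - (rule has_vector_derivative_transform_within[where f = "\<lambda>t. 0" and d = 1], simp_all add: P0)
      qed
      then show ?thesis unfolding D_def using M_0 by blast
    qed
    fix x x' assume "x \<in> D" "x' \<in> D"
    then obtain z z' where z: "z \<in> M" "z' \<in> M" "x \<in> M" "x' \<in> M"
      "\<And>h. h \<ge> 0 \<Longrightarrow> ((\<lambda>t. P t x) has_vector_derivative P h z) (at h within {0..})"
      "\<And>h. h \<ge> 0 \<Longrightarrow> ((\<lambda>t. P t x') has_vector_derivative P h z') (at h within {0..})"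
      unfolding D_def by blast
    have "((\<lambda>t. P t (x + x')) has_vector_derivative P h (z + z')) (at h within {0..})" if "h \<ge> 0" for h
    proof (rule has_vector_derivative_transform[where f = "\<lambda>t. P t x + P t x'"])
      show "((\<lambda>t. P t x + P t x') has_vector_derivative P h (z + z')) (at h within {0..})"
        using z that by (auto simp: P_add intro!: derivative_intros)
    qed (use z that in \<open>auto simp: P_add\<close>)
    then show "x + x' \<in> D" using z unfolding D_def by (auto intro!: bexI[of _ "z + z'"])
  next
    fix c x assume "x \<in> D"
    then obtain z where z: "z \<in> M" "x \<in> M"
      "\<And>h. h \<ge> 0 \<Longrightarrow> ((\<lambda>t. P t x) has_vector_derivative P h z) (at h within {0..})"
      unfolding D_def by blast
    have "((\<lambda>t. P t (c *\<^sub>R x)) has_vector_derivative P h (c *\<^sub>R z)) (at h within {0..})" if "h \<ge> 0" for h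
    proof (rule has_vector_derivative_transform[where f = "\<lambda>t. c *\<^sub>R P t x"])
      show "((\<lambda>t. c *\<^sub>R P t x) has_vector_derivative P h (c *\<^sub>R z)) (at h within {0..})"
        using bounded_linear.has_vector_derivative[OF bounded_linear_scaleR_right z(3)[OF that], of c] z that
        by (simp add: P_scaleR)
    qed (use z that in \<open>auto simp: P_scaleR\<close>)
    then show "c *\<^sub>R x \<in> D" using z unfolding D_def by (auto intro!: bexI[of _ "c *\<^sub>R z"])
  qed
  define G where "G u = integral {0..u} (\<lambda>s. P s y)" for u
  \<comment> \<open>\<open>P t\<close> carries an average over [0, \<delta>] to a difference of
    integrals with moving end points. This is differentiable although nothing is known yet about the
    orbit of \<open>y\<close> itself.\<close>
  have GD: "G \<delta> \<in> D" if "\<delta> > 0" for \<delta>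
  proof -
    have "((\<lambda>t. P t (G \<delta>)) has_vector_derivative P h (P \<delta> y - y)) (at h within {0..})" if h: "h \<ge> 0" for h
    proof (rule has_vector_derivative_transform[where f = "\<lambda>t. G (\<delta> + t) - G t"])
      have "((G \<circ> (\<lambda>u. \<delta> + u)) has_vector_derivative 1 *\<^sub>R P (\<delta> + h) y) (at h within {0..})"
      proof (rule vector_diff_chain_within)
        show "((\<lambda>u. \<delta> + u) has_vector_derivative 1) (at h within {0..})"
          by (auto intro!: derivative_eq_intros)
        show "(G has_vector_derivative P (\<delta> + h) y) (at (\<delta> + h) within (\<lambda>u. \<delta> + u) ` {0..})"
          unfolding G_def
          by (rule has_vector_derivative_within_subset[OF P_integral_derivative]) (use h assms \<open>\<delta> > 0\<close> in auto)
      qed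
      moreover have "(G has_vector_derivative P h y) (at h within {0..})"
        unfolding G_def by (rule P_integral_derivative[OF assms h])
      moreover have "P (\<delta> + h) y - P h y = P h (P \<delta> y - y)"
        using assms h \<open>\<delta> > 0\<close> P_P[of h \<delta> y] by (simp add: P_diff add.commute)
      ultimately show "((\<lambda>t. G (\<delta> + t) - G t) has_vector_derivative P h (P \<delta> y - y)) (at h within {0..})"
        by (auto intro!: derivative_eq_intros simp: o_def)
    qed (use h assms \<open>\<delta> > 0\<close> P_integral_shift[OF assms, of _ \<delta>] in \<open>auto simp: G_def\<close>)
    then show ?thesis using that assms P_integral_in[OF assms] unfolding D_def G_def
      by (auto intro!: bexI[of _ "P \<delta> y - y"])
  qed
  have "((\<lambda>u. (1 / (u - 0)) *\<^sub>R (G u - G 0)) \<longlongrightarrow> P 0 y) (at 0 within {0..})"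
    unfolding G_def by (rule has_vector_derivative_quotient[OF P_integral_derivative[OF assms]]) simp
  then have "((\<lambda>u. (1 / u) *\<^sub>R G u) \<longlongrightarrow> y) (at 0 within {0..})" using assms by (simp add: G_def)
  then have "y \<in> D"
  proof (rule Lim_in_closed_set[OF closed_subspace[OF \<open>subspace D\<close>], rotated 2])
    have "(1 / u) *\<^sub>R G u \<in> D" if "u \<in> {0..}" "u \<noteq> 0" for u
      using GD[of u] that \<open>subspace D\<close> by (simp add: subspace_scale)
    then show "\<forall>\<^sub>F u in at 0 within {0..}. (1 / u) *\<^sub>R G u \<in> D"
      unfolding eventually_at_filter by (intro always_eventually) auto
  qed simp
  then show ?thesis by (simp add: D_def)
qed

text \<open>\<open>Lim\<close> in \<open>generator\<close> is meaningful only once the limit exists.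
  Differentiability of the orbit at 0 supplies it and identifies \<open>L x\<close> with the
  negative derivative.\<close>

lemma L_in [simp]: "x \<in> M \<Longrightarrow> L x \<in> M"
  and P_derivative: "x \<in> M \<Longrightarrow> h \<ge> 0 \<Longrightarrow> ((\<lambda>t. P t x) has_vector_derivative - P h (L x)) (at h within {0..})"
proof -
  have "L x \<in> M \<and> (\<forall>h\<ge>0. ((\<lambda>t. P t x) has_vector_derivative - P h (L x)) (at h within {0..}))"
    if x: "x \<in> M" for x
  proof -
    obtain z where z: "z \<in> M" "\<And>h. h \<ge> 0 \<Longrightarrow> ((\<lambda>t. P t x) has_vector_derivative P h z) (at h within {0..})"
      using orbit_differentiable[OF x] by blast
    have "((\<lambda>u. (1 / (u - 0)) *\<^sub>R (P u x - P 0 x)) \<longlongrightarrow> P 0 z) (at 0 within {0..})"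
      by (rule has_vector_derivative_quotient[OF z(2)]) simp
    then have "((\<lambda>u. (1 / u) *\<^sub>R (P u x - x)) \<longlongrightarrow> z) (at 0 within {0..})" using x z by simp
    then have "((\<lambda>u. (1 / u) *\<^sub>R (P u x - x)) \<longlongrightarrow> z) (at_right 0)"
      by (rule tendsto_within_subset) auto
    from tendsto_minus[OF this] have "((\<lambda>u. (1 / u) *\<^sub>R (x - P u x)) \<longlongrightarrow> - z) (at_right 0)"
      by (simp add: scaleR_right_diff_distrib)
    then have "L x = - z" unfolding generator_def by (intro tendsto_Lim) auto
    moreover have "P h (- z) = - P h z" if "h \<ge> 0" for h using P_scaleR[OF that z(1), of "-1"] by simp
    ultimately show ?thesis using z by simp
  qed
  then show "x \<in> M \<Longrightarrow> L x \<in> M"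
    "x \<in> M \<Longrightarrow> h \<ge> 0 \<Longrightarrow> ((\<lambda>t. P t x) has_vector_derivative - P h (L x)) (at h within {0..})" by auto
qed

section \<open>Lindblad form, invariance and ergodicity\<close>

lemma v_in [simp]: "j \<in> {1..d} \<Longrightarrow> v j \<in> M"
  and v_star: "j \<in> {1..d} \<Longrightarrow> \<exists>k\<in>{1..d}. cadj (v j) = v k"
  using Lindblad unfolding Lindblad_form_def by blast+

lemma L_commutators: "x \<in> M \<Longrightarrow> L x = (\<Sum>j=1..d. commutator (cadj (v j)) (commutator (v j) x))"
  using Lindblad by (simp add: Lindblad_form_def adj_map_commutator)

lemma L_add: "x \<in> M \<Longrightarrow> y \<in> M \<Longrightarrow> L (x + y) = L x + L y"
  and L_scaleR: "x \<in> M \<Longrightarrow> L (r *\<^sub>R x) = r *\<^sub>R L x"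
  by (simp_all add: L_commutators commutator_simps sum.distrib scaleR_sum_right)

text \<open>Differentiate \<open>P h (P t x) = P t (P h x)\<close> at t = 0 in two ways.\<close>

lemma P_L:
  assumes "x \<in> M" "h \<ge> 0" shows "P h (L x) = L (P h x)"
proof -
  obtain g where g: "bounded_linear g" "\<And>x. x \<in> M \<Longrightarrow> g x = P h x" using P_extension \<open>h \<ge> 0\<close> by metis
  have "((\<lambda>t. g (P t x)) has_vector_derivative g (- P 0 (L x))) (at 0 within {0..})"
    by (rule bounded_linear.has_vector_derivative[OF g(1) P_derivative]) (use assms in auto)
  then have "((\<lambda>t. P t (P h x)) has_vector_derivative g (- P 0 (L x))) (at 0 within {0..})"
    by (rule has_vector_derivative_transform[rotated 2])
      (use assms g(2) P_P[of h] P_P[of _ h] in \<open>auto simp: add.commute\<close>)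
  moreover have "((\<lambda>t. P t (P h x)) has_vector_derivative - P 0 (L (P h x))) (at 0 within {0..})"
    by (rule P_derivative) (use assms in auto)
  ultimately have "g (- P 0 (L x)) = - P 0 (L (P h x))"
    by (intro vector_derivative_unique_within) auto
  then show ?thesis using assms g by (simp add: linear_neg bounded_linear.linear)
qed

lemma tr_P: "t \<ge> 0 \<Longrightarrow> x \<in> M \<Longrightarrow> \<tau> (P t x) = \<tau> x"
  using symm[unfolded tracially_symmetric_def, rule_format, of t x "mat 1"] by simp

lemma tr_commutator: "w \<in> M \<Longrightarrow> x \<in> M \<Longrightarrow> \<tau> (commutator w x) = 0"
  using tr_commute by (simp add: commutator_def tr_diff)

lemma tr_L: "x \<in> M \<Longrightarrow> \<tau> (L x) = 0"
  by (simp only: L_commutators, subst tr_sum) (auto intro!: sum.neutral tr_commutator)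

text \<open>After subtraction of a positive multiple of the unit below its spectrum, \<rho> is still
  positive. The semigroup preserves this positivity and fixes the unit, so it keeps the lower bound
  on the quadratic form.\<close>

lemma P_states: assumes "t \<ge> 0" "\<rho> \<in> S" shows "P t \<rho> \<in> S"
proof -
  note a = states_posD[OF assms(2)]
  \<comment> \<open>Inserting 1 makes \<open>Min\<close> well defined and positive without asking
    whether the spectrum is nonempty.\<close>
  define l where "l = Min (insert 1 (real_eigenvalues \<rho>))"
  have l: "0 < l" "\<And>r. r \<in> real_eigenvalues \<rho> \<Longrightarrow> l \<le> r"
    unfolding l_def using finite_real_eigenvalues[OF a(4)] posdef_eigenvalue[OF a(2)] by auto
  let ?x = "\<rho> - l *\<^sub>R mat 1"
  have "positive_in M ?x"
  proof (rule posdef_positive_in)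
    fix r assume "r \<in> real_eigenvalues ?x"
    then have "r + l \<in> real_eigenvalues \<rho>" by (rule real_eigenvalues_shift)
    then show "0 \<le> r" using l(2)[of "r + l"] by simp
  qed (use a in \<open>auto simp: cadj_diff cadj_scaleR\<close>)
  then have pos: "positive_in M (P t ?x)" using P_positive assms by blast
  have eq: "P t \<rho> = P t ?x + l *\<^sub>R mat 1"
    using assms a by (simp add: P_diff P_scaleR)
  have "0 < w \<bullet> (P t \<rho> *v w)" if "w \<noteq> 0" for w
    unfolding eq using positive_in_form(3)[OF pos, of w] l(1) that
    by (simp add: mv.add_left mv.scaleR_left inner_add_right add_nonneg_pos)
  moreover have "cadj (P t \<rho>) = P t \<rho>"
    unfolding eq using positive_in_form(2)[OF pos] by (simp add: cadj_add cadj_scaleR)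
  ultimately show ?thesis using assms a by (simp add: states_pos_iff posdef_def tr_P)
qed

lemma P_invariant:
  assumes "x \<in> M" "L x = 0" "t \<ge> 0" shows "P t x = x"
proof -
  have "((\<lambda>t. P t x) has_vector_derivative 0) (at h within {0..})" if "h \<in> {0..}" for h
    using P_derivative[OF assms(1), of h] that assms P_scaleR[of h 0 0] by simp
  then obtain c where "\<And>u. u \<in> {0..} \<Longrightarrow> P u x = c"
    using has_vector_derivative_zero_constant[of "{0..}" "\<lambda>t. P t x"] by (auto simp: convex_real_interval)
  from this[of 0] this[of t] assms show ?thesis by simp
qed

text \<open>The unit plus a small multiple of \<open>x\<close> is an invariant state, and ergodicity
  leaves no such state but the unit.\<close>

lemma kernel_selfadjoint:
  assumes x: "x \<in> M" "cadj x = x" "\<tau> x = 0" "L x = 0"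
  shows "x = 0"
proof -
  obtain C where C: "C > 0" "\<And>a b. norm ((a :: 'n cmat) *v b) \<le> norm a * norm b * C"
    using mv.pos_bounded by blast
  \<comment> \<open>Small enough that the perturbation changes the quadratic form by at most half of
    the squared norm.\<close>
  define e where "e = 1 / (2 * (norm x * C + 1))"
  have e: "e > 0" using C by (simp add: e_def add_nonneg_pos)
  define \<rho> where "\<rho> = mat 1 + e *\<^sub>R x"
  have "0 < w \<bullet> (\<rho> *v w)" if "w \<noteq> 0" for w
  proof -
    have "\<bar>w \<bullet> (x *v w)\<bar> \<le> norm w * (norm x * norm w * C)"
      using Cauchy_Schwarz_ineq2[of w "x *v w"] mult_left_mono[OF C(2)[of x w], of "norm w"] by simp
    then have "e * \<bar>w \<bullet> (x *v w)\<bar> \<le> e * ((norm x * C) * (norm w)\<^sup>2)"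
      using e by (intro mult_left_mono) (auto simp: power2_eq_square mult_ac)
    also have "\<dots> = (e * (norm x * C)) * (norm w)\<^sup>2" by simp
    also have "\<dots> \<le> (1 / 2) * (norm w)\<^sup>2"
    proof (rule mult_right_mono)
      have "norm x * C + 1 > 0" using C by (simp add: add_nonneg_pos)
      then show "e * (norm x * C) \<le> 1 / 2" by (simp add: e_def field_simps)
    qed simp
    finally have "e * \<bar>w \<bullet> (x *v w)\<bar> \<le> (1 / 2) * (norm w)\<^sup>2" .
    moreover have "- (e * \<bar>w \<bullet> (x *v w)\<bar>) \<le> e * (w \<bullet> (x *v w))"
      using e by (simp add: abs_if)
    moreover have "(norm w)\<^sup>2 > 0" using that by simp
    ultimately have "0 < (norm w)\<^sup>2 + e * (w \<bullet> (x *v w))" by linarith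
    then show ?thesis
      by (simp add: \<rho>_def mv.add_left mv.scaleR_left inner_add_right dot_square_norm)
  qed
  then have "\<rho> \<in> S" using x by (simp add: states_pos_iff posdef_def \<rho>_def cadj_add cadj_scaleR tr_add tr_scaleR)
  moreover have "L \<rho> = 0" using x by (simp add: \<rho>_def L_add L_scaleR) (simp add: L_commutators commutator_simps)
  then have "P t \<rho> = \<rho>" if "t \<ge> 0" for t using P_invariant x that by (simp add: \<rho>_def)
  ultimately have "\<rho> \<in> {\<rho> \<in> states M \<tau>. \<forall>t\<ge>0. P t \<rho> = \<rho>}" by (simp add: states_pos_def)
  then have "\<rho> = mat 1" using erg unfolding ergodic_def by (simp only: singleton_iff)
  then show ?thesis using e by (simp add: \<rho>_def)
qed

lemma tr_cadj: assumes "x \<in> M" shows "\<tau> (cadj x) = cnj (\<tau> x)"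
proof -
  have "Re (\<tau> (cadj x)) = Re (\<tau> x)"
    using br_commute[of x "mat 1"] assms by (simp add: bra_def ip_def)
  moreover have "Re (\<tau> (cadj (cscale \<i> x))) = Re (\<tau> (cscale \<i> x))"
    using br_commute[of "cscale \<i> x" "mat 1"] assms by (simp add: bra_def ip_def)
  ultimately show ?thesis using assms by (simp add: cadj_cscale tr_cscale complex_eq_iff)
qed

text \<open>The family \<open>v\<close> is closed under adjoints, so the adjoint of \<open>x\<close>
  has vanishing commutators as well, and both self-adjoint parts of \<open>x\<close> fall to
  ergodicity. This is the injectivity behind the metric.\<close>

lemma kernel_commutators:
  assumes x: "x \<in> M" "\<tau> x = 0" and c: "\<And>j. j \<in> {1..d} \<Longrightarrow> commutator (v j) x = 0"
  shows "x = 0"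
proof -
  have c': "commutator (v j) (cadj x) = 0" if "j \<in> {1..d}" for j
  proof -
    from v_star[OF that] obtain k where "k \<in> {1..d}" "cadj (v j) = v k" by blast
    then have "cadj (v k) = v j" by (metis cadj_cadj)
    then have "commutator (v j) (cadj x) = - cadj (commutator (v k) x)"
      by (simp add: cadj_commutator)
    then show ?thesis using c[OF \<open>k \<in> {1..d}\<close>] by simp
  qed
  let ?a = "x + cadj x" and ?b = "cscale \<i> (x - cadj x)"
  have Lz: "L z = 0" if "z \<in> M" "\<And>j. j \<in> {1..d} \<Longrightarrow> commutator (v j) z = 0" for z
    using that by (simp add: L_commutators commutator_simps)
  have "?a = 0"
  proof (rule kernel_selfadjoint)
    show "L ?a = 0" using x c c' by (intro Lz) (simp_all add: commutator_simps)
  qed (use x in \<open>simp_all add: cadj_add tr_add tr_cadj add.commute\<close>)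
  moreover have "?b = 0"
  proof (rule kernel_selfadjoint)
    show "cadj ?b = ?b" by (simp add: cadj_cscale cadj_diff) (simp add: cscale_def vec_eq_iff algebra_simps)
    have "commutator (v j) ?b = 0" if "j \<in> {1..d}" for j
      using c[OF that] c'[OF that] by (simp only: commutator_simps) (simp add: cscale_def vec_eq_iff)
    then show "L ?b = 0" using x by (intro Lz) simp_all
  qed (use x in \<open>simp_all add: tr_cscale tr_diff tr_cadj\<close>)
  then have "x = cadj x" by (simp add: cscale_def vec_eq_iff)
  ultimately have "2 *\<^sub>R x = 0" by (simp add: scaleR_2)
  then show ?thesis by simp
qed

text \<open>One basis serves for \<open>x\<close>, \<open>P t x\<close> and
  \<open>P t (L x)\<close>. Joint regularity in time and point is thereby reduced to that of
  finitely many orbits.\<close>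

lemma coordinates:
  obtains B where "finite B" "B \<subseteq> M" "\<And>x. x \<in> M \<Longrightarrow> (\<Sum>b\<in>B. (x \<bullet> b) *\<^sub>R b) = x"
    "\<And>x t. x \<in> M \<Longrightarrow> t \<ge> 0 \<Longrightarrow> (\<Sum>b\<in>B. (x \<bullet> b) *\<^sub>R P t b) = P t x"
    "\<And>x t. x \<in> M \<Longrightarrow> t \<ge> 0 \<Longrightarrow> (\<Sum>b\<in>B. (x \<bullet> b) *\<^sub>R P t (L b)) = P t (L x)"
proof -
  obtain B where B: "finite B" "B \<subseteq> M" "\<And>x. x \<in> M \<Longrightarrow> (\<Sum>b\<in>B. (x \<bullet> b) *\<^sub>R b) = x"
    by (rule subspace_coordinates[OF M_subspace]) (rule that, assumption+)
  show ?thesis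
  proof (rule that[OF B])
    fix x t assume x: "x \<in> M" "(t::real) \<ge> 0"
    show "(\<Sum>b\<in>B. (x \<bullet> b) *\<^sub>R P t b) = P t x"
      by (rule sum_in_coordinates[OF M_subspace B(1,2) B(3)[OF x(1)]]) (use x in \<open>auto simp: P_add P_scaleR\<close>)
    show "(\<Sum>b\<in>B. (x \<bullet> b) *\<^sub>R P t (L b)) = P t (L x)"
      by (rule sum_in_coordinates[OF M_subspace B(1,2) B(3)[OF x(1)], where f = "\<lambda>b. P t (L b)"])
        (use x in \<open>auto simp: P_add P_scaleR L_add L_scaleR\<close>)
  qed auto
qed

lemma continuous_on_P:
  assumes "continuous_on T f" "continuous_on T \<gamma>" "\<And>u. u \<in> T \<Longrightarrow> f u \<ge> 0" "\<And>u. u \<in> T \<Longrightarrow> \<gamma> u \<in> M"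
  shows "continuous_on T (\<lambda>u. P (f u) (\<gamma> u))"
proof -
  obtain B where B: "finite B" "B \<subseteq> M" "\<And>x. x \<in> M \<Longrightarrow> (\<Sum>b\<in>B. (x \<bullet> b) *\<^sub>R b) = x"
    "\<And>x t. x \<in> M \<Longrightarrow> t \<ge> 0 \<Longrightarrow> (\<Sum>b\<in>B. (x \<bullet> b) *\<^sub>R P t b) = P t x"
    "\<And>x t. x \<in> M \<Longrightarrow> t \<ge> 0 \<Longrightarrow> (\<Sum>b\<in>B. (x \<bullet> b) *\<^sub>R P t (L b)) = P t (L x)"
    by (rule coordinates) (rule that, assumption+)
  have "continuous_on T (\<lambda>u. \<Sum>b\<in>B. (\<gamma> u \<bullet> b) *\<^sub>R P (f u) b)"
    using B assms
    by (intro continuous_intros continuous_on_compose2[OF P_continuous]) auto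
  then show ?thesis by (rule continuous_on_eq) (use B assms in auto)
qed

lemma P_curve_derivative:
  assumes \<gamma>: "(\<gamma> has_vector_derivative \<gamma>') (at r within T)" "\<And>u. u \<in> T \<Longrightarrow> \<gamma> u \<in> M" "\<gamma>' \<in> M"
    and f: "(f has_real_derivative f') (at r within T)" "\<And>u. u \<in> T \<Longrightarrow> f u \<ge> 0" and r: "r \<in> T"
  shows "((\<lambda>u. P (f u) (\<gamma> u)) has_vector_derivative P (f r) \<gamma>' - f' *\<^sub>R P (f r) (L (\<gamma> r))) (at r within T)"
proof -
  obtain B where B: "finite B" "B \<subseteq> M" "\<And>x. x \<in> M \<Longrightarrow> (\<Sum>b\<in>B. (x \<bullet> b) *\<^sub>R b) = x"
    "\<And>x t. x \<in> M \<Longrightarrow> t \<ge> 0 \<Longrightarrow> (\<Sum>b\<in>B. (x \<bullet> b) *\<^sub>R P t b) = P t x"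
    "\<And>x t. x \<in> M \<Longrightarrow> t \<ge> 0 \<Longrightarrow> (\<Sum>b\<in>B. (x \<bullet> b) *\<^sub>R P t (L b)) = P t (L x)"
    by (rule coordinates) (rule that, assumption+)
  have Pf: "((\<lambda>u. P (f u) b) has_vector_derivative - (f' *\<^sub>R P (f r) (L b))) (at r within T)" if "b \<in> B" for b
  proof -
    have "(((\<lambda>t. P t b) \<circ> f) has_vector_derivative f' *\<^sub>R (- P (f r) (L b))) (at r within T)"
    proof (rule vector_diff_chain_within)
      show "(f has_vector_derivative f') (at r within T)"
        using f by (simp add: has_real_derivative_iff_has_vector_derivative)
      show "((\<lambda>t. P t b) has_vector_derivative - P (f r) (L b)) (at (f r) within f ` T)"
        by (rule has_vector_derivative_within_subset[OF P_derivative]) (use B that f r in auto)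
    qed
    then show ?thesis by (simp add: o_def)
  qed
  have gb: "((\<lambda>u. \<gamma> u \<bullet> b) has_real_derivative \<gamma>' \<bullet> b) (at r within T)" for b
    using bounded_linear.has_vector_derivative[OF bounded_linear_inner_left \<gamma>(1)]
    by (simp add: has_real_derivative_iff_has_vector_derivative)
  have "((\<lambda>u. \<Sum>b\<in>B. (\<gamma> u \<bullet> b) *\<^sub>R P (f u) b) has_vector_derivative
     (\<Sum>b\<in>B. (\<gamma> r \<bullet> b) *\<^sub>R (- (f' *\<^sub>R P (f r) (L b))) + (\<gamma>' \<bullet> b) *\<^sub>R P (f r) b)) (at r within T)"
    by (intro has_vector_derivative_sum has_vector_derivative_scaleR gb Pf)
  also have "(\<Sum>b\<in>B. (\<gamma> r \<bullet> b) *\<^sub>R (- (f' *\<^sub>R P (f r) (L b))) + (\<gamma>' \<bullet> b) *\<^sub>R P (f r) b)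
     = P (f r) \<gamma>' - f' *\<^sub>R P (f r) (L (\<gamma> r))"
  proof -
    have "(\<Sum>b\<in>B. (\<gamma> r \<bullet> b) *\<^sub>R (- (f' *\<^sub>R P (f r) (L b))) + (\<gamma>' \<bullet> b) *\<^sub>R P (f r) b)
      = (\<Sum>b\<in>B. (\<gamma>' \<bullet> b) *\<^sub>R P (f r) b) - f' *\<^sub>R (\<Sum>b\<in>B. (\<gamma> r \<bullet> b) *\<^sub>R P (f r) (L b))"
      by (simp add: sum_subtractf scaleR_sum_right mult.commute)
    then show ?thesis using B(4)[OF \<gamma>(3) f(2)[OF r]] B(5)[OF \<gamma>(2)[OF r] f(2)[OF r]] by simp
  qed
  finally show ?thesis
    by (rule has_vector_derivative_transform[rotated 2]) (use B \<gamma> f r in auto)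
qed

end

subsection \<open>The metric tensor and the dual gradient estimate\<close>

lemma discriminant_le:
  fixes A C D :: real
  assumes "\<And>t. 0 \<le> A + 2 * t * D + t\<^sup>2 * C" shows "D\<^sup>2 \<le> A * C"
proof (cases "C = 0")
  case True
  have "D = 0"
  proof (rule ccontr)
    assume "D \<noteq> 0"
    \<comment> \<open>The affine function A + 2 t D takes the value - 1 at this point.\<close>
    then show False using assms[of "- (A + 1) / (2 * D)"] True by (simp add: field_simps)
  qed
  then show ?thesis using True by simp
next
  case False
  have "C > 0"
  proof (rule ccontr)
    assume "\<not> C > 0"
    then have "C < 0" using False by simp
    \<comment> \<open>Chosen so that \<open>t * C\<close> outweighs |A| + 2 |D|, which refutes a
      negative leading coefficient.\<close>
    define t where "t = 1 + (\<bar>A\<bar> + 2 * \<bar>D\<bar>) / (- C)"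
    have t: "t \<ge> 1" using \<open>C < 0\<close> by (simp add: t_def divide_nonneg_neg)
    have "t * (- C) = - C + \<bar>A\<bar> + 2 * \<bar>D\<bar>" using \<open>C < 0\<close> by (simp add: t_def field_simps)
    then have *: "t * C = C - \<bar>A\<bar> - 2 * \<bar>D\<bar>" by simp
    have "A + 2 * t * D + t\<^sup>2 * C = A + t * (2 * D + t * C)"
      by (simp add: algebra_simps power2_eq_square)
    also have "\<dots> = A + t * (2 * D + C - \<bar>A\<bar> - 2 * \<bar>D\<bar>)" by (simp add: *)
    also have "\<dots> \<le> A + t * (C - \<bar>A\<bar>)" using t by (intro add_left_mono mult_left_mono) auto
    also have "\<dots> \<le> A + 1 * (C - \<bar>A\<bar>)"
      using t \<open>C < 0\<close> by (intro add_left_mono mult_right_mono_neg) auto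
    also have "\<dots> < 0" using \<open>C < 0\<close> by simp
    finally show False using assms[of t] by simp
  qed
  then show ?thesis using assms[of "- D / C"] by (simp add: field_simps power2_eq_square)
qed

lemma exp_quot_nonneg: "r \<ge> 0 \<Longrightarrow> exp_quot K r \<ge> 0"
  by (cases "K > 0") (auto simp: exp_quot_def divide_nonneg_pos mult_nonneg_nonneg
      intro!: divide_nonpos_neg mult_nonpos_nonneg)

text \<open>A product bound linearised with a free weight. In \<open>speed_inequality\<close> the
  weight is exp(- 2 K t), which makes the factor in front of the transported speed equal to 1 on the
  right.\<close>

lemma AMGM_square:
  fixes q X A :: real
  assumes "q\<^sup>2 \<le> X * A" "X \<ge> 0" "A \<ge> 0" "l > 0"
  shows "2 * q \<le> l * X + A / l"
proof (rule power2_le_imp_le)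
  have "(2 * q)\<^sup>2 \<le> 4 * ((l * X) * (A / l))" using assms by (simp add: power_mult_distrib)
  also have "\<dots> \<le> (l * X + A / l)\<^sup>2"
  proof -
    have "4 * (U * V) \<le> (U + V)\<^sup>2" for U V :: real
      using sum_squares_bound[of U V] by (simp add: power2_sum)
    then show ?thesis .
  qed
  finally show "(2 * q)\<^sup>2 \<le> (l * X + A / l)\<^sup>2" .
qed (use assms in simp)

context qms
begin

text \<open>All traceless elements, self-adjoint or not, since \<open>metric\<close> inverts
  \<open>K_op\<close> on this set; the tangent vectors form its self-adjoint part.\<close>

definition M0 where "M0 = {z \<in> M. \<tau> z = 0}"

text \<open>\<open>K_op\<close> with the adjoint and the logarithmic mean replaced by explicit
  expressions, so that it is linear on all matrices. The two agree on \<open>M\<close> at every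
  invertible state.\<close>

definition Kf where
  "Kf \<rho> x = (\<Sum>j=1..d. commutator (cadj (v j)) (dop Lam \<rho> \<rho> (commutator (v j) x)))"

definition J where "J \<rho> = the_inv_into M0 (Kf \<rho>)"

lemma M0_in: "z \<in> M0 \<Longrightarrow> z \<in> M" by (simp add: M0_def)

lemma M0_subspace: "subspace M0"
  by (simp add: subspace_def M0_def tr_add tr_scaleR)

lemma L_M0: "x \<in> M \<Longrightarrow> L x \<in> M0" by (simp add: M0_def tr_L)

lemma P_M0: "t \<ge> 0 \<Longrightarrow> x \<in> M0 \<Longrightarrow> P t x \<in> M0" by (simp add: M0_def tr_P)

lemma linear_Kf: "linear (Kf \<rho>)"
  by (auto intro!: linearI simp: Kf_def commutator_simps dop_simps sum.distrib scaleR_sum_right)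

lemma dop_Lam_in: "\<rho> \<in> S \<Longrightarrow> x \<in> M \<Longrightarrow> dop Lam \<rho> \<rho> x \<in> M"
  using dop_in[OF vN] states_posD by blast

lemma K_op_Kf: "\<rho> \<in> S \<Longrightarrow> x \<in> M \<Longrightarrow> K_op M \<tau> d v \<rho> x = Kf \<rho> x"
  unfolding K_op_def Kf_def
  by (intro sum.cong refl) (simp add: adj_map_commutator log_mean_dop states_posD dop_Lam_in)

lemma Kf_in: "\<rho> \<in> S \<Longrightarrow> x \<in> M \<Longrightarrow> Kf \<rho> x \<in> M"
  unfolding Kf_def by (intro M_sum) (simp add: dop_Lam_in)

lemma Kf_M0:
  assumes "\<rho> \<in> S" "x \<in> M" shows "Kf \<rho> x \<in> M0"
proof -
  have "\<tau> (Kf \<rho> x) = 0"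
    unfolding Kf_def using assms
    by (subst tr_sum) (auto intro!: sum.neutral tr_commutator simp: dop_Lam_in)
  then show ?thesis using Kf_in[OF assms] by (simp add: M0_def)
qed

lemma br_Kf:
  assumes "\<rho> \<in> S" "a \<in> M" "b \<in> M"
  shows "br a (Kf \<rho> b) = (\<Sum>j=1..d. br (commutator (v j) a) (dop Lam \<rho> \<rho> (commutator (v j) b)))"
proof -
  have "br a (Kf \<rho> b) = (\<Sum>j=1..d. br a (commutator (cadj (v j)) (dop Lam \<rho> \<rho> (commutator (v j) b))))"
    unfolding Kf_def using assms by (intro br_sum_right) (simp_all add: dop_Lam_in)
  also have "\<dots> = (\<Sum>j=1..d. br (commutator (v j) a) (dop Lam \<rho> \<rho> (commutator (v j) b)))"
    using assms by (intro sum.cong refl) (simp add: br_commutator dop_Lam_in)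
  finally show ?thesis .
qed

lemma br_Kf_commute:
  assumes "\<rho> \<in> S" "a \<in> M" "b \<in> M" shows "br a (Kf \<rho> b) = br b (Kf \<rho> a)"
  unfolding br_Kf[OF assms] br_Kf[OF assms(1,3,2)] using assms
  by (intro sum.cong refl br_dop_commute) (simp_all add: states_posD)

text \<open>The logarithmic mean of two eigenvalues is at least the smallest eigenvalue, so at an
  invertible state the logarithmic mean operator is coercive.\<close>

lemma br_dop_Lam:
  assumes "\<rho> \<in> S" obtains c where "c > 0" "\<And>x. x \<in> M \<Longrightarrow> c * br x x \<le> br x (dop Lam \<rho> \<rho> x)"
proof -
  note a = states_posD[OF assms]
  define l where "l = Min (insert 1 (real_eigenvalues \<rho>))"
  have l: "0 < l" "\<And>r. r \<in> real_eigenvalues \<rho> \<Longrightarrow> l \<le> r"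
    unfolding l_def using finite_real_eigenvalues[OF a(4)] posdef_eigenvalue[OF a(2)] by auto
  show ?thesis
    by (rule that[OF l(1)], rule br_dop_ge) (use a l in \<open>auto intro: Lam_ge\<close>)
qed

lemma br_Kf_pos:
  assumes "\<rho> \<in> S" "a \<in> M" shows "0 \<le> br a (Kf \<rho> a)"
proof -
  obtain c where c: "c > 0" "\<And>x. x \<in> M \<Longrightarrow> c * br x x \<le> br x (dop Lam \<rho> \<rho> x)"
    by (rule br_dop_Lam[OF assms(1)]) (rule that, assumption+)
  have "0 \<le> br x (dop Lam \<rho> \<rho> x)" if "x \<in> M" for x
    using c(2)[OF that] mult_nonneg_nonneg[of c "br x x"] c(1) br_pos[OF that] by linarith
  then show ?thesis unfolding br_Kf[OF assms assms(2)] using assms by (intro sum_nonneg) simp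
qed

text \<open>Coercivity forces every commutator with \<open>a\<close> to vanish, and ergodicity does
  the rest.\<close>

lemma br_Kf_eq_0:
  assumes "\<rho> \<in> S" "a \<in> M0" "br a (Kf \<rho> a) = 0" shows "a = 0"
proof -
  have a: "a \<in> M" "\<tau> a = 0" using assms by (auto simp: M0_def)
  obtain c where c: "c > 0" "\<And>x. x \<in> M \<Longrightarrow> c * br x x \<le> br x (dop Lam \<rho> \<rho> x)"
    by (rule br_dop_Lam[OF assms(1)]) (rule that, assumption+)
  have "c * br (commutator (v j) a) (commutator (v j) a) \<le> br (commutator (v j) a) (dop Lam \<rho> \<rho> (commutator (v j) a))"
    if "j \<in> {1..d}" for j using that a by (intro c(2)) simp
  then have "(\<Sum>j=1..d. c * br (commutator (v j) a) (commutator (v j) a)) \<le> 0"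
    using assms(3) unfolding br_Kf[OF assms(1) a(1) a(1)] by (metis (no_types, lifting) sum_mono)
  moreover have nn: "0 \<le> c * br (commutator (v j) a) (commutator (v j) a)" if "j \<in> {1..d}" for j
    using that a c(1) by (simp add: br_pos)
  ultimately have "(\<Sum>j=1..d. c * br (commutator (v j) a) (commutator (v j) a)) = 0"
    by (meson antisym sum_nonneg)
  then have "c * br (commutator (v j) a) (commutator (v j) a) = 0" if "j \<in> {1..d}" for j
    using nn that by (subst (asm) sum_nonneg_eq_0_iff) auto
  then have "commutator (v j) a = 0" if "j \<in> {1..d}" for j
    using c(1) a that br_eq_0[of "commutator (v j) a"] by simp
  then show ?thesis using kernel_commutators a by blast
qed

lemma br_Kf_Cauchy_Schwarz:
  assumes "\<rho> \<in> S" "a \<in> M" "b \<in> M"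
  shows "(br a (Kf \<rho> b))\<^sup>2 \<le> br a (Kf \<rho> a) * br b (Kf \<rho> b)"
proof (rule discriminant_le)
  fix t
  have "0 \<le> br (a + t *\<^sub>R b) (Kf \<rho> (a + t *\<^sub>R b))" using assms by (intro br_Kf_pos) auto
  also have "\<dots> = br a (Kf \<rho> a) + 2 * t * br a (Kf \<rho> b) + t\<^sup>2 * br b (Kf \<rho> b)"
    using assms br_Kf_commute[OF assms]
    by (simp add: linear_add[OF linear_Kf] linear_scale[OF linear_Kf] br_add_left br_add_right
        br_scaleR_left br_scaleR_right Kf_in power2_eq_square algebra_simps)
  finally show "0 \<le> br a (Kf \<rho> a) + 2 * t * br a (Kf \<rho> b) + t\<^sup>2 * br b (Kf \<rho> b)" .
qed

lemma normsq_grad: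
  assumes "\<rho> \<in> S" "a \<in> M" shows "normsq_hat \<tau> d \<rho> (grad v a) = br a (Kf \<rho> a)"
proof -
  have "normsq_hat \<tau> d \<rho> (grad v a)
     = (\<Sum>j=1..d. br (dop Lam \<rho> \<rho> (commutator (v j) a)) (commutator (v j) a))"
    using assms by (simp add: normsq_hat_def ip_hat_def grad_def log_mean_dop states_posD bra_def)
  also have "\<dots> = br a (Kf \<rho> a)"
    unfolding br_Kf[OF assms assms(2)] using assms
    by (intro sum.cong refl br_commute) (simp_all add: dop_Lam_in)
  finally show ?thesis .
qed

text \<open>The gradient flow structure. It is stated with \<open>Kf\<close> instead of its inverse
  because \<open>mlog \<rho>\<close> need not be traceless.\<close>

lemma Kf_mlog: "\<rho> \<in> S \<Longrightarrow> Kf \<rho> (mlog \<rho>) = L \<rho>"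
  by (simp add: Kf_def L_commutators states_posD log_mean_dop[symmetric] log_mean_commutator_mlog)

lemma Kf_inj: assumes "\<rho> \<in> S" shows "inj_on (Kf \<rho>) M0"
proof (rule inj_onI)
  fix x y assume xy: "x \<in> M0" "y \<in> M0" "Kf \<rho> x = Kf \<rho> y"
  then have "Kf \<rho> (x - y) = 0" by (simp add: linear_diff[OF linear_Kf])
  moreover have "x - y \<in> M0" using xy M0_subspace by (simp add: subspace_diff)
  ultimately show "x = y" using br_Kf_eq_0[OF assms, of "x - y"] by simp
qed

lemma Kf_surj: assumes "\<rho> \<in> S" shows "Kf \<rho> ` M0 = M0"
proof (rule subspace_dim_equal)
  show "subspace (Kf \<rho> ` M0)" by (rule linear_subspace_image[OF linear_Kf M0_subspace])
  show "Kf \<rho> ` M0 \<subseteq> M0" using Kf_M0[OF assms] M0_in by blast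
  have span: "span M0 = M0" using M0_subspace by (simp only: span_eq_iff)
  have "inj_on (Kf \<rho>) (span M0)" unfolding span by (rule Kf_inj[OF assms])
  then have "dim (Kf \<rho> ` M0) = dim M0" by (rule dim_image_eq[OF linear_Kf])
  then show "dim (Kf \<rho> ` M0) \<ge> dim M0" by simp
qed (rule M0_subspace)

lemma J_in: "\<rho> \<in> S \<Longrightarrow> x \<in> M0 \<Longrightarrow> J \<rho> x \<in> M0"
  unfolding J_def by (rule the_inv_into_into[OF Kf_inj]) (auto simp: Kf_surj)

lemma Kf_J: "\<rho> \<in> S \<Longrightarrow> x \<in> M0 \<Longrightarrow> Kf \<rho> (J \<rho> x) = x"
  unfolding J_def by (rule f_the_inv_into_f[OF Kf_inj]) (auto simp: Kf_surj)

lemma J_scaleR: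
  assumes "\<rho> \<in> S" "x \<in> M0" shows "J \<rho> (c *\<^sub>R x) = c *\<^sub>R J \<rho> x"
  unfolding J_def[of \<rho>]
proof (rule the_inv_into_f_eq[OF Kf_inj])
  show "Kf \<rho> (c *\<^sub>R the_inv_into M0 (Kf \<rho>) x) = c *\<^sub>R x"
    using Kf_J[OF assms] by (simp add: linear_scale[OF linear_Kf] J_def)
qed (use assms J_in[OF assms] M0_subspace in \<open>simp_all add: J_def subspace_scale\<close>)

abbreviation met where "met \<rho> x \<equiv> metric M \<tau> d v \<rho> x x"

text \<open>\<open>K_op\<close> and \<open>Kf\<close> are known to agree on \<open>M\<close> but not
  elsewhere, so the two inverses are compared through the predicates that define them.\<close>

lemma metric_J:
  assumes "\<rho> \<in> S" shows "metric M \<tau> d v \<rho> x y = br x (J \<rho> y)"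
proof -
  have "(z \<in> {z \<in> M. \<tau> z = 0} \<and> K_op M \<tau> d v \<rho> z = y) = (z \<in> M0 \<and> Kf \<rho> z = y)" for z
    using K_op_Kf[OF assms] by (auto simp: M0_def)
  then show ?thesis by (simp add: metric_def J_def the_inv_into_def bra_def)
qed

lemma met_nonneg: "\<rho> \<in> S \<Longrightarrow> x \<in> M0 \<Longrightarrow> 0 \<le> met \<rho> x"
  using br_Kf_pos[of \<rho> "J \<rho> x"] J_in[of \<rho> x] M0_in
  by (simp add: metric_J Kf_J br_commute)

lemma met_scaleR: "\<rho> \<in> S \<Longrightarrow> x \<in> M0 \<Longrightarrow> met \<rho> (c *\<^sub>R x) = c\<^sup>2 * met \<rho> x"
  using J_in[of \<rho> x] M0_in
  by (simp add: metric_J J_scaleR br_scaleR_left br_scaleR_right power2_eq_square)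

text \<open>Symmetry of \<open>Kf\<close> trades \<open>mlog \<rho>\<close> for the traceless
  potential of \<open>L \<rho>\<close>. The flow thus has the square root of the Fisher information
  as its speed, the source of the last term in the HWI inequality.\<close>

lemma Fisher_met:
  assumes "\<rho> \<in> S" shows "Fisher \<tau> P \<rho> = met \<rho> (L \<rho>)"
proof -
  have m: "mlog \<rho> \<in> M" "L \<rho> \<in> M" "L \<rho> \<in> M0" "J \<rho> (L \<rho>) \<in> M" "\<rho> \<in> M"
    using mlog_in[OF assms] states_posD(1)[OF assms] L_M0 J_in[OF assms] M0_in by auto
  have "met \<rho> (L \<rho>) = br (J \<rho> (L \<rho>)) (Kf \<rho> (mlog \<rho>))"
    using m assms by (simp add: metric_J Kf_mlog br_commute)
  also have "\<dots> = br (mlog \<rho>) (L \<rho>)" using m assms by (simp add: br_Kf_commute Kf_J)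
  also have "\<dots> = Fisher \<tau> P \<rho>"
    using m assms by (simp add: bra_def ip_def cadj_mlog Fisher_def tr_commute)
  finally show ?thesis ..
qed

text \<open>GE is tested with the potential \<open>a\<close> of the velocity \<open>z\<close> of the
  transported curve, and symmetry of the semigroup gives
  \<open>br (P t a) x = met \<sigma> z + c * e\<close>. Here \<open>c\<close> is the derivative of
  the running time and \<open>e\<close> that of the entropy; the latter equals the real part of the
  Dirichlet form occurring in GE.\<close>

lemma speed_inequality:
  fixes c :: real
  assumes GE: "GE M \<tau> P d v K N" and "N > 0" and \<rho>: "\<rho> \<in> S" and t: "t \<ge> 0" and x: "x \<in> M0"
  defines "\<sigma> \<equiv> P t \<rho>" and "z \<equiv> P t x - c *\<^sub>R L (P t \<rho>)"
  defines "e \<equiv> br z (mlog \<sigma>)"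
  shows "met \<sigma> z \<le> exp (- 2 * K * t) * met \<rho> x - 2 * c * e - exp (2 * K * t) * exp_quot K (2 * t) / N * e\<^sup>2"
proof -
  have \<sigma>: "\<sigma> \<in> S" using P_states[OF t \<rho>] by (simp add: \<sigma>_def)
  note m = states_posD(1)[OF \<rho>] states_posD(1)[OF \<sigma>] mlog_in[OF \<sigma>]
  have z: "z \<in> M0" unfolding z_def \<sigma>_def[symmetric]
    using m L_M0 P_M0[OF t x] M0_subspace by (simp add: subspace_diff subspace_scale)
  define a b where "a = J \<sigma> z" and "b = J \<rho> x"
  have ab: "a \<in> M0" "Kf \<sigma> a = z" "b \<in> M0" "Kf \<rho> b = x"
    using J_in Kf_J \<sigma> \<rho> z x by (auto simp: a_def b_def)
  note ab' = M0_in[OF ab(1)] M0_in[OF ab(3)] M0_in[OF z] M0_in[OF x]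
  have Z: "met \<sigma> z = br a (Kf \<sigma> a)" using \<sigma> ab ab' by (simp add: metric_J a_def[symmetric] br_commute)
  have X: "met \<rho> x = br b (Kf \<rho> b)" using \<rho> ab ab' by (simp add: metric_J b_def[symmetric] br_commute)
  have e: "e = br a (L \<sigma>)"
    using br_Kf_commute[OF \<sigma> m(3) ab'(1)] ab ab' m by (simp add: e_def Kf_mlog[OF \<sigma>] br_commute)
  have q: "br (P t a) (Kf \<rho> b) = met \<sigma> z + c * e"
  proof -
    have "P t x = z + c *\<^sub>R L \<sigma>" by (simp add: z_def \<sigma>_def)
    then have "br (P t a) (Kf \<rho> b) = br a z + c * br a (L \<sigma>)"
      using ab ab' m t by (simp add: P_br br_add_right br_scaleR_right)
    then show ?thesis using \<sigma> e by (simp add: metric_J a_def[symmetric] br_commute ab')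
  qed
  have ge: "br (P t a) (Kf \<rho> (P t a)) \<le> exp (- 2 * K * t) * met \<sigma> z - exp_quot K (2 * t) / N * e\<^sup>2"
  proof -
    have "br (P t a) (Kf \<rho> (P t a)) \<le> exp (- 2 * K * t) * met \<sigma> z
            - exp_quot K (2 * t) / N * (cmod (Dirichlet_form \<tau> P a \<sigma>))\<^sup>2"
      using GE[unfolded GE_def, rule_format, OF t ab'(1) \<rho>] t \<rho> \<sigma> ab' m
      by (simp add: normsq_grad Z \<sigma>_def[symmetric])
    \<comment> \<open>The modulus in GE is lowered to the real part. This weakens the bound because
      the subtracted coefficient is nonnegative.\<close>
    moreover have "e\<^sup>2 \<le> (cmod (Dirichlet_form \<tau> P a \<sigma>))\<^sup>2"
    proof -
      have "e = Re (Dirichlet_form \<tau> P a \<sigma>)" by (simp add: e bra_def Dirichlet_form_def)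
      then show ?thesis by (simp add: abs_Re_le_cmod abs_le_square_iff[symmetric])
    qed
    then have "exp_quot K (2 * t) / N * e\<^sup>2 \<le> exp_quot K (2 * t) / N * (cmod (Dirichlet_form \<tau> P a \<sigma>))\<^sup>2"
      using exp_quot_nonneg[of "2 * t" K] t \<open>N > 0\<close> by (intro mult_left_mono) auto
    ultimately show ?thesis by linarith
  qed
  let ?A = "exp (- 2 * K * t) * met \<sigma> z - exp_quot K (2 * t) / N * e\<^sup>2"
  have A0: "0 \<le> br (P t a) (Kf \<rho> (P t a))" using \<rho> t ab' by (intro br_Kf_pos) auto
  have "(met \<sigma> z + c * e)\<^sup>2 \<le> br (P t a) (Kf \<rho> (P t a)) * br b (Kf \<rho> b)"
    unfolding q[symmetric] using \<rho> t ab' by (intro br_Kf_Cauchy_Schwarz) auto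
  also have "\<dots> \<le> ?A * met \<rho> x"
    unfolding X using ge br_Kf_pos[OF \<rho> ab'(2)] by (intro mult_right_mono)
  finally have "(met \<sigma> z + c * e)\<^sup>2 \<le> met \<rho> x * ?A" by (simp add: mult.commute)
  then have "2 * (met \<sigma> z + c * e) \<le> exp (- 2 * K * t) * met \<rho> x + ?A / exp (- 2 * K * t)"
    using A0 ge met_nonneg[OF \<rho> x] by (intro AMGM_square) auto
  also have "?A / exp (- 2 * K * t) = met \<sigma> z - exp (2 * K * t) * exp_quot K (2 * t) / N * e\<^sup>2"
  proof -
    have "exp (- 2 * K * t) = 1 / exp (2 * K * t)" by (simp add: exp_minus divide_inverse)
    moreover have "(1 / E * Z - q) / (1 / E) = Z - E * q" if "E > 0" for E Z q :: real
      using that by (simp add: field_simps)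
    ultimately show ?thesis by (simp add: mult.assoc)
  qed
  finally show ?thesis by (simp add: algebra_simps)
qed

lemma met_contraction:
  assumes "GE M \<tau> P d v K N" "N > 0" "\<rho> \<in> S" "t \<ge> 0" "x \<in> M0"
  shows "met (P t \<rho>) (P t x) \<le> exp (- 2 * K * t) * met \<rho> x"
proof -
  have "0 \<le> exp (2 * K * t) * exp_quot K (2 * t) / N * (br (P t x) (mlog (P t \<rho>)))\<^sup>2"
    using assms by (intro mult_nonneg_nonneg divide_nonneg_nonneg) (auto simp: exp_quot_nonneg)
  then show ?thesis using speed_inequality[OF assms, of 0] by simp
qed

section \<open>Continuity of the metric\<close>

lemma continuous_on_Kf:
  fixes \<gamma> x :: "'a::topological_space \<Rightarrow> 'n cmat"
  assumes "compact T" "continuous_on T \<gamma>" "continuous_on T x" "\<And>t. t \<in> T \<Longrightarrow> \<gamma> t \<in> S"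
  shows "continuous_on T (\<lambda>t. Kf (\<gamma> t) (x t))"
  unfolding Kf_def commutator_def using assms
  by (intro continuous_on_sum continuous_on_diff mm.continuous_on continuous_on_const
      continuous_on_dop continuous_on_Lam) (auto simp: states_posD)

text \<open>Compactness of \<open>T\<close> times the unit sphere of \<open>M0\<close> gives one
  lower bound \<open>c\<close> for all the operators \<open>Kf (\<gamma> t)\<close>, hence a uniform
  bound on their inverses. The increment of the potential is then controlled by a residual that
  tends to 0.\<close>

lemma continuous_on_J:
  fixes \<gamma> x :: "real \<Rightarrow> 'n cmat"
  assumes T: "compact T" "continuous_on T \<gamma>" "continuous_on T x"
    and \<gamma>: "\<And>t. t \<in> T \<Longrightarrow> \<gamma> t \<in> S" and x: "\<And>t. t \<in> T \<Longrightarrow> x t \<in> M0"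
  shows "continuous_on T (\<lambda>t. J (\<gamma> t) (x t))"
proof -
  have "\<exists>c>0. \<forall>t\<in>T. \<forall>a\<in>M0. c * norm a \<le> norm (Kf (\<gamma> t) a)"
  \<comment> \<open>The product is empty if \<open>T\<close> is empty or \<open>M0\<close> is zero;
    there is then no minimum to take, and any constant works.\<close>
  proof (cases "T \<times> (M0 \<inter> sphere 0 1) = {}")
    case True
    have "a = 0" if "t \<in> T" "a \<in> M0" for t a
    proof (rule ccontr)
      assume "a \<noteq> 0"
      then have "(1 / norm a) *\<^sub>R a \<in> M0 \<inter> sphere 0 1" using that M0_subspace by (simp add: subspace_scale)
      then show False using True that by blast
    qed
    then have "\<forall>t\<in>T. \<forall>a\<in>M0. 1 * norm a \<le> norm (Kf (\<gamma> t) a)" by (metis mult_1 norm_ge_zero norm_zero)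
    then show ?thesis using zero_less_one by blast
  next
    case False
    let ?S = "T \<times> (M0 \<inter> sphere 0 1)"
    have c: "compact ?S"
      using T(1) closed_subspace[OF M0_subspace] by (intro compact_Times) (auto simp: closed_Int_compact)
    have "continuous_on ?S (\<lambda>p. norm (Kf (\<gamma> (fst p)) (snd p)))"
      using c \<gamma> by (intro continuous_on_norm continuous_on_Kf continuous_on_compose2[OF T(2)] continuous_intros) auto
    then obtain p where p: "p \<in> ?S" "\<And>q. q \<in> ?S \<Longrightarrow> norm (Kf (\<gamma> (fst p)) (snd p)) \<le> norm (Kf (\<gamma> (fst q)) (snd q))"
      using continuous_attains_inf[OF c False] by blast
    let ?c = "norm (Kf (\<gamma> (fst p)) (snd p))"
    have pc: "?c > 0"
    proof -
      have "snd p \<noteq> 0" "snd p \<in> M0" "fst p \<in> T" using p(1) by auto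
      then show ?thesis using br_Kf_eq_0[OF \<gamma>, of "fst p" "snd p"] by force
    qed
    have "?c * norm a \<le> norm (Kf (\<gamma> t) a)" if "t \<in> T" "a \<in> M0" for t a
    proof (cases "a = 0")
      case False
      then have "(t, (1 / norm a) *\<^sub>R a) \<in> ?S" using that M0_subspace by (simp add: subspace_scale)
      from p(2)[OF this] show ?thesis using False
        by (simp add: linear_scale[OF linear_Kf] field_simps)
    qed simp
    then show ?thesis using pc by blast
  qed
  then obtain c where c: "c > 0" "\<And>t a. t \<in> T \<Longrightarrow> a \<in> M0 \<Longrightarrow> c * norm a \<le> norm (Kf (\<gamma> t) a)" by blast
  show ?thesis
    unfolding continuous_on
  proof
    fix t assume t: "t \<in> T"
    let ?a = "J (\<gamma> t) (x t)"
    have "continuous_on T (\<lambda>u. norm (x u - Kf (\<gamma> u) ?a) / c)"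
      using T \<gamma> c(1) by (intro continuous_intros continuous_on_Kf) auto
    then have "((\<lambda>u. norm (x u - Kf (\<gamma> u) ?a) / c) \<longlongrightarrow> norm (x t - Kf (\<gamma> t) ?a) / c) (at t within T)"
      using t unfolding continuous_on by blast
    then have lim: "((\<lambda>u. norm (x u - Kf (\<gamma> u) ?a) / c) \<longlongrightarrow> 0) (at t within T)"
      using Kf_J[OF \<gamma>[OF t] x[OF t]] by simp
    have "norm (J (\<gamma> u) (x u) - ?a) \<le> norm (x u - Kf (\<gamma> u) ?a) / c" if "u \<in> T" for u
    proof -
      have "J (\<gamma> u) (x u) - ?a \<in> M0"
        using J_in[OF \<gamma>[OF that] x[OF that]] J_in[OF \<gamma>[OF t] x[OF t]] M0_subspace by (simp add: subspace_diff)
      from c(2)[OF that this] show ?thesis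
        using Kf_J[OF \<gamma>[OF that] x[OF that]] c(1) by (simp add: linear_diff[OF linear_Kf] field_simps)
    qed
    then have "((\<lambda>u. J (\<gamma> u) (x u) - ?a) \<longlongrightarrow> 0) (at t within T)"
      by (intro Lim_null_comparison[OF _ lim]) (auto simp: eventually_at_filter)
    then show "((\<lambda>u. J (\<gamma> u) (x u)) \<longlongrightarrow> ?a) (at t within T)" using LIM_zero_iff by blast
  qed
qed

lemma continuous_on_met:
  fixes \<gamma> x :: "real \<Rightarrow> 'n cmat"
  assumes "compact T" "continuous_on T \<gamma>" "continuous_on T x"
    "\<And>t. t \<in> T \<Longrightarrow> \<gamma> t \<in> S" "\<And>t. t \<in> T \<Longrightarrow> x t \<in> M0"
  shows "continuous_on T (\<lambda>t. met (\<gamma> t) (x t))"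
proof -
  have "continuous_on T (\<lambda>t. br (x t) (J (\<gamma> t) (x t)))"
    using assms J_in M0_in by (intro continuous_on_br continuous_on_J) auto
  then show ?thesis by (rule continuous_on_eq) (use assms in \<open>simp add: metric_J\<close>)
qed

end

subsection \<open>Length and distance\<close>

text \<open>Partitions are encoded as chains of a relation saying that a piece leads from x to y, so
  that rule induction replaces indices. Since each link increases, all links stay between the ends
  of the chain.\<close>

lemma rtranclp_between:
  fixes a b :: "'a::linorder"
  assumes "rtranclp Q a b" and lt: "\<forall>x y. Q x y \<longrightarrow> x < y"
  shows "rtranclp (\<lambda>x y. Q x y \<and> a \<le> x \<and> y \<le> b) a b \<and> a \<le> b"
  using assms(1)
proof induction
  case (step y z)
  have "rtranclp (\<lambda>x u. Q x u \<and> a \<le> x \<and> u \<le> z) a y"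
    using step.IH lt[rule_format, OF step.hyps(2)] by (auto elim!: rtranclp_mono[THEN predicate2D, rotated])
  moreover have "Q y z \<and> a \<le> y \<and> z \<le> z" using step by simp
  ultimately have "rtranclp (\<lambda>x u. Q x u \<and> a \<le> x \<and> u \<le> z) a z" by (rule rtranclp.rtrancl_into_rtrancl)
  moreover have "a \<le> z" using step.IH lt[rule_format, OF step.hyps(2)] by (meson less_imp_le order_trans)
  ultimately show ?case by simp
qed simp

text \<open>The exceptional set consists of the break points. Away from them a point is interior to
  a piece and derivatives are two-sided, as the fundamental theorem of calculus wants them.\<close>

lemma rtranclp_interior:
  fixes a b :: real
  assumes "rtranclp Q a b" and lt: "\<forall>x y. Q x y \<longrightarrow> x < y"
  shows "\<exists>F. finite F \<and> (\<forall>r\<in>{a..b} - F. \<exists>x y. Q x y \<and> x < r \<and> r < y)"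
  using assms(1)
proof induction
  case base
  then show ?case by (intro exI[of _ "{a}"]) auto
next
  case (step y z)
  then obtain F where F: "finite F" "\<And>r. r \<in> {a..y} - F \<Longrightarrow> \<exists>x y. Q x y \<and> x < r \<and> r < y" by auto
  have "\<exists>x y. Q x y \<and> x < r \<and> r < y" if "r \<in> {a..z} - (F \<union> {y, z})" for r
  proof (cases "r \<le> y")
    case True
    then show ?thesis using F(2)[of r] that by auto
  next
    case False
    then show ?thesis using step.hyps(2) that by (intro exI[of _ y] exI[of _ z]) auto
  qed
  then show ?case using F(1) by (intro exI[of _ "F \<union> {y, z}"]) auto
qed

lemma rtranclp_continuous:
  fixes a b :: real
  assumes "rtranclp Q a b" and lt: "\<forall>x y. Q x y \<longrightarrow> x < y" and c: "\<And>x y. Q x y \<Longrightarrow> continuous_on {x..y} f"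
  shows "continuous_on {a..b} f"
  using assms(1)
proof induction
  case (step y z)
  have "a \<le> y" "y < z" using rtranclp_between[OF step.hyps(1) lt] lt[rule_format, OF step.hyps(2)] by auto
  then have "{a..z} = {a..y} \<union> {y..z}" by auto
  then show ?case using continuous_on_closed_Un[OF _ _ step.IH c[OF step.hyps(2)]] by simp
qed simp

lemma at_within_Icc_nontrivial: "a < b \<Longrightarrow> r \<in> {a..b} \<Longrightarrow> at r within {a..b} \<noteq> (bot :: real filter)"
  by (simp add: trivial_limit_within islimpt_Icc)

context qms
begin

section \<open>Curves with dominated arc length\<close>

lemma derivative_in_M0:
  assumes "(\<gamma> has_vector_derivative D) (at r within T)" "\<And>u. u \<in> T \<Longrightarrow> \<gamma> u \<in> S" "r \<in> T"
    "at r within T \<noteq> bot"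
  shows "D \<in> M0"
proof (rule Lim_in_closed_set[OF closed_subspace[OF M0_subspace] _ assms(4) has_vector_derivative_quotient[OF assms(1)]])
  have "(1 / (u - r)) *\<^sub>R (\<gamma> u - \<gamma> r) \<in> M0" if "u \<in> T" for u
    using states_posD[OF assms(2)[OF that]] states_posD[OF assms(2)[OF assms(3)]]
    by (simp add: M0_def tr_scaleR tr_diff)
  then show "\<forall>\<^sub>F u in at r within T. (1 / (u - r)) *\<^sub>R (\<gamma> u - \<gamma> r) \<in> M0"
    by (auto simp: eventually_at_filter)
qed

text \<open>The derivative \<open>h\<close> of \<open>H\<close> bounds the metric speed, so lengths
  are compared by increments of \<open>H\<close>. The flag is set for curves about to be
  transported, where \<open>h\<close> enters the new velocity and must be continuous, and is dropped
  for the result. Derivatives are taken within the closed interval, which lets pieces meet at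
  corners.\<close>

definition piece where
  "piece c \<gamma> H a b \<longleftrightarrow> a < (b::real) \<and> (\<exists>\<gamma>' h. continuous_on {a..b} \<gamma>' \<and> (c \<longrightarrow> continuous_on {a..b} h) \<and>
     (\<forall>r\<in>{a..b}. \<gamma> r \<in> S \<and> \<gamma>' r \<in> M0 \<and> (\<gamma> has_vector_derivative \<gamma>' r) (at r within {a..b}) \<and>
        (H has_real_derivative h r) (at r within {a..b}) \<and> 0 \<le> h r \<and> met (\<gamma> r) (\<gamma>' r) \<le> (h r)\<^sup>2))"

text \<open>\<open>H\<close> dominates the arc length of the piecewise smooth curve \<open>\<gamma>\<close>; the flag asks for \<open>H\<close> to be
  piecewise \<open>C\<^sup>1\<close>.\<close>

definition dominated_curve where
  "dominated_curve c \<gamma> H \<longleftrightarrow> rtranclp (piece c \<gamma> H) 0 1"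

lemma piece_less: "piece c \<gamma> H a b \<Longrightarrow> a < b"
  by (simp add: piece_def)

lemma piece_lt: "\<forall>a b. piece c \<gamma> H a b \<longrightarrow> a < b"
  by (simp add: piece_def)

lemma piece_interior:
  assumes "piece c \<gamma> H a b" "a < r" "r < b"
  shows "\<gamma> r \<in> S" "vector_derivative \<gamma> (at r) \<in> M0"
    "(H has_real_derivative deriv H r) (at r)" "0 \<le> deriv H r"
    "met (\<gamma> r) (vector_derivative \<gamma> (at r)) \<le> (deriv H r)\<^sup>2"
proof -
  obtain \<gamma>' h where *: "\<gamma> r \<in> S" "\<gamma>' r \<in> M0" "(\<gamma> has_vector_derivative \<gamma>' r) (at r within {a..b})"
    "(H has_real_derivative h r) (at r within {a..b})" "0 \<le> h r" "met (\<gamma> r) (\<gamma>' r) \<le> (h r)\<^sup>2"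
    using assms unfolding piece_def by (metis atLeastAtMost_iff less_imp_le)
  have "at r within {a..b} = at r" using assms by (simp add: at_within_Icc_at)
  then have "vector_derivative \<gamma> (at r) = \<gamma>' r" "(H has_real_derivative h r) (at r)" "deriv H r = h r"
    using * by (auto simp: vector_derivative_at DERIV_imp_deriv)
  then show "\<gamma> r \<in> S" "vector_derivative \<gamma> (at r) \<in> M0" "(H has_real_derivative deriv H r) (at r)" "0 \<le> deriv H r"
    "met (\<gamma> r) (vector_derivative \<gamma> (at r)) \<le> (deriv H r)\<^sup>2" using * by auto
qed

lemma dominated_curve_states:
  assumes "dominated_curve c \<gamma> H" "r \<in> {0..1}" shows "\<gamma> r \<in> S"
proof -
  have "\<forall>r\<in>{0..b}. \<gamma> r \<in> S" if "rtranclp (piece c \<gamma> H) 0 b" "b > 0" for b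
    using that
  proof (induction)
    case (step y z)
    have "\<forall>r\<in>{y..z}. \<gamma> r \<in> S" using step.hyps(2) unfolding piece_def by blast
    moreover have "0 \<le> y" using rtranclp_between[OF step.hyps(1) piece_lt[of c \<gamma> H]] by blast
    moreover have "\<gamma> r \<in> S" if "0 \<le> r" "r < y" for r
      using step.IH that by auto
    ultimately show ?case by (metis atLeastAtMost_iff linorder_not_less)
  qed simp
  from this[of 1] show ?thesis using assms unfolding dominated_curve_def by auto
qed

lemma dominated_curve_C1:
  assumes "dominated_curve c \<gamma> H" shows "piecewise_C1_curve \<gamma>"
proof -
  obtain n where "(piece c \<gamma> H ^^ n) 0 1"
    using assms rtranclp_imp_relpowp unfolding dominated_curve_def by metis
  then obtain t where t: "t 0 = 0" "t n = 1" "\<And>i. i < n \<Longrightarrow> piece c \<gamma> H (t i) (t (Suc i))"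
    by (auto simp: relpowp_fun_conv)
  show ?thesis
    unfolding piecewise_C1_curve_def
  proof (rule exI[of _ n], rule exI[of _ t], intro conjI allI impI)
    show "t 0 = 0" "t n = 1" by fact+
    show "t i < t (Suc i)" if "i < n" for i using t(3)[OF that] piece_less by blast
    show "\<exists>\<gamma>'. continuous_on {t i..t (Suc i)} \<gamma>' \<and> (\<forall>r\<in>{t i..t (Suc i)}.
              (\<gamma> has_vector_derivative \<gamma>' r) (at r within {t i..t (Suc i)}))" if "i < n" for i
      using t(3)[OF that] unfolding piece_def by blast
  qed
qed

lemma dominated_curve_length:
  assumes "dominated_curve c \<gamma> H"
  shows "curve_length M \<tau> d v \<gamma> \<le> H 1 - H 0" "0 \<le> H 1 - H 0"
proof -
  have ch: "rtranclp (piece c \<gamma> H) 0 1" using assms by (simp add: dominated_curve_def)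
  from rtranclp_interior[OF ch piece_lt[of c \<gamma> H]] obtain F where F: "finite F"
    "\<forall>r\<in>{0..1} - F. \<exists>a b. piece c \<gamma> H a b \<and> a < r \<and> r < b" by (elim exE conjE)
  have cH: "continuous_on {0..1} H"
  proof (rule rtranclp_continuous[OF ch piece_lt[of c \<gamma> H]])
    fix x y assume "piece c \<gamma> H x y"
    then show "continuous_on {x..y} H"
      unfolding piece_def continuous_on_eq_continuous_within by (metis DERIV_continuous)
  qed
  define f where "f r = sqrt (met (\<gamma> r) (vector_derivative \<gamma> (at r)))" for r
  \<comment> \<open>At break points \<open>vector_derivative\<close> may carry no information, so
    both integrands are set to 0 there.\<close>
  define f' where "f' r = (if r \<in> F then 0 else f r)" for r
  define k where "k r = (if r \<in> F then 0 else deriv H r)" for r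
  have le: "f' r \<le> k r" "0 \<le> k r" if r: "r \<in> {0..1}" for r
  proof -
    have "f' r \<le> k r \<and> 0 \<le> k r"
    proof (cases "r \<in> F")
      case False
      then have "r \<in> {0..1} - F" using r by simp
      then obtain a b where ab: "piece c \<gamma> H a b" "a < r" "r < b" using F(2) by blast
      have "f r \<le> deriv H r"
        unfolding f_def using piece_interior[OF ab] by (simp add: real_le_lsqrt met_nonneg)
      then show ?thesis using piece_interior[OF ab] False by (simp add: f'_def k_def)
    qed (simp add: f'_def k_def)
    then show "f' r \<le> k r" "0 \<le> k r" by auto
  qed
  have "(deriv H has_integral (H 1 - H 0)) {0..1}"
  proof (rule fundamental_theorem_of_calculus_interior_strong[OF F(1) _ _ cH])
    fix r assume "r \<in> {0<..<1} - F"
    then have "r \<in> {0..1} - F" by simp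
    then obtain a b where ab: "piece c \<gamma> H a b" "a < r" "r < b" using F(2) by blast
    then show "(H has_vector_derivative deriv H r) (at r)"
      using piece_interior(3)[OF ab] by (simp add: has_real_derivative_iff_has_vector_derivative)
  qed simp
  then have k: "(k has_integral (H 1 - H 0)) {0..1}"
    by (rule has_integral_spike_finite[OF F(1), rotated]) (simp add: k_def)
  show "0 \<le> H 1 - H 0" by (rule has_integral_nonneg[OF k]) (use le in auto)
  show "curve_length M \<tau> d v \<gamma> \<le> H 1 - H 0"
  proof (cases "f integrable_on {0..1}")
    case True
    then have "(f' has_integral integral {0..1} f) {0..1}"
      by (intro has_integral_spike_finite[OF F(1) _ integrable_integral]) (simp add: f'_def)
    from has_integral_le[OF this k le(1)] show ?thesis by (simp add: curve_length_def f_def[abs_def])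
  next
    case False
    \<comment> \<open>The integral of a non-integrable function is 0 by default, and the increment
      of \<open>H\<close> is nonnegative.\<close>
    then have "curve_length M \<tau> d v \<gamma> = 0" by (simp add: curve_length_def f_def[abs_def] not_integrable_integral)
    then show ?thesis using \<open>0 \<le> H 1 - H 0\<close> by simp
  qed
qed

definition curve_from_to where
  "curve_from_to \<gamma> \<rho> \<sigma> \<longleftrightarrow> piecewise_C1_curve \<gamma> \<and> (\<forall>r\<in>{0..1}. \<gamma> r \<in> S) \<and> \<gamma> 0 = \<rho> \<and> \<gamma> 1 = \<sigma>"

text \<open>The arc length function itself serves as \<open>H\<close>. Integrability of the speed is
  proved together with the pieces, one link of the chain at a time.\<close>

lemma arc_length_dominates:
  assumes "curve_from_to \<gamma> \<rho> \<sigma>"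
  obtains H where "dominated_curve True \<gamma> H" "H 1 - H 0 = curve_length M \<tau> d v \<gamma>"
proof -
  have S: "\<And>r. r \<in> {0..1} \<Longrightarrow> \<gamma> r \<in> S" using assms by (simp add: curve_from_to_def)
  obtain m :: nat and t where t: "t 0 = (0::real)" "t m = 1" "\<And>i. i < m \<Longrightarrow> t i < t (Suc i)"
    "\<And>i. i < m \<Longrightarrow> \<exists>\<gamma>'. continuous_on {t i..t (Suc i)} \<gamma>' \<and>
        (\<forall>r\<in>{t i..t (Suc i)}. (\<gamma> has_vector_derivative \<gamma>' r) (at r within {t i..t (Suc i)}))"
    using assms unfolding curve_from_to_def piecewise_C1_curve_def by blast
  define Q where "Q a b \<longleftrightarrow> a < b \<and> (\<exists>\<gamma>'. continuous_on {a..b} \<gamma>' \<and>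
        (\<forall>r\<in>{a..b}. (\<gamma> has_vector_derivative \<gamma>' r) (at r within {a..b})))" for a b :: real
  have "(Q ^^ m) 0 1"
    unfolding relpowp_fun_conv using t by (intro exI[of _ t]) (auto simp: Q_def)
  then have "rtranclp Q 0 1" by (rule relpowp_imp_rtranclp)
  then have ch: "rtranclp (\<lambda>a b. Q a b \<and> 0 \<le> a \<and> b \<le> 1) 0 1"
    using rtranclp_between[of Q 0 1] by (auto simp: Q_def)
  define f where "f r = sqrt (met (\<gamma> r) (vector_derivative \<gamma> (at r)))" for r
  define H where "H u = integral {0..u} f" for u
  have "f integrable_on {0..b} \<and> rtranclp (piece True \<gamma> H) 0 b \<and> 0 \<le> b"
    if "rtranclp (\<lambda>a b. Q a b \<and> 0 \<le> a \<and> b \<le> 1) 0 b" for b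
    using that
  proof induction
    case base
    then show ?case using integrable_on_refl[of f "0::real"] by simp
  next
    case (step a b)
    then have ab: "a < b" "0 \<le> a" "b \<le> 1" and int: "f integrable_on {0..a}" by (auto simp: Q_def)
    obtain \<gamma>' where \<gamma>': "continuous_on {a..b} \<gamma>'"
      "\<And>r. r \<in> {a..b} \<Longrightarrow> (\<gamma> has_vector_derivative \<gamma>' r) (at r within {a..b})"
      using step.hyps(2) by (auto simp: Q_def)
    have Sab: "\<gamma> r \<in> S" if "r \<in> {a..b}" for r using S ab that by auto
    have M0: "\<gamma>' r \<in> M0" if "r \<in> {a..b}" for r
      by (rule derivative_in_M0[OF \<gamma>'(2)]) (use that Sab at_within_Icc_nontrivial ab in auto)
    have c\<gamma>: "continuous_on {a..b} \<gamma>"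
      unfolding continuous_on_eq_continuous_within using \<gamma>'(2) has_vector_derivative_continuous by blast
    define g where "g r = sqrt (met (\<gamma> r) (\<gamma>' r))" for r
    have cg: "continuous_on {a..b} g"
      unfolding g_def using Sab M0 by (intro continuous_on_real_sqrt continuous_on_met c\<gamma> \<gamma>') auto
    have fg: "f r = g r" if "r \<in> {a..b} - {a, b}" for r
      using \<gamma>'(2)[of r] that by (simp add: f_def g_def at_within_Icc_at vector_derivative_at)
    have "g integrable_on {a..b}" using cg by (rule integrable_continuous_real)
    then have "f integrable_on {a..b}"
      by (rule integrable_spike_finite[of "{a, b}", rotated 2]) (use fg in auto)
    then have int2: "f integrable_on {0..b}" using Henstock_Kurzweil_Integration.integrable_combine[OF _ _ int] ab by auto
    have H: "H u = H a + integral {a..u} g" if "u \<in> {a..b}" for u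
    proof -
      have "f integrable_on {0..u}" by (rule integrable_on_subinterval[OF int2]) (use that in auto)
      then have "H u = H a + integral {a..u} f"
        unfolding H_def using Henstock_Kurzweil_Integration.integral_combine[of 0 a u f] that ab by auto
      also have "integral {a..u} f = integral {a..u} g"
        by (rule integral_spike[of "{a, b}"]) (use fg that in auto)
      finally show ?thesis .
    qed
    have "(H has_real_derivative g r) (at r within {a..b})" if "r \<in> {a..b}" for r
    proof -
      have "((\<lambda>u. H a + integral {a..u} g) has_vector_derivative 0 + g r) (at r within {a..b})"
        by (intro has_vector_derivative_add has_vector_derivative_const integral_has_vector_derivative cg that)
      then have "((\<lambda>u. H a + integral {a..u} g) has_vector_derivative g r) (at r within {a..b})" by simp
      then have "(H has_vector_derivative g r) (at r within {a..b})"
        by - (rule has_vector_derivative_transform[OF that], rule H, assumption+)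
      then show ?thesis by (simp add: has_real_derivative_iff_has_vector_derivative)
    qed
    moreover have "0 \<le> g r" "met (\<gamma> r) (\<gamma>' r) \<le> (g r)\<^sup>2" if "r \<in> {a..b}" for r
      using met_nonneg[OF Sab[OF that] M0[OF that]] by (simp_all add: g_def)
    ultimately have "piece True \<gamma> H a b"
      unfolding piece_def using ab \<gamma>' cg Sab M0 by (intro conjI exI[of _ \<gamma>'] exI[of _ g]) auto
    then show ?case using step.IH int2 ab by auto
  qed
  from this[OF ch] have "dominated_curve True \<gamma> H" by (simp add: dominated_curve_def)
  moreover have "H 1 - H 0 = curve_length M \<tau> d v \<gamma>" by (simp add: H_def curve_length_def f_def[abs_def])
  ultimately show ?thesis by (rule that)
qed

lemma piece_cong:
  assumes "piece c \<gamma> H a b" "\<And>r. r \<in> {a..b} \<Longrightarrow> \<eta> r = \<gamma> r" "\<And>r. r \<in> {a..b} \<Longrightarrow> G r = H r + k"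
  shows "piece c \<eta> G a b"
proof -
  obtain \<gamma>' h where *: "a < b" "continuous_on {a..b} \<gamma>'" "c \<longrightarrow> continuous_on {a..b} h"
    "\<And>r. r \<in> {a..b} \<Longrightarrow> \<gamma> r \<in> S \<and> \<gamma>' r \<in> M0 \<and> (\<gamma> has_vector_derivative \<gamma>' r) (at r within {a..b}) \<and>
        (H has_real_derivative h r) (at r within {a..b}) \<and> 0 \<le> h r \<and> met (\<gamma> r) (\<gamma>' r) \<le> (h r)\<^sup>2"
    using assms(1) unfolding piece_def by blast
  have "\<eta> r \<in> S \<and> \<gamma>' r \<in> M0 \<and> (\<eta> has_vector_derivative \<gamma>' r) (at r within {a..b}) \<and>
        (G has_real_derivative h r) (at r within {a..b}) \<and> 0 \<le> h r \<and> met (\<eta> r) (\<gamma>' r) \<le> (h r)\<^sup>2"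
    if r: "r \<in> {a..b}" for r
  proof -
    have "(\<eta> has_vector_derivative \<gamma>' r) (at r within {a..b})"
      by (rule has_vector_derivative_transform[OF r assms(2)]) (use *(4)[OF r] in auto)
    moreover have "((\<lambda>r. H r + k) has_vector_derivative h r) (at r within {a..b})"
      using *(4)[OF r] by (auto simp: has_real_derivative_iff_has_vector_derivative[symmetric] intro!: derivative_eq_intros)
    then have "(G has_vector_derivative h r) (at r within {a..b})"
      by - (rule has_vector_derivative_transform[OF r], rule assms(3), assumption+)
    ultimately show ?thesis using *(4)[OF r] assms(2)[OF r]
      by (simp add: has_real_derivative_iff_has_vector_derivative)
  qed
  then show ?thesis unfolding piece_def using * by blast
qed

text \<open>The sign keeps the dominating function increasing when a negative \<open>k\<close>
  reverses the curve.\<close>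

lemma piece_affine:
  assumes p: "piece c \<gamma> H a b" and k: "k \<noteq> 0" and "x < y" and img: "(\<lambda>r. k * r + l) ` {x..y} \<subseteq> {a..b}"
  shows "piece c (\<lambda>r. \<gamma> (k * r + l)) (\<lambda>r. sgn k * H (k * r + l)) x y"
proof -
  obtain \<gamma>' h where *: "a < b" "continuous_on {a..b} \<gamma>'" "c \<longrightarrow> continuous_on {a..b} h"
    "\<And>r. r \<in> {a..b} \<Longrightarrow> \<gamma> r \<in> S \<and> \<gamma>' r \<in> M0 \<and> (\<gamma> has_vector_derivative \<gamma>' r) (at r within {a..b}) \<and>
        (H has_real_derivative h r) (at r within {a..b}) \<and> 0 \<le> h r \<and> met (\<gamma> r) (\<gamma>' r) \<le> (h r)\<^sup>2"
    using p unfolding piece_def by blast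
  let ?f = "\<lambda>r. k * r + l"
  have cf: "continuous_on {x..y} ?f" by (intro continuous_intros)
  have df: "(?f has_vector_derivative k) (at r within {x..y})" for r
    by (auto simp: has_real_derivative_iff_has_vector_derivative[symmetric] intro!: derivative_eq_intros)
  have "\<gamma> (?f r) \<in> S \<and> k *\<^sub>R \<gamma>' (?f r) \<in> M0 \<and>
     ((\<lambda>r. \<gamma> (?f r)) has_vector_derivative k *\<^sub>R \<gamma>' (?f r)) (at r within {x..y}) \<and>
     ((\<lambda>r. sgn k * H (?f r)) has_real_derivative \<bar>k\<bar> * h (?f r)) (at r within {x..y}) \<and>
     0 \<le> \<bar>k\<bar> * h (?f r) \<and> met (\<gamma> (?f r)) (k *\<^sub>R \<gamma>' (?f r)) \<le> (\<bar>k\<bar> * h (?f r))\<^sup>2"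
    if r: "r \<in> {x..y}" for r
  proof -
    have fr: "?f r \<in> {a..b}" using img r by blast
    note ** = *(4)[OF fr]
    have "((\<gamma> \<circ> ?f) has_vector_derivative k *\<^sub>R \<gamma>' (?f r)) (at r within {x..y})"
      by (rule vector_diff_chain_within[OF df]) (use ** img in \<open>blast intro: has_vector_derivative_within_subset\<close>)
    moreover have "((H \<circ> ?f) has_vector_derivative k *\<^sub>R h (?f r)) (at r within {x..y})"
      by (rule vector_diff_chain_within[OF df])
        (use ** img in \<open>blast intro: has_vector_derivative_within_subset
          has_real_derivative_iff_has_vector_derivative[THEN iffD1]\<close>)
    then have "((\<lambda>r. H (?f r)) has_real_derivative k * h (?f r)) (at r within {x..y})"
      by (simp add: has_real_derivative_iff_has_vector_derivative o_def)
    then have "((\<lambda>r. sgn k * H (?f r)) has_real_derivative sgn k * (k * h (?f r))) (at r within {x..y})"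
      by (rule DERIV_cmult)
    moreover have "sgn k * (k * h (?f r)) = \<bar>k\<bar> * h (?f r)" by (simp add: abs_sgn mult_ac)
    moreover have "met (\<gamma> (?f r)) (k *\<^sub>R \<gamma>' (?f r)) \<le> (\<bar>k\<bar> * h (?f r))\<^sup>2"
      using ** by (simp add: met_scaleR power_mult_distrib mult_left_mono)
    ultimately show ?thesis using ** M0_subspace by (simp add: o_def subspace_scale)
  qed
  moreover have "continuous_on {x..y} (\<lambda>r. k *\<^sub>R \<gamma>' (?f r))"
    by (intro continuous_on_scaleR continuous_on_const continuous_on_compose2[OF *(2) cf img])
  moreover have "c \<longrightarrow> continuous_on {x..y} (\<lambda>r. \<bar>k\<bar> * h (?f r))"
    using *(3) by (auto intro!: continuous_on_mult continuous_on_const continuous_on_compose2[OF _ cf img])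
  ultimately show ?thesis
    unfolding piece_def using \<open>x < y\<close>
    by (intro conjI exI[of _ "\<lambda>r. k *\<^sub>R \<gamma>' (?f r)"] exI[of _ "\<lambda>r. \<bar>k\<bar> * h (?f r)"]) auto
qed

section \<open>The Riemannian distance\<close>

abbreviation Wd where "Wd \<equiv> W M \<tau> d v"

lemma Wd_def: "Wd \<rho> \<sigma> = Inf {curve_length M \<tau> d v \<gamma> | \<gamma>. curve_from_to \<gamma> \<rho> \<sigma>}"
  by (simp add: W_def curve_from_to_def)

lemma curve_length_nonneg:
  assumes "curve_from_to \<gamma> \<rho> \<sigma>" shows "0 \<le> curve_length M \<tau> d v \<gamma>"
proof -
  obtain H where "dominated_curve True \<gamma> H" "H 1 - H 0 = curve_length M \<tau> d v \<gamma>"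
    by (rule arc_length_dominates[OF assms]) (rule that, assumption+)
  then show ?thesis using dominated_curve_length(2) by metis
qed

lemma Wd_le:
  assumes "dominated_curve c \<gamma> H" "\<gamma> 0 = \<rho>" "\<gamma> 1 = \<sigma>" shows "Wd \<rho> \<sigma> \<le> H 1 - H 0"
proof -
  have c: "curve_from_to \<gamma> \<rho> \<sigma>"
    using assms dominated_curve_states dominated_curve_C1 by (simp add: curve_from_to_def)
  have "Wd \<rho> \<sigma> \<le> curve_length M \<tau> d v \<gamma>"
    unfolding Wd_def using c curve_length_nonneg by (intro cInf_lower bdd_belowI[of _ 0]) auto
  then show ?thesis using dominated_curve_length(1)[OF assms(1)] by simp
qed

text \<open>The invertible states are convex, so the straight segment is admissible. It shows that
  the \<open>Inf\<close> in \<open>W\<close> is over a nonempty set.\<close>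

lemma segment:
  assumes "\<rho> \<in> S" "\<sigma> \<in> S"
  shows "curve_from_to (\<lambda>r. (1 - r) *\<^sub>R \<rho> + r *\<^sub>R \<sigma>) \<rho> \<sigma>"
proof -
  have "piecewise_C1_curve (\<lambda>r. (1 - r) *\<^sub>R \<rho> + r *\<^sub>R \<sigma>)"
    unfolding piecewise_C1_curve_def
  proof (intro exI[of _ "Suc 0"] exI[of _ real] conjI allI impI)
    fix i :: nat assume "i < Suc 0"
    show "\<exists>\<gamma>'. continuous_on {real i..real (Suc i)} \<gamma>' \<and> (\<forall>r\<in>{real i..real (Suc i)}.
      ((\<lambda>r. (1 - r) *\<^sub>R \<rho> + r *\<^sub>R \<sigma>) has_vector_derivative \<gamma>' r) (at r within {real i..real (Suc i)}))"
      by (intro exI[of _ "\<lambda>r. \<sigma> - \<rho>"] conjI ballI continuous_intros)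
        (auto intro!: derivative_eq_intros simp: has_real_derivative_iff_has_vector_derivative[symmetric])
  qed simp_all
  then show ?thesis using assms states_pos_convex by (auto simp: curve_from_to_def)
qed

lemma Wd_nonneg: "\<rho> \<in> S \<Longrightarrow> \<sigma> \<in> S \<Longrightarrow> 0 \<le> Wd \<rho> \<sigma>"
  unfolding Wd_def using segment curve_length_nonneg by (intro cInf_greatest) blast+

lemma Wd_less:
  assumes "\<rho> \<in> S" "\<sigma> \<in> S" "Wd \<rho> \<sigma> < w"
  obtains \<gamma> H where "dominated_curve True \<gamma> H" "\<gamma> 0 = \<rho>" "\<gamma> 1 = \<sigma>" "H 1 - H 0 < w"
proof -
  have "\<exists>x\<in>{curve_length M \<tau> d v \<gamma> | \<gamma>. curve_from_to \<gamma> \<rho> \<sigma>}. x < w"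
    using assms(3) segment[OF assms(1,2)] unfolding Wd_def by (intro cInf_lessD) blast+
  then obtain \<gamma> where \<gamma>: "curve_from_to \<gamma> \<rho> \<sigma>" "curve_length M \<tau> d v \<gamma> < w" by blast
  obtain H where "dominated_curve True \<gamma> H" "H 1 - H 0 = curve_length M \<tau> d v \<gamma>"
    by (rule arc_length_dominates[OF \<gamma>(1)]) (rule that, assumption+)
  then show ?thesis using \<gamma> that[of \<gamma> H] by (simp add: curve_from_to_def)
qed

lemma dominated_curve_reverse:
  assumes "dominated_curve c \<gamma> H"
  shows "dominated_curve c (\<lambda>r. \<gamma> (1 - r)) (\<lambda>r. - H (1 - r))"
proof -
  have "rtranclp (piece c (\<lambda>r. \<gamma> (1 - r)) (\<lambda>r. - H (1 - r))) (1 - b) (1 - a)"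
    if "rtranclp (piece c \<gamma> H) a b" for a b
    using that
  proof induction
    case (step y z)
    have "piece c (\<lambda>r. \<gamma> (- 1 * r + 1)) (\<lambda>r. sgn (- 1) * H (- 1 * r + 1)) (1 - z) (1 - y)"
      using piece_less[OF step.hyps(2)] by (intro piece_affine[OF step.hyps(2)]) auto
    then have "piece c (\<lambda>r. \<gamma> (1 - r)) (\<lambda>r. - H (1 - r)) (1 - z) (1 - y)" by simp
    then show ?case using step.IH by (rule converse_rtranclp_into_rtranclp)
  qed simp
  from this[of 0 1] show ?thesis using assms by (simp add: dominated_curve_def)
qed

lemma Wd_commute_le:
  assumes "\<rho> \<in> S" "\<sigma> \<in> S" shows "Wd \<sigma> \<rho> \<le> Wd \<rho> \<sigma>"
proof (rule dense_ge)
  fix w assume "Wd \<rho> \<sigma> < w"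
  then obtain \<gamma> H where "dominated_curve True \<gamma> H" "\<gamma> 0 = \<rho>" "\<gamma> 1 = \<sigma>" "H 1 - H 0 < w"
    by (rule Wd_less[OF assms]) (rule that, assumption+)
  then show "Wd \<sigma> \<rho> \<le> w" using Wd_le[OF dominated_curve_reverse, of True \<gamma> H \<sigma> \<rho>] by simp
qed

lemma Wd_commute: "\<rho> \<in> S \<Longrightarrow> \<sigma> \<in> S \<Longrightarrow> Wd \<rho> \<sigma> = Wd \<sigma> \<rho>"
  by (intro antisym Wd_commute_le)

lemma rtranclp_piece_affine:
  assumes "rtranclp (piece c \<gamma> H) a b" "k > 0"
    and "\<And>r. r \<in> {(a - l) / k..(b - l) / k} \<Longrightarrow> \<eta> r = \<gamma> (k * r + l)"
    and "\<And>r. r \<in> {(a - l) / k..(b - l) / k} \<Longrightarrow> G r = H (k * r + l) + e"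
  shows "rtranclp (piece c \<eta> G) ((a - l) / k) ((b - l) / k)"
  using assms(1,3,4)
proof induction
  case (step y z)
  have yz: "y < z" "a \<le> y"
    using piece_less[OF step.hyps(2)] rtranclp_between[OF step.hyps(1) piece_lt[of c \<gamma> H]] by auto
  have lt: "(y - l) / k < (z - l) / k" "(a - l) / k \<le> (y - l) / k"
    using yz \<open>k > 0\<close> by (auto simp: divide_strict_right_mono divide_right_mono)
  have "piece c (\<lambda>r. \<gamma> (k * r + l)) (\<lambda>r. sgn k * H (k * r + l)) ((y - l) / k) ((z - l) / k)"
    using lt \<open>k > 0\<close> by (intro piece_affine[OF step.hyps(2)]) (auto simp: field_simps)
  then have "piece c \<eta> G ((y - l) / k) ((z - l) / k)"
    by (rule piece_cong) (use step.prems lt \<open>k > 0\<close> in auto)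
  moreover have "rtranclp (piece c \<eta> G) ((a - l) / k) ((y - l) / k)"
    by (rule step.IH) (use step.prems lt in auto)
  ultimately show ?case by (rule rtranclp.rtrancl_into_rtrancl[rotated])
qed simp

lemma dominated_curve_join:
  assumes "dominated_curve c \<gamma> H" "dominated_curve c \<gamma>' H'" "\<gamma> 1 = \<gamma>' 0"
  obtains \<eta> G where "dominated_curve c \<eta> G" "\<eta> 0 = \<gamma> 0" "\<eta> 1 = \<gamma>' 1"
    "G 1 - G 0 = (H 1 - H 0) + (H' 1 - H' 0)"
proof
  define \<eta> where "\<eta> r = (if r \<le> 1 / 2 then \<gamma> (2 * r) else \<gamma>' (2 * r - 1))" for r
  \<comment> \<open>The added constant makes the two halves of \<open>G\<close> match at
    1/2.\<close>
  define G where "G r = (if r \<le> 1 / 2 then H (2 * r) else H' (2 * r - 1) + (H 1 - H' 0))" for r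
  have "rtranclp (piece c \<eta> G) ((0 - 0) / 2) ((1 - 0) / 2)"
    using assms(1) unfolding dominated_curve_def
    by (rule rtranclp_piece_affine[where e = 0]) (auto simp: \<eta>_def G_def)
  moreover have "rtranclp (piece c \<eta> G) ((0 - (-1)) / 2) ((1 - (-1)) / 2)"
    using assms(2) unfolding dominated_curve_def
  proof (rule rtranclp_piece_affine[where e = "H 1 - H' 0"])
    fix r :: real assume "r \<in> {(0 - (-1)) / 2..(1 - (-1)) / 2}"
    then have "1 / 2 \<le> r" by simp
    then have "\<eta> r = \<gamma>' (2 * r + - 1) \<and> G r = H' (2 * r + - 1) + (H 1 - H' 0)"
    proof (cases "r = 1 / 2")
      case True
      show ?thesis unfolding True using assms(3) by (simp add: \<eta>_def G_def)
    qed (simp add: \<eta>_def G_def)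
    then show "\<eta> r = \<gamma>' (2 * r + - 1)" "G r = H' (2 * r + - 1) + (H 1 - H' 0)" by auto
  qed simp
  ultimately show "dominated_curve c \<eta> G" by (simp add: dominated_curve_def)
  show "\<eta> 0 = \<gamma> 0" "\<eta> 1 = \<gamma>' 1" "G 1 - G 0 = (H 1 - H 0) + (H' 1 - H' 0)" by (simp_all add: \<eta>_def G_def)
qed

lemma Wd_triangle:
  assumes "\<rho> \<in> S" "\<sigma> \<in> S" "\<omega> \<in> S" shows "Wd \<rho> \<omega> \<le> Wd \<rho> \<sigma> + Wd \<sigma> \<omega>"
proof (rule field_le_epsilon)
  fix e :: real assume "e > 0"
  have "Wd \<rho> \<sigma> < Wd \<rho> \<sigma> + e / 2" "Wd \<sigma> \<omega> < Wd \<sigma> \<omega> + e / 2" using \<open>e > 0\<close> by auto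
  obtain \<gamma> H where 1: "dominated_curve True \<gamma> H" "\<gamma> 0 = \<rho>" "\<gamma> 1 = \<sigma>" "H 1 - H 0 < Wd \<rho> \<sigma> + e / 2"
    by (rule Wd_less[OF assms(1,2) \<open>Wd \<rho> \<sigma> < _\<close>]) (rule that, assumption+)
  obtain \<gamma>' H' where 2: "dominated_curve True \<gamma>' H'" "\<gamma>' 0 = \<sigma>" "\<gamma>' 1 = \<omega>" "H' 1 - H' 0 < Wd \<sigma> \<omega> + e / 2"
    by (rule Wd_less[OF assms(2,3) \<open>Wd \<sigma> \<omega> < _\<close>]) (rule that, assumption+)
  have "\<gamma> 1 = \<gamma>' 0" using 1 2 by simp
  obtain \<eta> G where "dominated_curve True \<eta> G" "\<eta> 0 = \<gamma> 0" "\<eta> 1 = \<gamma>' 1"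
    "G 1 - G 0 = (H 1 - H 0) + (H' 1 - H' 0)"
    by (rule dominated_curve_join[OF 1(1) 2(1) \<open>\<gamma> 1 = \<gamma>' 0\<close>]) (rule that, assumption+)
  then show "Wd \<rho> \<omega> \<le> Wd \<rho> \<sigma> + Wd \<sigma> \<omega> + e" using Wd_le[of True \<eta> G \<rho> \<omega>] 1 2 by simp
qed

lemma dominated_curve_single:
  assumes "\<And>r. r \<in> {0..1} \<Longrightarrow> \<gamma> r \<in> S" "continuous_on {0..1} \<gamma>'"
    "\<And>r. r \<in> {0..1} \<Longrightarrow> (\<gamma> has_vector_derivative \<gamma>' r) (at r within {0..1})"
    "C \<ge> 0" "\<And>r. r \<in> {0..1} \<Longrightarrow> met (\<gamma> r) (\<gamma>' r) \<le> C\<^sup>2"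
  shows "dominated_curve True \<gamma> (\<lambda>r. C * r)"
proof -
  have "\<gamma>' r \<in> M0" if "r \<in> {0..1}" for r
    by (rule derivative_in_M0[OF assms(3)]) (use that assms at_within_Icc_nontrivial in auto)
  moreover have "((\<lambda>r. C * r) has_real_derivative C) (at r within {0..1})" for r
    by (auto intro!: derivative_eq_intros)
  ultimately have "piece True \<gamma> (\<lambda>r. C * r) 0 1"
    unfolding piece_def using assms
    by (intro conjI exI[of _ \<gamma>'] exI[of _ "\<lambda>_. C"]) auto
  then show ?thesis by (auto simp: dominated_curve_def)
qed

lemma Wd_self:
  assumes "\<rho> \<in> S" shows "Wd \<rho> \<rho> = 0"
proof -
  have "dominated_curve True (\<lambda>r. \<rho>) (\<lambda>r. 0 * r)"
    using assms by (intro dominated_curve_single[of _ "\<lambda>_. 0"]) (auto simp: metric_J)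
  from Wd_le[OF this, of \<rho> \<rho>] show ?thesis using Wd_nonneg[OF assms assms] by simp
qed

end

subsection \<open>Generalized sine and cosine and the transported curve\<close>

lemma s_fun_0 [simp]: "s_fun \<kappa> 0 = 0" and c_fun_0 [simp]: "c_fun \<kappa> 0 = 1"
  by (simp_all add: s_fun_def c_fun_def)

lemma sqrt_cases:
  fixes \<kappa> :: real
  obtains q where "q > 0" "\<kappa> = q\<^sup>2" | "\<kappa> = 0" | q where "q > 0" "\<kappa> = - q\<^sup>2"
proof -
  consider "\<kappa> > 0" | "\<kappa> = 0" | "\<kappa> < 0" by linarith
  then show ?thesis
  proof cases
    case 1
    then show ?thesis using that(1)[of "sqrt \<kappa>"] by simp
  next
    case 3
    then show ?thesis using that(3)[of "sqrt (- \<kappa>)"] by simp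
  qed (rule that(2))
qed

lemma s_fun_derivative [derivative_intros]:
  assumes "(f has_real_derivative f') (at x within T)"
  shows "((\<lambda>x. s_fun \<kappa> (f x)) has_real_derivative c_fun \<kappa> (f x) * f') (at x within T)"
  by (cases \<kappa> rule: sqrt_cases)
    (use assms in \<open>auto simp: s_fun_def c_fun_def intro!: derivative_eq_intros\<close>)

lemma c_fun_derivative [derivative_intros]:
  assumes "(f has_real_derivative f') (at x within T)"
  shows "((\<lambda>x. c_fun \<kappa> (f x)) has_real_derivative (- \<kappa> * s_fun \<kappa> (f x)) * f') (at x within T)"
  by (cases \<kappa> rule: sqrt_cases)
    (use assms in \<open>auto simp: s_fun_def c_fun_def power2_eq_square mult_le_0_iff intro!: derivative_eq_intros\<close>)

lemma c_fun_half: "c_fun \<kappa> x = 1 - 2 * \<kappa> * (s_fun \<kappa> (x / 2))\<^sup>2"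
proof -
  consider "\<kappa> > 0" | "\<kappa> = 0" | "\<kappa> < 0" by linarith
  then show ?thesis
  proof cases
    case 1
    have "cos (2 * (sqrt \<kappa> * (x / 2))) = 1 - 2 * (sin (sqrt \<kappa> * (x / 2)))\<^sup>2" by (rule cos_double_sin)
    with 1 show ?thesis by (simp add: s_fun_def c_fun_def power_divide)
  next
    case 3
    have "cosh (2 * (sqrt (- \<kappa>) * (x / 2))) = 1 + 2 * (sinh (sqrt (- \<kappa>) * (x / 2)))\<^sup>2"
      using cosh_double[of "sqrt (- \<kappa>) * (x / 2)"] hyperbolic_pythagoras[of "sqrt (- \<kappa>) * (x / 2)"] by simp
    with 3 show ?thesis by (simp add: s_fun_def c_fun_def power_divide)
  qed (simp add: s_fun_def c_fun_def)
qed

lemma s_fun_double: "s_fun \<kappa> x = 2 * s_fun \<kappa> (x / 2) * c_fun \<kappa> (x / 2)"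
proof -
  have s: "sin (2 * (y / 2)) = 2 * sin (y / 2) * cos (y / 2)" for y :: real by (rule sin_double)
  have h: "sinh (2 * (y / 2)) = 2 * sinh (y / 2) * cosh (y / 2)" for y :: real by (rule sinh_double)
  show ?thesis
    using s[of "sqrt \<kappa> * x"] h[of "sqrt (- \<kappa>) * x"] by (auto simp: s_fun_def c_fun_def)
qed

text \<open>The range up to the first positive zero of \<open>s_fun\<close>, where the Jacobi
  solutions stay positive; the Bonnet-Myers bound places all distances in it.\<close>

definition s_dom :: "real \<Rightarrow> real \<Rightarrow> bool" where
  "s_dom \<kappa> w \<longleftrightarrow> (\<kappa> > 0 \<longrightarrow> w < pi / sqrt \<kappa>)"

lemma s_dom_mono: "s_dom \<kappa> w \<Longrightarrow> x \<le> w \<Longrightarrow> s_dom \<kappa> x"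
  by (auto simp: s_dom_def)

lemma s_fun_pos: assumes "0 < x" "s_dom \<kappa> x" shows "0 < s_fun \<kappa> x"
proof -
  have "sqrt \<kappa> * x < pi" if "\<kappa> > 0" using assms that by (simp add: s_dom_def field_simps)
  then show ?thesis using assms by (auto simp: s_fun_def intro!: sin_gt_zero divide_pos_pos)
qed

lemma s_fun_nonneg: "0 \<le> x \<Longrightarrow> s_dom \<kappa> x \<Longrightarrow> 0 \<le> s_fun \<kappa> x"
  using s_fun_pos[of x \<kappa>] by (cases "x = 0") auto

text \<open>The continuous extension of \<open>s_fun \<kappa> x / x\<close>, so that the estimates
  stay meaningful at distance 0.\<close>

definition sc_fun :: "real \<Rightarrow> real \<Rightarrow> real" where
  "sc_fun \<kappa> x = (if x = 0 then 1 else s_fun \<kappa> x / x)"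

lemma s_fun_sc: "s_fun \<kappa> x = x * sc_fun \<kappa> x"
  by (simp add: sc_fun_def)

lemma sc_fun_pos: "0 \<le> x \<Longrightarrow> s_dom \<kappa> x \<Longrightarrow> 0 < sc_fun \<kappa> x"
  using s_fun_pos[of x \<kappa>] by (simp add: sc_fun_def)

lemma isCont_s_fun: "isCont (s_fun \<kappa>) x"
  using s_fun_derivative[OF DERIV_ident, where x = x and T = UNIV and \<kappa> = \<kappa>] DERIV_isCont by blast

lemma isCont_c_fun: "isCont (c_fun \<kappa>) x"
  using c_fun_derivative[OF DERIV_ident, where x = x and T = UNIV and \<kappa> = \<kappa>] DERIV_isCont by blast

lemma isCont_sc_fun: "isCont (sc_fun \<kappa>) x"
proof (cases "x = 0")
  case True
  have "(s_fun \<kappa> has_real_derivative 1) (at 0)"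
    using s_fun_derivative[OF DERIV_ident, where x = 0 and T = UNIV and \<kappa> = \<kappa>] by simp
  then have "((\<lambda>h. s_fun \<kappa> h / h) \<longlongrightarrow> 1) (at 0)" by (simp add: has_field_derivative_iff)
  then have "(sc_fun \<kappa> \<longlongrightarrow> 1) (at 0)"
    by (rule tendsto_cong[THEN iffD1, rotated]) (simp add: sc_fun_def eventually_at_filter)
  then show ?thesis using True by (simp add: isCont_def sc_fun_def)
next
  case False
  have "isCont (\<lambda>x. s_fun \<kappa> x / x) x" using False isCont_s_fun by (intro continuous_intros) auto
  moreover have "\<forall>\<^sub>F y in nhds x. sc_fun \<kappa> y = s_fun \<kappa> y / y"
    using t1_space_nhds[OF False] by eventually_elim (simp add: sc_fun_def)
  ultimately show ?thesis using isCont_cong[of "sc_fun \<kappa>" "\<lambda>y. s_fun \<kappa> y / y" x] by blast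
qed

text \<open>Both values of \<open>s_fun\<close> are comparable with their arguments on [0, w1]. The
  point is a constant that survives w \<rightarrow> 0, because the Jacobi solutions are divided by
  \<open>s_fun \<kappa> w\<close>.\<close>

lemma s_fun_ratio_bound:
  assumes "s_dom \<kappa> w1" "0 < w1"
  obtains C where "C > 0" "\<And>x w. 0 < w \<Longrightarrow> w \<le> w1 \<Longrightarrow> 0 \<le> x \<Longrightarrow> x \<le> w \<Longrightarrow> s_fun \<kappa> x \<le> C * s_fun \<kappa> w"
proof -
  have c: "continuous_on {0..w1} (sc_fun \<kappa>)" using isCont_sc_fun by (simp add: continuous_at_imp_continuous_on)
  obtain m where m: "m \<in> {0..w1}" "\<And>x. x \<in> {0..w1} \<Longrightarrow> sc_fun \<kappa> m \<le> sc_fun \<kappa> x"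
    using continuous_attains_inf[OF _ _ c] assms by force
  obtain k where k: "k \<in> {0..w1}" "\<And>x. x \<in> {0..w1} \<Longrightarrow> sc_fun \<kappa> x \<le> sc_fun \<kappa> k"
    using continuous_attains_sup[OF _ _ c] assms by force
  have pos: "0 < sc_fun \<kappa> m" "0 < sc_fun \<kappa> k" using m k assms s_dom_mono by (auto intro!: sc_fun_pos)
  show ?thesis
  proof (rule that[of "sc_fun \<kappa> k / sc_fun \<kappa> m"])
    fix x w assume *: "0 < w" "w \<le> w1" "0 \<le> x" "x \<le> w"
    have "s_fun \<kappa> x \<le> w * sc_fun \<kappa> k"
      unfolding s_fun_sc[of _ x] using * k(2)[of x] pos s_dom_mono[OF assms(1), of x]
      by (intro mult_mono) (auto intro: less_imp_le sc_fun_pos)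
    also have "\<dots> \<le> w * (sc_fun \<kappa> k / sc_fun \<kappa> m * sc_fun \<kappa> w)"
      using * m(2)[of w] pos by (intro mult_left_mono) (auto simp: field_simps)
    also have "\<dots> = sc_fun \<kappa> k / sc_fun \<kappa> m * s_fun \<kappa> w" by (simp add: s_fun_sc)
    finally show "s_fun \<kappa> x \<le> sc_fun \<kappa> k / sc_fun \<kappa> m * s_fun \<kappa> w" .
  qed (use pos in simp)
qed

text \<open>The solution of \<open>u'' = - \<kappa> w\<^sup>2 u\<close> on \<open>[0, 1]\<close> with boundary values \<open>a\<close> and \<open>b\<close>, and its
  derivative.\<close>

definition jac :: "real \<Rightarrow> real \<Rightarrow> real \<Rightarrow> real \<Rightarrow> real \<Rightarrow> real" where
  "jac \<kappa> w a b x = (a * s_fun \<kappa> ((1 - x) * w) + b * s_fun \<kappa> (x * w)) / s_fun \<kappa> w"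

definition jac' :: "real \<Rightarrow> real \<Rightarrow> real \<Rightarrow> real \<Rightarrow> real \<Rightarrow> real" where
  "jac' \<kappa> w a b x = w * (b * c_fun \<kappa> (x * w) - a * c_fun \<kappa> ((1 - x) * w)) / s_fun \<kappa> w"

lemma jac_derivative:
  "(jac \<kappa> w a b has_real_derivative jac' \<kappa> w a b x) (at x within T)"
  unfolding jac_def[abs_def] jac'_def
  by (rule DERIV_cdivide) (auto intro!: derivative_eq_intros simp: algebra_simps)

lemma jac'_derivative:
  "(jac' \<kappa> w a b has_real_derivative - \<kappa> * w\<^sup>2 * jac \<kappa> w a b x) (at x within T)"
proof -
  have "((\<lambda>x. w * (b * c_fun \<kappa> (x * w) - a * c_fun \<kappa> ((1 - x) * w))) has_real_derivative
      - \<kappa> * w\<^sup>2 * (a * s_fun \<kappa> ((1 - x) * w) + b * s_fun \<kappa> (x * w))) (at x within T)"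
    by (auto intro!: derivative_eq_intros simp: algebra_simps power2_eq_square)
  from DERIV_cdivide[OF this, of "s_fun \<kappa> w"] show ?thesis by (simp add: jac_def jac'_def[abs_def])
qed

lemma continuous_on_jac: "continuous_on T (jac \<kappa> w a b)"
  by (meson DERIV_continuous continuous_on_eq_continuous_within jac_derivative)

lemma continuous_on_jac': "continuous_on T (jac' \<kappa> w a b)"
  by (meson DERIV_continuous continuous_on_eq_continuous_within jac'_derivative)

text \<open>Two solutions of the same equation without first order term have a constant Wronskian.
  This constancy turns the entropy term of the energy bound into an exact derivative.\<close>

lemma Wronskian_constant:
  "jac \<kappa> w a b x * jac' \<kappa> w a' b' x - jac' \<kappa> w a b x * jac \<kappa> w a' b' x
   = jac \<kappa> w a b 0 * jac' \<kappa> w a' b' 0 - jac' \<kappa> w a b 0 * jac \<kappa> w a' b' 0"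
  by (rule DERIV_isconst_all[of "\<lambda>x. jac \<kappa> w a b x * jac' \<kappa> w a' b' x - jac' \<kappa> w a b x * jac \<kappa> w a' b' x"])
    (auto intro!: derivative_eq_intros jac_derivative jac'_derivative simp: algebra_simps)

lemma jac_bounds:
  assumes w: "0 < w" "s_dom \<kappa> w" and ab: "0 \<le> a" "0 \<le> b" and x: "x \<in> {0..1}"
  shows "0 \<le> jac \<kappa> w a b x" "0 < a \<Longrightarrow> 0 < b \<Longrightarrow> 0 < jac \<kappa> w a b x"
    "(\<And>y. 0 \<le> y \<Longrightarrow> y \<le> w \<Longrightarrow> s_fun \<kappa> y \<le> C * s_fun \<kappa> w) \<Longrightarrow> jac \<kappa> w a b x \<le> C * (a + b)"
    "jac \<kappa> w a b 0 = a" "jac \<kappa> w a b 1 = b"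
proof -
  have sw: "0 < s_fun \<kappa> w" using w by (simp add: s_fun_pos)
  have le: "(1 - x) * w \<le> w" "x * w \<le> w" "0 \<le> (1 - x) * w" "0 \<le> x * w"
    using w x mult_right_mono[of "1 - x" 1 w] mult_right_mono[of x 1 w] by auto
  have d: "s_dom \<kappa> ((1 - x) * w)" "s_dom \<kappa> (x * w)" using le s_dom_mono w by blast+
  have nn: "0 \<le> s_fun \<kappa> ((1 - x) * w)" "0 \<le> s_fun \<kappa> (x * w)" using d le s_fun_nonneg by blast+
  show "0 \<le> jac \<kappa> w a b x" using nn ab sw by (simp add: jac_def)
  show "0 < jac \<kappa> w a b x" if p: "0 < a" "0 < b"
  proof (cases "x = 0")
    case False
    then have "0 < s_fun \<kappa> (x * w)" using d x w by (intro s_fun_pos) auto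
    then show ?thesis using nn p sw by (simp add: jac_def add_nonneg_pos)
  qed (use p sw in \<open>simp add: jac_def\<close>)
  show "jac \<kappa> w a b x \<le> C * (a + b)" if C: "\<And>y. 0 \<le> y \<Longrightarrow> y \<le> w \<Longrightarrow> s_fun \<kappa> y \<le> C * s_fun \<kappa> w"
  proof -
    have "a * s_fun \<kappa> ((1 - x) * w) + b * s_fun \<kappa> (x * w) \<le> a * (C * s_fun \<kappa> w) + b * (C * s_fun \<kappa> w)"
      using le ab by (intro add_mono mult_left_mono C) auto
    also have "\<dots> = C * (a + b) * s_fun \<kappa> w" by (simp add: algebra_simps)
    finally show ?thesis using sw by (simp add: jac_def pos_divide_le_eq)
  qed
  show "jac \<kappa> w a b 0 = a" "jac \<kappa> w a b 1 = b" using sw by (simp_all add: jac_def)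
qed

lemma jac'_boundary:
  assumes "0 < w" "s_dom \<kappa> w" "u0 > 0" "u1 > 0"
  shows "jac' \<kappa> w u0 u1 1 * jac \<kappa> w (t / u0) (s / u1) 1 - jac' \<kappa> w u0 u1 0 * jac \<kappa> w (t / u0) (s / u1) 0
    = (w / s_fun \<kappa> w) * ((s + t) * c_fun \<kappa> w - s * u0 / u1 - t * u1 / u0)"
proof -
  have "s_fun \<kappa> w \<noteq> 0" using s_fun_pos assms by force
  then show ?thesis using assms by (simp add: jac_def jac'_def field_simps)
qed

text \<open>Here \<open>u\<close> and \<open>y\<close> are the two Jacobi solutions, \<theta> is the
  derivative of the normalised arc length and \<open>e\<close> that of the entropy. The conclusion
  exceeds the hypothesis by the square \<open>2 N h u y (e / N + u' / u \<theta>)\<^sup>2\<close>,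
  and its big bracket is an exact derivative along the curve.\<close>

lemma step_algebra:
  fixes u y :: real
  assumes "u > 0" "y \<ge> 0" "N > 0" "h > 0"
    and Z: "Z \<le> (1 - 2 * K * (h * (u * y))) * (w * \<theta>)\<^sup>2 - 2 * (h * ((u' * y + u * y') * \<theta>)) * e
        - 2 * (h * (u * y)) / N * e\<^sup>2"
  shows "Z \<le> \<theta> * (w\<^sup>2 * \<theta> + 2 * N * h * ((- (K / N) * w\<^sup>2 * u * y + u' * y') * \<theta>
        + (u * y' - u' * y) * (- e / N - u' / u * \<theta>)))"
proof -
  have "\<theta> * (w\<^sup>2 * \<theta> + 2 * N * h * ((- (K / N) * w\<^sup>2 * u * y + u' * y') * \<theta>
        + (u * y' - u' * y) * (- e / N - u' / u * \<theta>)))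
     - ((1 - 2 * K * (h * (u * y))) * (w * \<theta>)\<^sup>2 - 2 * (h * ((u' * y + u * y') * \<theta>)) * e
        - 2 * (h * (u * y)) / N * e\<^sup>2) = 2 * N * h * (u * y) * (e / N + u' / u * \<theta>)\<^sup>2"
    using assms by (simp add: field_simps power2_eq_square)
  moreover have "0 \<le> 2 * N * h * (u * y) * (e / N + u' / u * \<theta>)\<^sup>2" using assms by simp
  ultimately show ?thesis using Z by linarith
qed

text \<open>Each \<open>B\<close> yields a linear bound on a length. Optimising over
  \<open>B\<close> recovers the bound of the squared distance by the energy without reparametrising
  the curve; the best choice is B = W.\<close>

lemma square_le_from_AMGM:
  fixes W D :: real
  assumes "W \<ge> 0" "\<And>B. B > 0 \<Longrightarrow> W \<le> (D / B + B) / 2" shows "W\<^sup>2 \<le> D"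
proof (cases "W > 0")
  case True
  then show ?thesis using assms(2)[of W] by (simp add: field_simps power2_eq_square)
next
  case False
  have "D \<ge> 0"
  proof (rule ccontr)
    assume "\<not> D \<ge> 0"
    \<comment> \<open>With this value the bound would be - 3 B / 2, which is negative.\<close>
    define B where "B = sqrt (- D) / 2"
    have B: "B > 0" "D = - 4 * B * B" using \<open>\<not> D \<ge> 0\<close> by (auto simp: B_def)
    have "D / B = - 4 * B" using B by simp
    then show False using assms(2)[OF B(1)] assms(1) B(1) by simp
  qed
  then show ?thesis using False assms(1) by simp
qed

text \<open>On the time scale \<open>\<delta>\<close> the constants \<open>K'\<close> and \<open>N'\<close> absorb the terms of second order in the time, so that
  first order variations give exact inequalities.\<close>

definition step_ok :: "real \<Rightarrow> real \<Rightarrow> real \<Rightarrow> real \<Rightarrow> real \<Rightarrow> bool" where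
  "step_ok K N K' N' \<delta> \<longleftrightarrow> N' > 0 \<and> \<delta> > 0 \<and> (\<forall>T\<in>{0..\<delta>}. exp (- 2 * K * T) \<le> 1 - 2 * K' * T \<and>
     2 * T / N' \<le> exp (2 * K * T) * exp_quot K (2 * T) / N)"

context qms
begin

lemma dominated_curve_mono:
  assumes "dominated_curve c \<gamma> H" "r \<in> {0..1}" shows "H 0 \<le> H r" "H r \<le> H 1"
proof -
  have mono: "H x \<le> H y" if p: "piece c \<gamma> H a b" "a \<le> x" "x \<le> y" "y \<le> b" for a b x y
  proof (rule DERIV_nonneg_imp_increasing_open[OF p(3)])
    show "\<exists>k. (H has_real_derivative k) (at z) \<and> 0 \<le> k" if "x < z" "z < y" for z
      using piece_interior[OF p(1), of z] that p by auto
    have "continuous_on {a..b} H"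
      using p(1) unfolding piece_def continuous_on_eq_continuous_within by (metis DERIV_continuous)
    then show "continuous_on {x..y} H" by (rule continuous_on_subset) (use p in auto)
  qed
  have "\<forall>r\<in>{0..b}. H 0 \<le> H r \<and> H r \<le> H b" if "rtranclp (piece c \<gamma> H) 0 b" for b
    using that
  proof induction
    case (step y z)
    have yz: "0 \<le> y" "y < z"
      using rtranclp_between[OF step.hyps(1) piece_lt[of c \<gamma> H]] piece_less[OF step.hyps(2)] by auto
    show ?case
    proof
      fix r assume r: "r \<in> {0..z}"
      have "H 0 \<le> H y" "H y \<le> H z" using step.IH yz mono[OF step.hyps(2), of y z] by auto
      then show "H 0 \<le> H r \<and> H r \<le> H z"
      proof (cases "r \<le> y")
        case True
        then have "H 0 \<le> H r \<and> H r \<le> H y" using step.IH r by simp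
        then show ?thesis using \<open>H y \<le> H z\<close> by simp
      next
        case False
        then show ?thesis
          using mono[OF step.hyps(2), of y r] mono[OF step.hyps(2), of r z] r \<open>H 0 \<le> H y\<close> by auto
      qed
    qed
  qed simp
  from this[of 1] show "H 0 \<le> H r" "H r \<le> H 1" using assms by (auto simp: dominated_curve_def)
qed

lemma continuous_on_L:
  assumes "continuous_on T \<gamma>" "\<And>r. r \<in> T \<Longrightarrow> \<gamma> r \<in> M" shows "continuous_on T (\<lambda>r. L (\<gamma> r))"
proof -
  have "continuous_on T (\<lambda>r. \<Sum>j=1..d. commutator (cadj (v j)) (commutator (v j) (\<gamma> r)))"
    unfolding commutator_def
    by (intro continuous_on_sum continuous_on_diff mm.continuous_on continuous_on_const assms)
  then show ?thesis by (rule continuous_on_eq) (use assms in \<open>simp add: L_commutators\<close>)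
qed

text \<open>The curve \<open>\<gamma>\<close> is transported by \<open>P\<close> run for the position dependent time \<open>h \<sigma>(\<theta>(r))\<close>, where \<open>\<theta>\<close> is the
  normalised arc length. The choice of \<open>\<sigma>\<close> as a product of two solutions of the Jacobi equation is the
  saddle point of the first order variation of the energy; completing the square in
  the lemma \<open>step_algebra\<close> is all that remains of this variational problem.\<close>

lemma transported_piece:
  assumes GE: "GE M \<tau> P d v K N" "N > 0" and ok: "step_ok K N K' N' \<delta>" and h: "h > 0"
    and w: "0 < w" "s_dom (K' / N') w" and u: "u0 > 0" "u1 > 0" and st: "s \<ge> 0" "t \<ge> 0"
    and p: "piece True \<gamma> H a b" and e: "\<epsilon> > 0" and B: "B > 0"
    and \<theta>: "\<And>r. \<theta> r = (H r - H 0 + \<epsilon> * r) / w" and \<theta>01: "\<And>r. r \<in> {a..b} \<Longrightarrow> \<theta> r \<in> {0..1}"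
    and small: "\<And>x. x \<in> {0..1} \<Longrightarrow> h * (jac (K' / N') w u0 u1 x * jac (K' / N') w (t / u0) (s / u1) x) \<le> \<delta>"
  defines "A \<equiv> jac (K' / N') w u0 u1" and "Y \<equiv> jac (K' / N') w (t / u0) (s / u1)"
    and "A' \<equiv> jac' (K' / N') w u0 u1" and "Y' \<equiv> jac' (K' / N') w (t / u0) (s / u1)"
  defines "\<eta> \<equiv> \<lambda>r. P (h * (A (\<theta> r) * Y (\<theta> r))) (\<gamma> r)"
  defines "G \<equiv> \<lambda>r. ((w\<^sup>2 * \<theta> r + 2 * N' * h * (A' (\<theta> r) * Y (\<theta> r)
      + (A 0 * Y' 0 - A' 0 * Y 0) * (- Ent \<tau> (\<eta> r) / N' - ln (A (\<theta> r))))) / B + B * \<theta> r) / 2"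
  shows "piece False \<eta> G a b"
proof -
  have N': "N' > 0" using ok by (simp add: step_ok_def)
  obtain \<gamma>' g where ab: "a < b" and c: "continuous_on {a..b} \<gamma>'" "continuous_on {a..b} g"
    and *: "\<And>r. r \<in> {a..b} \<Longrightarrow> \<gamma> r \<in> S \<and> \<gamma>' r \<in> M0 \<and> (\<gamma> has_vector_derivative \<gamma>' r) (at r within {a..b}) \<and>
        (H has_real_derivative g r) (at r within {a..b}) \<and> 0 \<le> g r \<and> met (\<gamma> r) (\<gamma>' r) \<le> (g r)\<^sup>2"
    using p unfolding piece_def by blast
  have g: "\<And>r. r \<in> {a..b} \<Longrightarrow> \<gamma> r \<in> S" "\<And>r. r \<in> {a..b} \<Longrightarrow> \<gamma>' r \<in> M0"
    "\<And>r. r \<in> {a..b} \<Longrightarrow> (\<gamma> has_vector_derivative \<gamma>' r) (at r within {a..b})"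
    "\<And>r. r \<in> {a..b} \<Longrightarrow> (H has_real_derivative g r) (at r within {a..b})"
    "\<And>r. r \<in> {a..b} \<Longrightarrow> 0 \<le> g r" "\<And>r. r \<in> {a..b} \<Longrightarrow> met (\<gamma> r) (\<gamma>' r) \<le> (g r)\<^sup>2"
    using * by blast+
  have gM: "\<And>r. r \<in> {a..b} \<Longrightarrow> \<gamma> r \<in> M" using g(1) states_posD(1) by blast
  \<comment> \<open>The slack \<epsilon> makes \<theta> strictly increasing even where \<gamma>
    rests. Positivity of \<open>th r\<close> is what later forces \<open>Dd r\<close> to be
    nonnegative.\<close>
  define th where "th r = (g r + \<epsilon>) / w" for r
  have th: "(\<theta> has_real_derivative th r) (at r within {a..b})" "th r > 0" if r: "r \<in> {a..b}" for r
  proof -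
    have "((\<lambda>r. (H r - H 0 + \<epsilon> * r) / w) has_real_derivative (g r - 0 + \<epsilon> * 1) / w) (at r within {a..b})"
      by (intro DERIV_cdivide DERIV_add DERIV_diff DERIV_const DERIV_cmult DERIV_ident g(4)[OF r])
    then show "(\<theta> has_real_derivative th r) (at r within {a..b})"
      by (simp add: th_def \<theta>[abs_def])
    show "th r > 0" using g(5)[OF r] e w by (simp add: th_def)
  qed
  define f where "f r = h * (A (\<theta> r) * Y (\<theta> r))" for r
  define f' where "f' r = h * ((A' (\<theta> r) * Y (\<theta> r) + A (\<theta> r) * Y' (\<theta> r)) * th r)" for r
  have dU: "((\<lambda>r. A (\<theta> r)) has_real_derivative A' (\<theta> r) * th r) (at r within {a..b})"
    and dY: "((\<lambda>r. Y (\<theta> r)) has_real_derivative Y' (\<theta> r) * th r) (at r within {a..b})"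
    and dU': "((\<lambda>r. A' (\<theta> r)) has_real_derivative (- (K' / N') * w\<^sup>2 * A (\<theta> r)) * th r) (at r within {a..b})"
    if r: "r \<in> {a..b}" for r
    unfolding A_def Y_def A'_def Y'_def
    by - (rule DERIV_chain2[OF jac_derivative th(1)[OF r]] DERIV_chain2[OF jac'_derivative th(1)[OF r]])+
  have UY: "0 < A x" "0 \<le> Y x" if "x \<in> {0..1}" for x
    unfolding A_def Y_def using jac_bounds(1,2)[OF w _ _ that] u st by simp_all
  have f0: "0 \<le> f r" "f r \<le> \<delta>" if "r \<in> {a..b}" for r
    using UY[OF \<theta>01[OF that]] small[OF \<theta>01[OF that]] h by (simp_all add: f_def A_def Y_def)
  have df: "(f has_real_derivative f' r) (at r within {a..b})" if r: "r \<in> {a..b}" for r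
    unfolding f_def[abs_def] f'_def
    using dU[OF r] dY[OF r] by (auto intro!: derivative_eq_intros simp: algebra_simps)
  define \<eta>' where "\<eta>' r = P (f r) (\<gamma>' r) - f' r *\<^sub>R P (f r) (L (\<gamma> r))" for r
  have \<eta>f: "\<eta> r = P (f r) (\<gamma> r)" for r by (simp add: \<eta>_def f_def)
  have \<eta>S: "\<eta> r \<in> S" if "r \<in> {a..b}" for r
    unfolding \<eta>f using P_states f0 g(1) that by blast
  have d\<eta>: "(\<eta> has_vector_derivative \<eta>' r) (at r within {a..b})" if r: "r \<in> {a..b}" for r
    unfolding \<eta>f[abs_def] \<eta>'_def
    using P_curve_derivative[OF g(3)[OF r] gM M0_in[OF g(2)[OF r]] df[OF r] f0(1) r] by blast
  have \<eta>'M0: "\<eta>' r \<in> M0" if r: "r \<in> {a..b}" for r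
    by (rule derivative_in_M0[OF d\<eta>[OF r] \<eta>S r]) (use r ab at_within_Icc_nontrivial in auto)
  have cont: "continuous_on {a..b} \<theta>" "continuous_on {a..b} f" "continuous_on {a..b} \<gamma>" "continuous_on {a..b} \<eta>"
    using th(1) df g(3) d\<eta> unfolding continuous_on_eq_continuous_within
    by (blast intro: DERIV_continuous has_vector_derivative_continuous)+
  have c\<eta>': "continuous_on {a..b} \<eta>'"
  proof -
    have "continuous_on {a..b} f'"
      unfolding f'_def th_def A_def Y_def A'_def Y'_def using w
      by (intro continuous_intros c continuous_on_compose2[OF continuous_on_jac[of UNIV]]
          continuous_on_compose2[OF continuous_on_jac'[of UNIV]] cont) auto
    then show ?thesis
      unfolding \<eta>'_def using f0 g(2) M0_in gM
      by (intro continuous_intros continuous_on_P cont c continuous_on_L) auto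
  qed
  define en where "en r = br (\<eta>' r) (mlog (\<eta> r))" for r
  have dEnt: "((\<lambda>r. Ent \<tau> (\<eta> r)) has_real_derivative en r) (at r within {a..b})" if r: "r \<in> {a..b}" for r
    unfolding en_def
    by (rule Ent_has_derivative[OF _ cont(4) \<eta>S r d\<eta>[OF r] M0_in[OF \<eta>'M0[OF r]]]) auto
  define Dd where "Dd r = w\<^sup>2 * th r + 2 * N' * h * ((- (K' / N') * w\<^sup>2 * A (\<theta> r) * Y (\<theta> r) + A' (\<theta> r) * Y' (\<theta> r)) * th r
        + (A (\<theta> r) * Y' (\<theta> r) - A' (\<theta> r) * Y (\<theta> r)) * (- en r / N' - A' (\<theta> r) / A (\<theta> r) * th r))" for r
  have dG: "(G has_real_derivative (Dd r / B + B * th r) / 2) (at r within {a..b})" if r: "r \<in> {a..b}" for r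
  proof -
    \<comment> \<open>\<open>G\<close> contains the Wronskian at 0; moving it to the current point
      gives the derivative the shape of \<open>step_algebra\<close>.\<close>
    have W: "A 0 * Y' 0 - A' 0 * Y 0 = A (\<theta> r) * Y' (\<theta> r) - A' (\<theta> r) * Y (\<theta> r)"
      unfolding A_def Y_def A'_def Y'_def by (rule Wronskian_constant[symmetric])
    have "A (\<theta> r) > 0" using UY(1)[OF \<theta>01[OF r]] .
    then show ?thesis
      unfolding G_def W Dd_def
      using th(1)[OF r] dU[OF r] dY[OF r] dU'[OF r] dEnt[OF r] N' B
      by (auto intro!: derivative_eq_intros simp: field_simps)
  qed
  have bound: "met (\<eta> r) (\<eta>' r) \<le> th r * Dd r" if r: "r \<in> {a..b}" for r
  proof -
    have z: "\<eta>' r = P (f r) (\<gamma>' r) - f' r *\<^sub>R L (P (f r) (\<gamma> r))"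
      using f0[OF r] gM[OF r] by (simp add: \<eta>'_def P_L)
    have "met (\<eta> r) (\<eta>' r) \<le> exp (- 2 * K * f r) * met (\<gamma> r) (\<gamma>' r) - 2 * f' r * en r
        - exp (2 * K * f r) * exp_quot K (2 * f r) / N * (en r)\<^sup>2"
      using speed_inequality[OF GE g(1)[OF r] f0(1)[OF r] g(2)[OF r], of "f' r"]
      by (simp add: en_def \<eta>f z)
    also have "\<dots> \<le> (1 - 2 * K' * f r) * (w * th r)\<^sup>2 - 2 * f' r * en r - 2 * f r / N' * (en r)\<^sup>2"
    proof -
      have ok': "exp (- 2 * K * f r) \<le> 1 - 2 * K' * f r"
        "2 * f r / N' \<le> exp (2 * K * f r) * exp_quot K (2 * f r) / N"
        using ok f0[OF r] unfolding step_ok_def by auto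
      have "met (\<gamma> r) (\<gamma>' r) \<le> (g r)\<^sup>2" using g(6)[OF r] .
      also have "\<dots> \<le> (w * th r)\<^sup>2" using g(5)[OF r] e w by (simp add: th_def power_mono)
      finally have "exp (- 2 * K * f r) * met (\<gamma> r) (\<gamma>' r) \<le> exp (- 2 * K * f r) * (w * th r)\<^sup>2"
        by (intro mult_left_mono) auto
      also have "\<dots> \<le> (1 - 2 * K' * f r) * (w * th r)\<^sup>2" using ok'(1) by (intro mult_right_mono) auto
      finally have 1: "exp (- 2 * K * f r) * met (\<gamma> r) (\<gamma>' r) \<le> (1 - 2 * K' * f r) * (w * th r)\<^sup>2" .
      have 2: "2 * f r / N' * (en r)\<^sup>2 \<le> exp (2 * K * f r) * exp_quot K (2 * f r) / N * (en r)\<^sup>2"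
        using ok'(2) by (intro mult_right_mono) auto
      show ?thesis using 1 2 by linarith
    qed
    finally show ?thesis
      unfolding Dd_def f_def f'_def using UY[OF \<theta>01[OF r]] N' h by (intro step_algebra) auto
  qed
  have "0 \<le> (Dd r / B + B * th r) / 2 \<and> met (\<eta> r) (\<eta>' r) \<le> ((Dd r / B + B * th r) / 2)\<^sup>2"
    if r: "r \<in> {a..b}" for r
  proof -
    have "0 \<le> th r * Dd r" using bound[OF r] met_nonneg[OF \<eta>S[OF r] \<eta>'M0[OF r]] by linarith
    then have D0: "0 \<le> Dd r" using th(2)[OF r] by (simp add: zero_le_mult_iff)
    \<comment> \<open>The arithmetic-geometric mean inequality bounds the speed, which is at most
      sqrt(th r * Dd r), by the derivative of \<open>G\<close>, whatever the weight
      \<open>B\<close>.\<close>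
    have "4 * (X * Z) \<le> (X + Z)\<^sup>2" for X Z :: real using sum_squares_bound[of X Z] by (simp add: power2_sum)
    from this[of "Dd r / B" "B * th r"] have "th r * Dd r \<le> ((Dd r / B + B * th r) / 2)\<^sup>2"
      using B by (simp add: power_divide mult.commute)
    then show ?thesis using bound[OF r] D0 B th(2)[OF r] by simp
  qed
  then show ?thesis
    unfolding piece_def using ab c\<eta>' \<eta>S \<eta>'M0 d\<eta> dG
    by (intro conjI exI[of _ \<eta>'] exI[of _ "\<lambda>r. (Dd r / B + B * th r) / 2"]) auto
qed

end

subsection \<open>First order variation of the distance\<close>

text \<open>Halving keeps the argument below pi / (2 sqrt \<kappa>), where the derivative
  \<open>c_fun\<close> is nonnegative; on the whole range up to pi / sqrt \<kappa> the sine is not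
  monotone.\<close>

lemma s_fun_half_mono:
  assumes "0 \<le> x" "x \<le> y" "s_dom \<kappa> y" shows "s_fun \<kappa> (x / 2) \<le> s_fun \<kappa> (y / 2)"
proof (rule DERIV_nonneg_imp_nondecreasing[of "x / 2" "y / 2" "s_fun \<kappa>"])
  fix z assume z: "x / 2 \<le> z" "z \<le> y / 2"
  have "0 \<le> c_fun \<kappa> z"
  proof (cases "\<kappa> > 0")
    case True
    have "sqrt \<kappa> * (2 * z) \<le> sqrt \<kappa> * y" using z True by (intro mult_left_mono) auto
    also have "\<dots> < pi" using assms(3) True by (simp add: s_dom_def field_simps)
    finally have "sqrt \<kappa> * z \<le> pi / 2" by simp
    moreover have "0 \<le> sqrt \<kappa> * z" using z assms True by simp
    ultimately show ?thesis using True by (auto simp: c_fun_def intro!: cos_ge_zero)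
  qed (auto simp: c_fun_def)
  then show "\<exists>k. (s_fun \<kappa> has_real_derivative k) (at z) \<and> 0 \<le> k"
    using s_fun_derivative[OF DERIV_ident, where x = z and T = UNIV and \<kappa> = \<kappa>] by auto
qed (use assms in simp)

text \<open>First order expansion in \<open>h\<close>. The square root is not differentiable at the
  origin, so w = 0 goes through \<open>sc_fun\<close>; for w > 0 the double angle formula yields the
  same coefficient.\<close>

lemma s_fun_sqrt_expansion:
  assumes w: "0 \<le> w" "s_dom \<kappa> w" and k: "w = 0 \<Longrightarrow> 0 \<le> k" and "\<epsilon> > 0"
  shows "\<forall>\<^sub>F h in at_right 0. (s_fun \<kappa> (sqrt (w\<^sup>2 + k * h) / 2))\<^sup>2 \<le> (s_fun \<kappa> (w / 2))\<^sup>2 + h * (k * sc_fun \<kappa> w / 4 + \<epsilon>)"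
proof (cases "w = 0")
  case True
  have "((\<lambda>h. sqrt (k * h) / 2) \<longlongrightarrow> sqrt (k * 0) / 2) (at_right 0)"
    by (intro tendsto_intros) simp
  then have "((\<lambda>h. sc_fun \<kappa> (sqrt (k * h) / 2)) \<longlongrightarrow> sc_fun \<kappa> 0) (at_right 0)"
    using isCont_tendsto_compose[OF isCont_sc_fun] by simp
  then have "((\<lambda>h. k * (sc_fun \<kappa> (sqrt (k * h) / 2))\<^sup>2 / 4) \<longlongrightarrow> k * 1\<^sup>2 / 4) (at_right 0)"
    by (intro tendsto_intros) (simp_all add: sc_fun_def)
  then have "\<forall>\<^sub>F h in at_right 0. k * (sc_fun \<kappa> (sqrt (k * h) / 2))\<^sup>2 / 4 < k / 4 + \<epsilon>"
    by (rule order_tendstoD) (use \<open>\<epsilon> > 0\<close> in simp)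
  then show ?thesis
    using eventually_at_right_less[of "0::real"]
  proof eventually_elim
    case (elim h)
    have "(s_fun \<kappa> (sqrt (k * h) / 2))\<^sup>2 = h * (k * (sc_fun \<kappa> (sqrt (k * h) / 2))\<^sup>2 / 4)"
      using elim k[OF True] by (simp add: s_fun_sc[of _ "sqrt (k * h) / 2"] power_mult_distrib power_divide)
    also have "\<dots> \<le> h * (k / 4 + \<epsilon>)" using elim by (intro mult_left_mono) auto
    finally show ?case using True by (simp add: sc_fun_def)
  qed
next
  case False
  then have "w > 0" using w by simp
  let ?f = "\<lambda>h. (s_fun \<kappa> (sqrt (w\<^sup>2 + k * h) / 2))\<^sup>2"
  have "(?f has_real_derivative (2 * s_fun \<kappa> (w / 2) * (c_fun \<kappa> (w / 2) * (k / (2 * w) / 2)))) (at 0)"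
    using \<open>w > 0\<close> by (auto intro!: derivative_eq_intros simp: field_simps)
  moreover have "2 * s_fun \<kappa> (w / 2) * (c_fun \<kappa> (w / 2) * (k / (2 * w) / 2)) = k * sc_fun \<kappa> w / 4"
    using \<open>w > 0\<close> by (simp add: sc_fun_def s_fun_double[of \<kappa> w])
  ultimately have "(?f has_real_derivative k * sc_fun \<kappa> w / 4) (at 0)" by (simp only:)
  then have "((\<lambda>h. (?f h - ?f 0) / h) \<longlongrightarrow> k * sc_fun \<kappa> w / 4) (at 0)"
    by (simp add: has_field_derivative_iff)
  then have "((\<lambda>h. (?f h - ?f 0) / h) \<longlongrightarrow> k * sc_fun \<kappa> w / 4) (at_right 0)"
    by (rule tendsto_within_subset) simp
  then have "\<forall>\<^sub>F h in at_right 0. (?f h - ?f 0) / h < k * sc_fun \<kappa> w / 4 + \<epsilon>"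
    by (rule order_tendstoD) (use \<open>\<epsilon> > 0\<close> in simp)
  then show ?thesis
    using eventually_at_right_less[of "0::real"]
    by eventually_elim (use \<open>w > 0\<close> in \<open>simp add: field_simps\<close>)
qed

lemma exp_quot_derivative: "(exp_quot \<alpha> has_real_derivative exp (- \<alpha> * x)) (at x)"
  unfolding exp_quot_def[abs_def] by (cases "\<alpha> = 0") (auto intro!: derivative_eq_intros)

text \<open>The distance estimate for small steps is one-sided, so the comparison works with an
  upper Dini derivative. At the last point where \<open>f\<close> is at most the solution
  \<open>B\<close> of the equation with source \<beta> + \<epsilon> both agree, and beyond it
  \<open>f\<close> would have to grow faster than allowed.\<close>

lemma Gronwall_Dini:
  fixes f :: "real \<Rightarrow> real"
  assumes cont: "continuous_on {0..1} f"
    and dini: "\<And>x \<epsilon>. 0 \<le> x \<Longrightarrow> x < 1 \<Longrightarrow> 0 < \<epsilon> \<Longrightarrow>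
      \<forall>\<^sub>F h in at_right 0. f (x + h) \<le> f x + h * (- \<alpha> * f x + \<beta> + \<epsilon>)"
  shows "f 1 \<le> exp (- \<alpha>) * f 0 + \<beta> * exp_quot \<alpha> 1"
proof -
  have main: "f 1 \<le> exp (- \<alpha>) * f 0 + (\<beta> + \<epsilon>) * exp_quot \<alpha> 1" if "\<epsilon> > 0" for \<epsilon>
  proof (rule ccontr)
    assume neg: "\<not> ?thesis"
    define B where "B x = exp (- \<alpha> * x) * f 0 + (\<beta> + \<epsilon>) * exp_quot \<alpha> x" for x
    have dB: "(B has_real_derivative - \<alpha> * B x + \<beta> + \<epsilon>) (at x)" for x
    proof -
      have "(B has_real_derivative (exp (- \<alpha> * x) * (- \<alpha>)) * f 0 + (\<beta> + \<epsilon>) * exp (- \<alpha> * x)) (at x)"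
        unfolding B_def[abs_def] by (auto intro!: derivative_eq_intros exp_quot_derivative)
      moreover have ex: "exp (- \<alpha> * x) = 1 - \<alpha> * exp_quot \<alpha> x" by (simp add: exp_quot_def)
      have "(exp (- \<alpha> * x) * (- \<alpha>)) * f 0 + (\<beta> + \<epsilon>) * exp (- \<alpha> * x) = - \<alpha> * B x + \<beta> + \<epsilon>"
        unfolding B_def ex by (simp add: algebra_simps)
      ultimately show ?thesis by simp
    qed
    have cB: "continuous_on {0..1} B" by (meson DERIV_continuous_on dB has_field_derivative_at_within)
    define Z where "Z = {x \<in> {0..1}. f x - B x \<le> 0}"
    have "closed Z"
    proof -
      have "Z = {0..1} \<inter> (\<lambda>x. f x - B x) -` {..0}" by (auto simp: Z_def)
      moreover have "closed ({0..1} \<inter> (\<lambda>x. f x - B x) -` {..0})"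
        by (intro continuous_closed_preimage continuous_on_diff cont cB) auto
      ultimately show ?thesis by simp
    qed
    have "compact Z"
    proof -
      have "Z = {0..1} \<inter> Z" by (auto simp: Z_def)
      then show ?thesis using \<open>closed Z\<close> compact_Int_closed[of "{0..1::real}" Z] by simp
    qed
    moreover have "0 \<in> Z" by (simp add: Z_def B_def exp_quot_def)
    ultimately obtain x where x: "x \<in> Z" "\<And>y. y \<in> Z \<Longrightarrow> y \<le> x"
      using compact_attains_sup[of Z] by blast
    have "1 \<notin> Z" using neg by (simp add: Z_def B_def)
    then have x01: "0 \<le> x" "x < 1" using x(1) by (auto simp: Z_def less_le)
    have evlt: "\<forall>\<^sub>F h in at_right 0. x + h < 1"
      using eventually_at_right_real[of 0 "1 - x"] x01 by (auto elim!: eventually_mono)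
    have pos: "\<forall>\<^sub>F h in at_right 0. f (x + h) - B (x + h) > 0"
      using evlt eventually_at_right_less[of "0::real"]
    proof eventually_elim
      case (elim h)
      then have "x + h \<notin> Z" using x(2)[of "x + h"] by auto
      then show ?case using elim x01 by (simp add: Z_def)
    qed
    have "((\<lambda>h. (B (x + h) - B x) / h) \<longlongrightarrow> - \<alpha> * B x + \<beta> + \<epsilon>) (at 0)"
      using dB[of x] by (simp add: DERIV_def)
    then have "((\<lambda>h. (B (x + h) - B x) / h) \<longlongrightarrow> - \<alpha> * B x + \<beta> + \<epsilon>) (at_right 0)"
      by (rule tendsto_within_subset) simp
    then have evB: "\<forall>\<^sub>F h in at_right 0. (B (x + h) - B x) / h > - \<alpha> * B x + \<beta> + \<epsilon> / 2"
      by (rule order_tendstoD) (use that in simp)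
    have "f x - B x = 0"
    proof (rule ccontr)
      assume "f x - B x \<noteq> 0"
      then have lt: "f x - B x < 0" using x(1) by (simp add: Z_def)
      have "((\<lambda>y. f y - B y) \<longlongrightarrow> f x - B x) (at x within {0..1})"
        using x01 cont cB by (intro tendsto_diff) (auto simp: continuous_on)
      then have "((\<lambda>y. f y - B y) \<longlongrightarrow> f x - B x) (at x within {x..1})"
        by (rule tendsto_within_subset) (use x01 in auto)
      then have "((\<lambda>y. f y - B y) \<longlongrightarrow> f x - B x) (at_right x)"
        using x01 by (simp add: at_within_Icc_at_right)
      then have "\<forall>\<^sub>F y in at_right x. f y - B y < 0" by (rule order_tendstoD) (rule lt)
      then have "\<forall>\<^sub>F h in at_right 0. f (x + h) - B (x + h) < 0"
        by (simp add: eventually_at_right_to_0[of _ x] add.commute)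
      with pos have "\<forall>\<^sub>F h in at_right (0::real). False" by eventually_elim simp
      then show False by simp
    qed
    then have fx: "f x = B x" by simp
    \<comment> \<open>Half of \<epsilon> is spent here and the other half in \<open>evB\<close>,
      which makes the contradiction strict.\<close>
    have "\<forall>\<^sub>F h in at_right 0. f (x + h) \<le> f x + h * (- \<alpha> * f x + \<beta> + \<epsilon> / 2)"
      by (rule dini[OF x01]) (use that in simp)
    then have "\<forall>\<^sub>F h in at_right (0::real). False"
      using evB pos eventually_at_right_less[of "0::real"]
    proof eventually_elim
      case (elim h)
      then have "B (x + h) - B x > h * (- \<alpha> * B x + \<beta> + \<epsilon> / 2)" by (simp add: field_simps)
      with elim fx show ?case by simp
    qed
    then show False by simp
  qed
  have "((\<lambda>\<epsilon>. exp (- \<alpha>) * f 0 + (\<beta> + \<epsilon>) * exp_quot \<alpha> 1) \<longlongrightarrow> exp (- \<alpha>) * f 0 + (\<beta> + 0) * exp_quot \<alpha> 1) (at_right 0)"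
    by (intro tendsto_intros)
  then have "f 1 \<le> exp (- \<alpha>) * f 0 + (\<beta> + 0) * exp_quot \<alpha> 1"
    by (rule tendsto_lowerbound) (use main in \<open>auto simp: eventually_at_filter\<close>)
  then show ?thesis by simp
qed

context qms
begin

lemma U_pos: "U \<tau> N \<rho> > 0" by (simp add: U_def)

lemma ln_U: "ln (U \<tau> N \<rho>) = - Ent \<tau> \<rho> / N" by (simp add: U_def)

text \<open>The pieces chain up to a bound by the increment of one function \<open>D\<close>.
  Evaluating \<open>u0\<close> and \<open>u1\<close> at the ends of the transported curve makes the
  logarithmic terms cancel the entropies there, so the boundary values of the Jacobi solutions are
  all that is left.\<close>

lemma transport_estimate:
  assumes GE: "GE M \<tau> P d v K N" "N > 0" and ok: "step_ok K N K' N' \<delta>" and h: "h > 0"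
    and \<rho>: "\<rho>\<^sub>0 \<in> S" "\<rho>\<^sub>1 \<in> S" and w: "Wd \<rho>\<^sub>0 \<rho>\<^sub>1 < w" "s_dom (K' / N') w" and st: "s \<ge> 0" "t \<ge> 0"
  defines "u0 \<equiv> U \<tau> N' (P (h * t) \<rho>\<^sub>0)" and "u1 \<equiv> U \<tau> N' (P (h * s) \<rho>\<^sub>1)"
  assumes small: "\<And>x. x \<in> {0..1} \<Longrightarrow> h * (jac (K' / N') w u0 u1 x * jac (K' / N') w (t / u0) (s / u1) x) \<le> \<delta>"
  shows "(Wd (P (h * t) \<rho>\<^sub>0) (P (h * s) \<rho>\<^sub>1))\<^sup>2 \<le> w\<^sup>2 + 2 * N' * h * ((w / s_fun (K' / N') w) *
      ((s + t) * c_fun (K' / N') w - s * u0 / u1 - t * u1 / u0))"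
proof -
  have u: "u0 > 0" "u1 > 0" by (simp_all add: u0_def u1_def U_pos)
  have w0: "w > 0" using w(1) Wd_nonneg[OF \<rho>] by simp
  have PS: "P (h * t) \<rho>\<^sub>0 \<in> S" "P (h * s) \<rho>\<^sub>1 \<in> S" using P_states \<rho> h st by auto
  obtain \<gamma> H where \<gamma>: "dominated_curve True \<gamma> H" "\<gamma> 0 = \<rho>\<^sub>0" "\<gamma> 1 = \<rho>\<^sub>1" "H 1 - H 0 < w"
    by (rule Wd_less[OF \<rho> w(1)]) (rule that, assumption+)
  \<comment> \<open>The slack between \<open>w\<close> and the length is spread linearly, so that
    \<theta> runs exactly from 0 to 1.\<close>
  define \<epsilon> where "\<epsilon> = w - (H 1 - H 0)"
  have \<epsilon>: "\<epsilon> > 0" using \<gamma>(4) by (simp add: \<epsilon>_def)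
  define \<theta> where "\<theta> r = (H r - H 0 + \<epsilon> * r) / w" for r
  have \<theta>0: "\<theta> 0 = 0" and \<theta>1: "\<theta> 1 = 1" using w0 by (simp_all add: \<theta>_def \<epsilon>_def)
  have \<theta>01: "\<theta> r \<in> {0..1}" if r: "r \<in> {0..1}" for r
  proof -
    have H: "H 0 \<le> H r" "H r \<le> H 1" using dominated_curve_mono[OF \<gamma>(1) r] by auto
    have "\<epsilon> * r \<le> \<epsilon> * 1" using \<epsilon> r by (intro mult_left_mono) auto
    then have "H r - H 0 + \<epsilon> * r \<le> w" using H by (simp add: \<epsilon>_def)
    then show ?thesis using H \<epsilon> r w0 by (simp add: \<theta>_def)
  qed
  let ?\<kappa> = "K' / N'"
  let ?A = "jac ?\<kappa> w u0 u1" and ?Y = "jac ?\<kappa> w (t / u0) (s / u1)"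
  let ?A' = "jac' ?\<kappa> w u0 u1" and ?Y' = "jac' ?\<kappa> w (t / u0) (s / u1)"
  define \<eta> where "\<eta> r = P (h * (?A (\<theta> r) * ?Y (\<theta> r))) (\<gamma> r)" for r
  define D where "D r = w\<^sup>2 * \<theta> r + 2 * N' * h * (?A' (\<theta> r) * ?Y (\<theta> r)
      + (?A 0 * ?Y' 0 - ?A' 0 * ?Y 0) * (- Ent \<tau> (\<eta> r) / N' - ln (?A (\<theta> r))))" for r
  \<comment> \<open>The product of the two solutions is t at 0 and s at 1, so the ends flow for the
    times h t and h s.\<close>
  have A01: "?A 0 = u0" "?A 1 = u1" "?Y 0 = t / u0" "?Y 1 = s / u1"
    using jac_bounds(4,5)[OF w0 w(2), of u0 u1 0] jac_bounds(4,5)[OF w0 w(2), of "t / u0" "s / u1" 0] u st by auto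
  have \<eta>0: "\<eta> 0 = P (h * t) \<rho>\<^sub>0" and \<eta>1: "\<eta> 1 = P (h * s) \<rho>\<^sub>1"
    using u by (simp_all add: \<eta>_def \<theta>0 \<theta>1 A01 \<gamma>)
  have E: "- Ent \<tau> (\<eta> 0) / N' - ln u0 = 0" "- Ent \<tau> (\<eta> 1) / N' - ln u1 = 0"
    by (simp_all add: \<eta>0 \<eta>1 u0_def u1_def ln_U)
  have "D 1 - D 0 = w\<^sup>2 + 2 * N' * h * (?A' 1 * ?Y 1 - ?A' 0 * ?Y 0)"
    unfolding D_def \<theta>0 \<theta>1 A01(1,2) E by (simp add: algebra_simps)
  also have "?A' 1 * ?Y 1 - ?A' 0 * ?Y 0 = (w / s_fun ?\<kappa> w) * ((s + t) * c_fun ?\<kappa> w - s * u0 / u1 - t * u1 / u0)"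
    by (rule jac'_boundary[OF w0 w(2) u])
  finally have D: "D 1 - D 0 = w\<^sup>2 + 2 * N' * h * ((w / s_fun ?\<kappa> w) * ((s + t) * c_fun ?\<kappa> w - s * u0 / u1 - t * u1 / u0))" .
  have "Wd (P (h * t) \<rho>\<^sub>0) (P (h * s) \<rho>\<^sub>1) \<le> ((D 1 - D 0) / B + B) / 2" if B: "B > 0" for B
  proof -
    have "rtranclp (\<lambda>x y. piece True \<gamma> H x y \<and> 0 \<le> x \<and> y \<le> 1) 0 1"
      using rtranclp_between[OF \<gamma>(1)[unfolded dominated_curve_def] piece_lt[of True \<gamma> H]] by blast
    then have "rtranclp (piece False \<eta> (\<lambda>r. (D r / B + B * \<theta> r) / 2)) 0 1"
    proof (rule rtranclp_mono[THEN predicate2D, rotated], intro predicate2I)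
      fix x y assume xy: "piece True \<gamma> H x y \<and> 0 \<le> x \<and> y \<le> 1"
      show "piece False \<eta> (\<lambda>r. (D r / B + B * \<theta> r) / 2) x y"
        unfolding \<eta>_def[abs_def] D_def
        by (rule transported_piece[OF GE ok h w0 w(2) u st _ \<epsilon> B \<theta>_def _ small]) (use xy \<theta>01 in auto)
    qed
    then have "dominated_curve False \<eta> (\<lambda>r. (D r / B + B * \<theta> r) / 2)" by (simp add: dominated_curve_def)
    from Wd_le[OF this \<eta>0 \<eta>1] show ?thesis by (simp add: \<theta>0 \<theta>1 diff_divide_distrib add_divide_distrib)
  qed
  then have "(Wd (P (h * t) \<rho>\<^sub>0) (P (h * s) \<rho>\<^sub>1))\<^sup>2 \<le> D 1 - D 0"
    using Wd_nonneg[OF PS] by (intro square_le_from_AMGM)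
  then show ?thesis unfolding D .
qed

lemma continuous_on_U_P:
  assumes "\<rho> \<in> S" "t \<ge> 0" shows "continuous_on {0..1} (\<lambda>h. U \<tau> N (P (h * t) \<rho>))"
proof -
  have "continuous_on {0..1} (\<lambda>h. Ent \<tau> (P (h * t) \<rho>))"
    using assms states_posD(1)[OF assms(1)] P_states
    by (intro continuous_on_Ent continuous_on_P continuous_intros) auto
  then show ?thesis unfolding U_def by (intro continuous_intros)
qed

lemma U_P_tendsto:
  assumes "\<rho> \<in> S" "t \<ge> 0" shows "((\<lambda>h. U \<tau> N (P (h * t) \<rho>)) \<longlongrightarrow> U \<tau> N \<rho>) (at_right 0)"
proof -
  have "((\<lambda>h. U \<tau> N (P (h * t) \<rho>)) \<longlongrightarrow> U \<tau> N (P (0 * t) \<rho>)) (at 0 within {0..1})"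
    using bspec[OF continuous_on_U_P[OF assms, of N, unfolded continuous_on], of 0] by simp
  then show ?thesis using states_posD(1)[OF assms(1)] by (simp add: at_within_Icc_at_right)
qed

lemma U_P_bounds:
  assumes "\<rho> \<in> S" "t \<ge> 0"
  obtains l m where "0 < l" "\<And>h. h \<in> {0..1} \<Longrightarrow> l \<le> U \<tau> N (P (h * t) \<rho>) \<and> U \<tau> N (P (h * t) \<rho>) \<le> m"
proof -
  note c = continuous_on_U_P[OF assms, of N]
  obtain a where a: "\<And>h. h \<in> {0..1} \<Longrightarrow> U \<tau> N (P (a * t) \<rho>) \<le> U \<tau> N (P (h * t) \<rho>)"
    using continuous_attains_inf[OF _ _ c] by force
  obtain b where b: "\<And>h. h \<in> {0..1} \<Longrightarrow> U \<tau> N (P (h * t) \<rho>) \<le> U \<tau> N (P (b * t) \<rho>)"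
    using continuous_attains_sup[OF _ _ c] by force
  show ?thesis by (rule that[OF U_pos]) (use a b in blast)
qed

text \<open>The infimum may not be attained and the Jacobi solutions need a positive length, so the
  estimate is used for z > w and z tends to w. To keep \<open>h\<close> fixed in this limit, the
  admissible times are bounded independently of z.\<close>

lemma W_step:
  assumes GE: "GE M \<tau> P d v K N" "N > 0" and ok: "step_ok K N K' N' \<delta>"
    and \<rho>: "\<rho>\<^sub>0 \<in> S" "\<rho>\<^sub>1 \<in> S" and dom: "s_dom (K' / N') (Wd \<rho>\<^sub>0 \<rho>\<^sub>1)" and st: "s \<ge> 0" "t \<ge> 0"
  defines "w \<equiv> Wd \<rho>\<^sub>0 \<rho>\<^sub>1" and "u0 \<equiv> \<lambda>h. U \<tau> N' (P (h * t) \<rho>\<^sub>0)" and "u1 \<equiv> \<lambda>h. U \<tau> N' (P (h * s) \<rho>\<^sub>1)"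
  shows "\<forall>\<^sub>F h in at_right 0. (Wd (P (h * t) \<rho>\<^sub>0) (P (h * s) \<rho>\<^sub>1))\<^sup>2 \<le> w\<^sup>2 + 2 * N' * h *
      (((s + t) * c_fun (K' / N') w - s * u0 h / u1 h - t * u1 h / u0 h) / sc_fun (K' / N') w)"
proof -
  let ?\<kappa> = "K' / N'"
  have w0: "w \<ge> 0" using Wd_nonneg[OF \<rho>] by (simp add: w_def)
  have ok': "\<delta> > 0" using ok by (simp add: step_ok_def)
  obtain w1 where w1: "w < w1" "s_dom ?\<kappa> w1"
  proof (cases "?\<kappa> > 0")
    case True
    then have "w < pi / sqrt ?\<kappa>" using dom by (simp add: s_dom_def w_def)
    then obtain z where "w < z" "z < pi / sqrt ?\<kappa>" using dense by blast
    then show ?thesis using that by (simp add: s_dom_def)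
  next
    case False
    then show ?thesis using that[of "w + 1"] by (simp add: s_dom_def)
  qed
  have "0 < w1" using w0 w1 by simp
  obtain C where C: "C > 0" "\<And>x w. 0 < w \<Longrightarrow> w \<le> w1 \<Longrightarrow> 0 \<le> x \<Longrightarrow> x \<le> w \<Longrightarrow> s_fun ?\<kappa> x \<le> C * s_fun ?\<kappa> w"
    by (rule s_fun_ratio_bound[OF w1(2) \<open>0 < w1\<close>]) (rule that, assumption+)
  obtain l m where "0 < l" "\<And>h. h \<in> {0..1} \<Longrightarrow> l \<le> U \<tau> N' (P (h * t) \<rho>\<^sub>0) \<and> U \<tau> N' (P (h * t) \<rho>\<^sub>0) \<le> m"
    by (rule U_P_bounds[OF \<rho>(1) st(2), of N']) (rule that, assumption+)
  then have lm: "0 < l" "\<And>h. h \<in> {0..1} \<Longrightarrow> l \<le> u0 h \<and> u0 h \<le> m" by (auto simp: u0_def)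
  obtain l' m' where "0 < l'" "\<And>h. h \<in> {0..1} \<Longrightarrow> l' \<le> U \<tau> N' (P (h * s) \<rho>\<^sub>1) \<and> U \<tau> N' (P (h * s) \<rho>\<^sub>1) \<le> m'"
    by (rule U_P_bounds[OF \<rho>(2) st(1), of N']) (rule that, assumption+)
  then have lm': "0 < l'" "\<And>h. h \<in> {0..1} \<Longrightarrow> l' \<le> u1 h \<and> u1 h \<le> m'" by (auto simp: u1_def)
  \<comment> \<open>Bounds the product of the two Jacobi solutions for all z up to \<open>w1\<close>
    and all \<open>h\<close> up to 1.\<close>
  define Bd where "Bd = (C * (m + m')) * (C * (t / l + s / l'))"
  have mm: "0 < m" "0 < m'" using lm(1) lm(2)[of 0] lm'(1) lm'(2)[of 0] by auto
  have Bd: "Bd \<ge> 0" using C lm lm' mm st by (simp add: Bd_def)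
  define h0 where "h0 = min 1 (\<delta> / (Bd + 1))"
  have h0: "h0 > 0" using ok' Bd by (simp add: h0_def)
  have u: "u0 h > 0" "u1 h > 0" for h by (simp_all add: u0_def u1_def U_pos)
  define R where "R h z = z\<^sup>2 + 2 * N' * h * (((s + t) * c_fun ?\<kappa> z - s * u0 h / u1 h - t * u1 h / u0 h) / sc_fun ?\<kappa> z)" for h z
  have main: "(Wd (P (h * t) \<rho>\<^sub>0) (P (h * s) \<rho>\<^sub>1))\<^sup>2 \<le> R h w" if h: "0 < h" "h < h0" for h
  proof -
    have h1: "h \<in> {0..1}" "h * Bd \<le> \<delta>"
    proof -
      show "h \<in> {0..1}" using h by (simp add: h0_def)
      have "h * Bd \<le> h * (Bd + 1)" using h by simp
      also have "\<dots> \<le> \<delta> / (Bd + 1) * (Bd + 1)" using h Bd by (intro mult_right_mono) (auto simp: h0_def)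
      also have "\<dots> = \<delta>" using Bd by simp
      finally show "h * Bd \<le> \<delta>" .
    qed
    have le: "(Wd (P (h * t) \<rho>\<^sub>0) (P (h * s) \<rho>\<^sub>1))\<^sup>2 \<le> R h z" if z: "w < z" "z < w1" for z
    proof -
      have z0: "0 < z" using w0 z by simp
      have dz: "s_dom ?\<kappa> z" using s_dom_mono[OF w1(2)] z by simp
      have Cz: "\<And>y. 0 \<le> y \<Longrightarrow> y \<le> z \<Longrightarrow> s_fun ?\<kappa> y \<le> C * s_fun ?\<kappa> z" using C(2)[OF z0] z by simp
      have sm: "h * (jac ?\<kappa> z (u0 h) (u1 h) x * jac ?\<kappa> z (t / u0 h) (s / u1 h) x) \<le> \<delta>" if x: "x \<in> {0..1}" for x
      proof -
        have nn: "0 \<le> t / u0 h" "0 \<le> s / u1 h" "0 \<le> u0 h" "0 \<le> u1 h"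
          using st u by (auto intro: less_imp_le divide_nonneg_pos)
        have "jac ?\<kappa> z (u0 h) (u1 h) x \<le> C * (u0 h + u1 h)"
          by (rule jac_bounds(3)[OF z0 dz nn(3,4) x Cz])
        also have "\<dots> \<le> C * (m + m')" using C lm(2)[OF h1(1)] lm'(2)[OF h1(1)] by (intro mult_left_mono) auto
        finally have 1: "jac ?\<kappa> z (u0 h) (u1 h) x \<le> C * (m + m')" .
        have "jac ?\<kappa> z (t / u0 h) (s / u1 h) x \<le> C * (t / u0 h + s / u1 h)"
          by (rule jac_bounds(3)[OF z0 dz nn(1,2) x Cz])
        also have "\<dots> \<le> C * (t / l + s / l')"
          using C lm(1,2) lm(2)[OF h1(1)] lm'(1) lm'(2)[OF h1(1)] st
          by (intro mult_left_mono add_mono divide_left_mono) auto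
        finally have 2: "jac ?\<kappa> z (t / u0 h) (s / u1 h) x \<le> C * (t / l + s / l')" .
        have "jac ?\<kappa> z (u0 h) (u1 h) x * jac ?\<kappa> z (t / u0 h) (s / u1 h) x \<le> Bd"
          unfolding Bd_def using 1 2 jac_bounds(1)[OF z0 dz nn(1,2) x] C mm by (intro mult_mono) auto
        then have "h * (jac ?\<kappa> z (u0 h) (u1 h) x * jac ?\<kappa> z (t / u0 h) (s / u1 h) x) \<le> h * Bd"
          using h by (intro mult_left_mono) auto
        then show ?thesis using h1(2) by linarith
      qed
      have "(Wd (P (h * t) \<rho>\<^sub>0) (P (h * s) \<rho>\<^sub>1))\<^sup>2 \<le> z\<^sup>2 + 2 * N' * h * ((z / s_fun ?\<kappa> z) *
         ((s + t) * c_fun ?\<kappa> z - s * u0 h / u1 h - t * u1 h / u0 h))"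
        unfolding u0_def u1_def
        by (rule transport_estimate[OF GE ok h(1) \<rho> z(1)[unfolded w_def] dz st]) (use sm in \<open>simp add: u0_def u1_def\<close>)
      moreover have "(z / a) * X = X / (a / z)" for a X by simp
      ultimately show ?thesis using z0 by (simp only: R_def sc_fun_def) simp
    qed
    have "isCont (R h) w"
      unfolding R_def[abs_def] using sc_fun_pos[OF w0 dom[folded w_def]]
      by (intro continuous_intros isCont_c_fun isCont_sc_fun) auto
    then have "(R h \<longlongrightarrow> R h w) (at_right w)" unfolding isCont_def by (rule tendsto_within_subset) simp
    moreover have "\<forall>\<^sub>F z in at_right w. (Wd (P (h * t) \<rho>\<^sub>0) (P (h * s) \<rho>\<^sub>1))\<^sup>2 \<le> R h z"
      using eventually_at_right_real[OF w1(1)] by eventually_elim (use le in auto)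
    ultimately show ?thesis by (rule tendsto_lowerbound) simp
  qed
  show ?thesis
    using eventually_at_right_real[OF h0] by eventually_elim (use main in \<open>auto simp: R_def\<close>)
qed

subsection \<open>HWI inequality, diameter bound and expansion bound\<close>

text \<open>The orbit is itself a curve, and the contraction of the metric bounds its speed at later
  times by the initial one.\<close>

lemma Wd_flow:
  assumes GE: "GE M \<tau> P d v K N" "N > 0" and \<rho>: "\<rho> \<in> S" and h: "h \<ge> 0"
  shows "Wd \<rho> (P h \<rho>) \<le> h * (exp (\<bar>K\<bar> * h) * sqrt (Fisher \<tau> P \<rho>))"
proof -
  note m = states_posD(1)[OF \<rho>]
  have F: "Fisher \<tau> P \<rho> \<ge> 0" using met_nonneg[OF \<rho> L_M0[OF m]] by (simp add: Fisher_met[OF \<rho>])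
  define C where "C = h * (exp (\<bar>K\<bar> * h) * sqrt (Fisher \<tau> P \<rho>))"
  have "dominated_curve True (\<lambda>r. P (h * r) \<rho>) (\<lambda>r. C * r)"
  proof (rule dominated_curve_single[where \<gamma>' = "\<lambda>r. (- h) *\<^sub>R P (h * r) (L \<rho>)"])
    fix r :: real assume r: "r \<in> {0..1}"
    then have hr: "0 \<le> h * r" "h * r \<le> h" using h by (auto simp: mult_left_le)
    show "P (h * r) \<rho> \<in> S" using P_states[OF hr(1) \<rho>] .
    have "((\<lambda>r. P (h * r) ((\<lambda>_. \<rho>) r)) has_vector_derivative P (h * r) 0 - h *\<^sub>R P (h * r) (L \<rho>)) (at r within {0..1})"
      by (rule P_curve_derivative) (use m h r in \<open>auto intro!: derivative_eq_intros\<close>)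
    moreover have "P (h * r) 0 = 0" using P_scaleR[OF hr(1) M_0, of 0] by simp
    ultimately show "((\<lambda>r. P (h * r) \<rho>) has_vector_derivative (- h) *\<^sub>R P (h * r) (L \<rho>)) (at r within {0..1})" by simp
    have "met (P (h * r) \<rho>) ((- h) *\<^sub>R P (h * r) (L \<rho>)) = h\<^sup>2 * met (P (h * r) \<rho>) (P (h * r) (L \<rho>))"
      using met_scaleR[OF P_states[OF hr(1) \<rho>] P_M0[OF hr(1) L_M0[OF m]], of "- h"] by simp
    also have "\<dots> \<le> h\<^sup>2 * (exp (- 2 * K * (h * r)) * Fisher \<tau> P \<rho>)"
      using met_contraction[OF GE \<rho> hr(1) L_M0[OF m]] by (intro mult_left_mono) (auto simp: Fisher_met[OF \<rho>])
    also have "\<dots> \<le> h\<^sup>2 * ((exp (\<bar>K\<bar> * h))\<^sup>2 * Fisher \<tau> P \<rho>)"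
    proof (intro mult_left_mono mult_right_mono F)
      have "- 2 * K * (h * r) \<le> 2 * (\<bar>K\<bar> * h)"
      proof -
        have "- K * (h * r) \<le> \<bar>K\<bar> * h" using hr h by (intro mult_mono) auto
        then show ?thesis by linarith
      qed
      then show "exp (- 2 * K * (h * r)) \<le> (exp (\<bar>K\<bar> * h))\<^sup>2" by (simp add: exp_double[symmetric] mult.commute)
    qed simp
    also have "\<dots> = C\<^sup>2" using F by (simp add: C_def power_mult_distrib)
    finally show "met (P (h * r) \<rho>) ((- h) *\<^sub>R P (h * r) (L \<rho>)) \<le> C\<^sup>2" .
  next
    show "continuous_on {0..1} (\<lambda>r. (- h) *\<^sub>R P (h * r) (L \<rho>))"
      using h m by (intro continuous_intros continuous_on_P) auto
    show "C \<ge> 0" using h F by (simp add: C_def)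
  qed
  from Wd_le[OF this] show ?thesis using m by (simp add: C_def)
qed

lemma Fisher_decay:
  assumes "GE M \<tau> P d v K N" "N > 0" "\<rho> \<in> S" "t \<ge> 0"
  shows "Fisher \<tau> P (P t \<rho>) \<le> exp (- 2 * K * t) * Fisher \<tau> P \<rho>"
  using met_contraction[OF assms(1-4) L_M0[OF states_posD(1)[OF assms(3)]]] assms
    P_states[OF assms(4,3)] states_posD(1)[OF assms(3)]
  by (simp add: Fisher_met P_L)

lemma Wd_diff_le:
  assumes "\<rho> \<in> S" "\<sigma> \<in> S" "\<rho>' \<in> S" "\<sigma>' \<in> S"
  shows "\<bar>Wd \<rho> \<sigma> - Wd \<rho>' \<sigma>'\<bar> \<le> Wd \<rho> \<rho>' + Wd \<sigma> \<sigma>'"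
  using Wd_triangle[of \<rho> \<rho>' \<sigma>] Wd_triangle[of \<rho>' \<sigma>' \<sigma>] Wd_triangle[of \<rho>' \<rho> \<sigma>'] Wd_triangle[of \<rho> \<sigma> \<sigma>']
    Wd_commute[of \<rho> \<rho>'] Wd_commute[of \<sigma> \<sigma>'] assms by auto

text \<open>The distance is Lipschitz in time because the Fisher information grows at most
  exponentially along the flow. Gronwall's lemma asks for this continuity.\<close>

lemma continuous_on_Wd_flow:
  assumes GE: "GE M \<tau> P d v K N" "N > 0" and \<rho>: "\<rho>\<^sub>0 \<in> S" "\<rho>\<^sub>1 \<in> S" and st: "s \<ge> 0" "t \<ge> 0"
  shows "continuous_on {0..1} (\<lambda>r. Wd (P (r * t) \<rho>\<^sub>0) (P (r * s) \<rho>\<^sub>1))"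
proof -
  have lip: "\<exists>C\<ge>0. \<forall>a\<in>{0..1}. \<forall>b\<in>{0..1}. Wd (P (a * t) \<rho>) (P (b * t) \<rho>) \<le> C * \<bar>b - a\<bar>"
    if \<rho>: "\<rho> \<in> S" and t: "t \<ge> 0" for \<rho> t
  proof -
    have F: "0 \<le> Fisher \<tau> P \<rho>" if "\<rho> \<in> S" for \<rho>
      using met_nonneg[OF that L_M0[OF states_posD(1)[OF that]]] by (simp add: Fisher_met[OF that])
    define C where "C = t * (exp (\<bar>K\<bar> * t) * sqrt (exp (2 * \<bar>K\<bar> * t) * Fisher \<tau> P \<rho>))"
    have C: "C \<ge> 0" using t F[OF \<rho>] by (simp add: C_def)
    have le: "Wd (P (a * t) \<rho>) (P (b * t) \<rho>) \<le> C * (b - a)" if ab: "0 \<le> a" "a \<le> b" "b \<le> 1" for a b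
    proof -
      let ?h = "(b - a) * t"
      have h: "0 \<le> ?h" "?h \<le> t" "0 \<le> a * t" "a * t \<le> t"
        using ab t mult_right_mono[of "b - a" 1 t] mult_right_mono[of a 1 t] by auto
      have Pa: "P (a * t) \<rho> \<in> S" using P_states[OF h(3) \<rho>] .
      have "P (b * t) \<rho> = P ?h (P (a * t) \<rho>)"
        using P_P[OF h(1,3) states_posD(1)[OF \<rho>]] by (simp add: algebra_simps)
      then have "Wd (P (a * t) \<rho>) (P (b * t) \<rho>) \<le> ?h * (exp (\<bar>K\<bar> * ?h) * sqrt (Fisher \<tau> P (P (a * t) \<rho>)))"
        using Wd_flow[OF GE Pa h(1)] by simp
      also have "\<dots> \<le> ?h * (exp (\<bar>K\<bar> * t) * sqrt (exp (2 * \<bar>K\<bar> * t) * Fisher \<tau> P \<rho>))"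
      proof (intro mult_left_mono mult_mono real_sqrt_le_mono)
        show "exp (\<bar>K\<bar> * ?h) \<le> exp (\<bar>K\<bar> * t)" using h by (simp add: mult_left_mono)
        have "Fisher \<tau> P (P (a * t) \<rho>) \<le> exp (- 2 * K * (a * t)) * Fisher \<tau> P \<rho>"
          by (rule Fisher_decay[OF GE \<rho> h(3)])
        also have "\<dots> \<le> exp (2 * \<bar>K\<bar> * t) * Fisher \<tau> P \<rho>"
        proof (intro mult_right_mono F[OF \<rho>])
          have "- K * (a * t) \<le> \<bar>K\<bar> * t" using h by (intro mult_mono) auto
          then show "exp (- 2 * K * (a * t)) \<le> exp (2 * \<bar>K\<bar> * t)" by (simp add: mult.commute)
        qed
        finally show "Fisher \<tau> P (P (a * t) \<rho>) \<le> exp (2 * \<bar>K\<bar> * t) * Fisher \<tau> P \<rho>" .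
      qed (use h F[OF Pa] in auto)
      also have "\<dots> = C * (b - a)" by (simp add: C_def)
      finally show ?thesis .
    qed
    have "Wd (P (a * t) \<rho>) (P (b * t) \<rho>) \<le> C * \<bar>b - a\<bar>" if ab: "a \<in> {0..1}" "b \<in> {0..1}" for a b
    proof (cases "a \<le> b")
      case False
      have "P (a * t) \<rho> \<in> S" "P (b * t) \<rho> \<in> S" using ab t \<rho> P_states by auto
      then show ?thesis using le[of b a] False ab Wd_commute[of "P (a * t) \<rho>" "P (b * t) \<rho>"] by simp
    qed (use le[of a b] ab in simp)
    then show ?thesis using C by blast
  qed
  obtain C where C: "C \<ge> 0" "\<And>a b. a \<in> {0..1} \<Longrightarrow> b \<in> {0..1} \<Longrightarrow> Wd (P (a * t) \<rho>\<^sub>0) (P (b * t) \<rho>\<^sub>0) \<le> C * \<bar>b - a\<bar>"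
    using lip[OF \<rho>(1) st(2)] by blast
  obtain C' where C': "C' \<ge> 0" "\<And>a b. a \<in> {0..1} \<Longrightarrow> b \<in> {0..1} \<Longrightarrow> Wd (P (a * s) \<rho>\<^sub>1) (P (b * s) \<rho>\<^sub>1) \<le> C' * \<bar>b - a\<bar>"
    using lip[OF \<rho>(2) st(1)] by blast
  have "(C + C')-lipschitz_on {0..1} (\<lambda>r. Wd (P (r * t) \<rho>\<^sub>0) (P (r * s) \<rho>\<^sub>1))"
  proof (rule lipschitz_onI)
    fix a b :: real assume ab: "a \<in> {0..1}" "b \<in> {0..1}"
    have S: "P (a * t) \<rho>\<^sub>0 \<in> S" "P (b * t) \<rho>\<^sub>0 \<in> S" "P (a * s) \<rho>\<^sub>1 \<in> S" "P (b * s) \<rho>\<^sub>1 \<in> S"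
      using ab st \<rho> P_states by auto
    have "\<bar>Wd (P (a * t) \<rho>\<^sub>0) (P (a * s) \<rho>\<^sub>1) - Wd (P (b * t) \<rho>\<^sub>0) (P (b * s) \<rho>\<^sub>1)\<bar> \<le> C * \<bar>b - a\<bar> + C' * \<bar>b - a\<bar>"
      using Wd_diff_le[OF S(1,3,2,4)] C(2)[OF ab] C'(2)[OF ab] by linarith
    then show "dist (Wd (P (a * t) \<rho>\<^sub>0) (P (a * s) \<rho>\<^sub>1)) (Wd (P (b * t) \<rho>\<^sub>0) (P (b * s) \<rho>\<^sub>1)) \<le> (C + C') * dist a b"
      by (simp add: dist_real_def algebra_simps abs_minus_commute)
  qed (use C C' in simp)
  then show ?thesis by (rule lipschitz_on_continuous_on)
qed

text \<open>Only \<open>\<rho>\<^sub>0\<close> flows. The triangle inequality bounds the squared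
  distance from below by w^2 - 2 w e, where e is h sqrt(I) to first order. Comparison with the upper
  bound of \<open>W_step\<close>, division by 2 h and h \<rightarrow> 0 give the inequality.\<close>

lemma HWI_local:
  assumes GE: "GE M \<tau> P d v K N" "N > 0" and ok: "step_ok K N K' N' \<delta>"
    and \<rho>: "\<rho>\<^sub>0 \<in> S" "\<rho>\<^sub>1 \<in> S" and dom: "s_dom (K' / N') (Wd \<rho>\<^sub>0 \<rho>\<^sub>1)"
  shows "U \<tau> N' \<rho>\<^sub>1 / U \<tau> N' \<rho>\<^sub>0 \<le> c_fun (K' / N') (Wd \<rho>\<^sub>0 \<rho>\<^sub>1)
     + 1 / N' * s_fun (K' / N') (Wd \<rho>\<^sub>0 \<rho>\<^sub>1) * sqrt (Fisher \<tau> P \<rho>\<^sub>0)"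
proof -
  define w where "w = Wd \<rho>\<^sub>0 \<rho>\<^sub>1"
  define c where "c = c_fun (K' / N') w"
  define sc where "sc = sc_fun (K' / N') w"
  define u1 where "u1 = U \<tau> N' \<rho>\<^sub>1"
  define u where "u h = U \<tau> N' (P (h * 1) \<rho>\<^sub>0)" for h
  define I where "I = sqrt (Fisher \<tau> P \<rho>\<^sub>0)"
  have N': "N' > 0" using ok by (simp add: step_ok_def)
  have w0: "w \<ge> 0" using Wd_nonneg[OF \<rho>] by (simp add: w_def)
  have sc: "sc > 0" using sc_fun_pos[OF w0] dom by (simp add: sc_def w_def)
  have m: "\<rho>\<^sub>1 \<in> M" using states_posD[OF \<rho>(2)] by simp
  have I: "I \<ge> 0"
    using met_nonneg[OF \<rho>(1) L_M0[OF states_posD(1)[OF \<rho>(1)]]] by (simp add: I_def Fisher_met[OF \<rho>(1)])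
  have step: "\<forall>\<^sub>F h in at_right 0. (Wd (P (h * 1) \<rho>\<^sub>0) \<rho>\<^sub>1)\<^sup>2 \<le> w\<^sup>2 + 2 * N' * h * ((c - u1 / u h) / sc)"
    using W_step[OF GE ok \<rho> dom, of 0 1] m by (simp add: w_def c_def sc_def u1_def u_def)
  have ev: "\<forall>\<^sub>F h in at_right 0. - (w * (exp (\<bar>K\<bar> * h) * I)) * sc \<le> N' * (c - u1 / u h)"
    using step eventually_at_right_less[of "0::real"]
  proof eventually_elim
    case (elim h)
    have Ph: "P (h * 1) \<rho>\<^sub>0 \<in> S" using elim \<rho> P_states by simp
    define e where "e = h * (exp (\<bar>K\<bar> * h) * I)"
    have "w \<le> e + Wd (P (h * 1) \<rho>\<^sub>0) \<rho>\<^sub>1"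
      using Wd_triangle[OF \<rho>(1) Ph \<rho>(2)] Wd_flow[OF GE \<rho>(1), of h] elim by (simp add: w_def e_def I_def)
    then have ge: "w - e \<le> Wd (P (h * 1) \<rho>\<^sub>0) \<rho>\<^sub>1" by simp
    have "w\<^sup>2 - 2 * w * e \<le> (Wd (P (h * 1) \<rho>\<^sub>0) \<rho>\<^sub>1)\<^sup>2"
    proof (cases "e \<le> w")
      case True
      then have "(w - e)\<^sup>2 \<le> (Wd (P (h * 1) \<rho>\<^sub>0) \<rho>\<^sub>1)\<^sup>2" using ge by (intro power_mono) auto
      moreover have "w\<^sup>2 - 2 * w * e \<le> (w - e)\<^sup>2" by (simp add: power2_diff)
      ultimately show ?thesis by linarith
    next
      case False
      have "w * w \<le> w * (2 * e)" using w0 False by (intro mult_left_mono) auto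
      then have "w\<^sup>2 - 2 * w * e \<le> 0" by (simp add: power2_eq_square)
      then show ?thesis using zero_le_power2[of "Wd (P (h * 1) \<rho>\<^sub>0) \<rho>\<^sub>1"] by linarith
    qed
    then have "- 2 * w * e \<le> 2 * N' * h * ((c - u1 / u h) / sc)" using elim by linarith
    then have "(2 * h) * (- (w * (exp (\<bar>K\<bar> * h) * I))) \<le> (2 * h) * (N' * ((c - u1 / u h) / sc))"
      by (simp add: e_def mult_ac)
    then have "- (w * (exp (\<bar>K\<bar> * h) * I)) \<le> N' * ((c - u1 / u h) / sc)"
      using elim by (subst (asm) mult_le_cancel_left_pos) auto
    then show ?case using sc by (simp add: field_simps)
  qed
  have l1: "((\<lambda>h. - (w * (exp (\<bar>K\<bar> * h) * I)) * sc) \<longlongrightarrow> - (w * (exp (\<bar>K\<bar> * 0) * I)) * sc) (at_right 0)"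
    by (intro tendsto_intros)
  have l2: "((\<lambda>h. N' * (c - u1 / u h)) \<longlongrightarrow> N' * (c - u1 / U \<tau> N' \<rho>\<^sub>0)) (at_right 0)"
    unfolding u_def using U_pos[of N' "\<rho>\<^sub>0"]
    by (intro tendsto_intros U_P_tendsto \<rho>) auto
  have "- (w * (exp (\<bar>K\<bar> * 0) * I)) * sc \<le> N' * (c - u1 / U \<tau> N' \<rho>\<^sub>0)"
    by (rule tendsto_le[OF _ l2 l1 ev]) simp
  then have "N' * (u1 / U \<tau> N' \<rho>\<^sub>0) \<le> N' * (c + 1 / N' * (w * sc) * I)"
    using N' by (simp add: algebra_simps)
  then have "u1 / U \<tau> N' \<rho>\<^sub>0 \<le> c + 1 / N' * (w * sc) * I"
    using mult_le_cancel_left_pos[OF N'] by blast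
  then show ?thesis by (simp add: s_fun_sc[of _ "Wd \<rho>\<^sub>0 \<rho>\<^sub>1"] u1_def c_def sc_def I_def w_def)
qed

text \<open>With the intermediate value theorem this supplies states at every intermediate distance,
  in place of points on a geodesic.\<close>

lemma Wd_segment:
  assumes "\<rho> \<in> S" "\<sigma> \<in> S"
  shows "continuous_on {0..1} (\<lambda>r. Wd \<rho> ((1 - r) *\<^sub>R \<rho> + r *\<^sub>R \<sigma>))"
proof -
  define \<gamma> where "\<gamma> r = (1 - r) *\<^sub>R \<rho> + r *\<^sub>R \<sigma>" for r
  have \<gamma>: "\<gamma> r \<in> S" if "r \<in> {0..1}" for r using states_pos_convex[OF assms] that by (simp add: \<gamma>_def)
  have d: "\<sigma> - \<rho> \<in> M0" using assms by (simp add: M0_def states_pos_iff tr_diff)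
  have "continuous_on {0..1} \<gamma>" unfolding \<gamma>_def[abs_def] by (intro continuous_intros)
  then have "continuous_on {0..1} (\<lambda>r. met (\<gamma> r) (\<sigma> - \<rho>))"
    using \<gamma> d by (intro continuous_on_met) auto
  from continuous_attains_sup[OF _ _ this] obtain r0 where r0: "r0 \<in> {0..1}"
    "\<And>r. r \<in> {0..1} \<Longrightarrow> met (\<gamma> r) (\<sigma> - \<rho>) \<le> met (\<gamma> r0) (\<sigma> - \<rho>)" by force
  define C where "C = sqrt (met (\<gamma> r0) (\<sigma> - \<rho>))"
  have C: "C \<ge> 0" "C\<^sup>2 = met (\<gamma> r0) (\<sigma> - \<rho>)" using met_nonneg[OF \<gamma>[OF r0(1)] d] by (simp_all add: C_def)
  have le: "Wd (\<gamma> a) (\<gamma> b) \<le> C * \<bar>b - a\<bar>" if ab: "a \<in> {0..1}" "b \<in> {0..1}" for a b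
  proof -
    have in01: "a + (b - a) * r \<in> {0..1}" if r: "r \<in> {0..1}" for r
    proof -
      have "a + (b - a) * r = (1 - r) * a + r * b" by (simp add: algebra_simps)
      moreover have "0 \<le> (1 - r) * a + r * b" using ab r by simp
      moreover have "(1 - r) * a + r * b \<le> (1 - r) * 1 + r * 1"
        using ab r by (intro add_mono mult_left_mono) auto
      ultimately show ?thesis by simp
    qed
    have "dominated_curve True (\<lambda>r. \<gamma> (a + (b - a) * r)) (\<lambda>r. (C * \<bar>b - a\<bar>) * r)"
    proof (rule dominated_curve_single[where \<gamma>' = "\<lambda>r. (b - a) *\<^sub>R (\<sigma> - \<rho>)"])
      fix r :: real assume r: "r \<in> {0..1}"
      show "\<gamma> (a + (b - a) * r) \<in> S" using \<gamma>[OF in01[OF r]] .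
      have "(\<lambda>r. \<gamma> (a + (b - a) * r)) = (\<lambda>r. \<gamma> a + r *\<^sub>R ((b - a) *\<^sub>R (\<sigma> - \<rho>)))"
        by (rule ext) (simp add: \<gamma>_def algebra_simps)
      then show "((\<lambda>r. \<gamma> (a + (b - a) * r)) has_vector_derivative (b - a) *\<^sub>R (\<sigma> - \<rho>)) (at r within {0..1})"
        by (auto intro!: derivative_eq_intros simp: has_real_derivative_iff_has_vector_derivative[symmetric])
      show "met (\<gamma> (a + (b - a) * r)) ((b - a) *\<^sub>R (\<sigma> - \<rho>)) \<le> (C * \<bar>b - a\<bar>)\<^sup>2"
        using r0(2)[OF in01[OF r]] met_scaleR[OF \<gamma>[OF in01[OF r]] d, of "b - a"]
        by (simp add: power_mult_distrib C(2) mult.commute mult_left_mono)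
    qed (use C in auto)
    from Wd_le[OF this] show ?thesis by simp
  qed
  have "C-lipschitz_on {0..1} (\<lambda>r. Wd \<rho> (\<gamma> r))"
  proof (rule lipschitz_onI)
    fix a b :: real assume ab: "a \<in> {0..1}" "b \<in> {0..1}"
    show "dist (Wd \<rho> (\<gamma> a)) (Wd \<rho> (\<gamma> b)) \<le> C * dist a b"
      using Wd_diff_le[OF assms(1) \<gamma>[OF ab(1)] assms(1) \<gamma>[OF ab(2)]] le[OF ab] Wd_self[OF assms(1)]
      by (simp add: dist_real_def abs_minus_commute)
  qed (rule C(1))
  then show ?thesis unfolding \<gamma>_def by (rule lipschitz_on_continuous_on)
qed

text \<open>Bonnet-Myers: at distance \<open>\<pi> / sqrt \<kappa>\<close> the HWI inequality would bound a positive number by \<open>- 1\<close>.\<close>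

lemma Wd_diameter:
  assumes GE: "GE M \<tau> P d v K N" "N > 0" and ok: "step_ok K N K' N' \<delta>" and \<rho>: "\<rho> \<in> S" "\<sigma> \<in> S"
  shows "s_dom (K' / N') (Wd \<rho> \<sigma>)"
proof (rule ccontr)
  assume neg: "\<not> s_dom (K' / N') (Wd \<rho> \<sigma>)"
  define \<kappa> where "\<kappa> = K' / N'"
  define l where "l = pi / sqrt \<kappa>"
  have \<kappa>: "\<kappa> > 0" and ge: "l \<le> Wd \<rho> \<sigma>" using neg by (auto simp: s_dom_def \<kappa>_def l_def)
  have l: "l > 0" using \<kappa> by (simp add: l_def)
  define \<gamma> where "\<gamma> r = (1 - r) *\<^sub>R \<rho> + r *\<^sub>R \<sigma>" for r
  have \<gamma>: "\<gamma> r \<in> S" if "r \<in> {0..1}" for r using states_pos_convex[OF \<rho>] that by (simp add: \<gamma>_def)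
  have c\<gamma>: "continuous_on {0..1} \<gamma>" unfolding \<gamma>_def[abs_def] by (intro continuous_intros)
  have "continuous_on {0..1} (\<lambda>r. U \<tau> N' (\<gamma> r))"
    unfolding U_def using \<gamma> c\<gamma> by (intro continuous_intros continuous_on_Ent) auto
  from continuous_attains_inf[OF _ _ this] obtain r0 where
    r0: "\<And>r. r \<in> {0..1} \<Longrightarrow> U \<tau> N' (\<gamma> r0) \<le> U \<tau> N' (\<gamma> r)" by force
  \<comment> \<open>The least value of \<open>U\<close> on the segment gives a lower bound that does
    not depend on which point is found at distance x.\<close>
  define q where "q = U \<tau> N' (\<gamma> r0) / U \<tau> N' \<rho>"
  have q: "q > 0" by (simp add: q_def U_pos)
  define f where "f x = c_fun \<kappa> x + 1 / N' * s_fun \<kappa> x * sqrt (Fisher \<tau> P \<rho>)" for x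
  have le: "q \<le> f x" if x: "0 < x" "x < l" for x
  proof -
    have "\<exists>r\<ge>0. r \<le> 1 \<and> Wd \<rho> (\<gamma> r) = x"
      using Wd_segment[OF \<rho>] x ge Wd_self[OF \<rho>(1)] by (intro IVT') (auto simp: \<gamma>_def)
    then obtain r where r: "r \<in> {0..1}" "Wd \<rho> (\<gamma> r) = x" by auto
    have "s_dom \<kappa> (Wd \<rho> (\<gamma> r))" using r x by (simp add: s_dom_def l_def)
    then have "U \<tau> N' (\<gamma> r) / U \<tau> N' \<rho> \<le> f x"
      using HWI_local[OF GE ok \<rho>(1) \<gamma>[OF r(1)]] r by (simp add: \<kappa>_def f_def)
    moreover have "q \<le> U \<tau> N' (\<gamma> r) / U \<tau> N' \<rho>"
      unfolding q_def using r0[OF r(1)] U_pos[of N' \<rho>] by (intro divide_right_mono) auto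
    ultimately show ?thesis by linarith
  qed
  have "isCont f l" unfolding f_def[abs_def] by (intro continuous_intros isCont_c_fun isCont_s_fun)
  then have "(f \<longlongrightarrow> f l) (at_left l)" unfolding isCont_def by (rule tendsto_within_subset) simp
  then have "q \<le> f l"
  proof (rule tendsto_lowerbound)
    show "\<forall>\<^sub>F x in at_left l. q \<le> f x"
      using eventually_at_left_real[OF l] by eventually_elim (use le in auto)
  qed simp
  moreover have "f l = - 1" using \<kappa> by (simp add: f_def l_def c_fun_def s_fun_def)
  ultimately show False using q by simp
qed

text \<open>The arithmetic-geometric mean bound 2 sqrt(s t) removes the entropies, and the half
  angle formula for \<open>c_fun\<close> makes the result affine in \<open>F\<close>, the form that
  Gronwall's lemma asks for.\<close>

lemma W_expansion_step:
  assumes GE: "GE M \<tau> P d v K N" "N > 0" and ok: "step_ok K N K' N' \<delta>"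
    and \<rho>: "\<rho>\<^sub>0 \<in> S" "\<rho>\<^sub>1 \<in> S" and st: "s \<ge> 0" "t \<ge> 0" and "\<epsilon> > 0"
  defines "F \<equiv> \<lambda>h. (s_fun (K' / N') (Wd (P (h * t) \<rho>\<^sub>0) (P (h * s) \<rho>\<^sub>1) / 2))\<^sup>2"
  shows "\<forall>\<^sub>F h in at_right 0. F h \<le> F 0 + h * (- (K' * (s + t)) * F 0 + N' / 2 * (sqrt t - sqrt s)\<^sup>2 + \<epsilon>)"
proof -
  let ?\<kappa> = "K' / N'"
  note dom = Wd_diameter[OF GE ok]
  define w where "w = Wd \<rho>\<^sub>0 \<rho>\<^sub>1"
  have w0: "w \<ge> 0" using Wd_nonneg[OF \<rho>] by (simp add: w_def)
  have dw: "s_dom ?\<kappa> w" using dom[OF \<rho>] by (simp add: w_def)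
  have N': "N' > 0" using ok by (simp add: step_ok_def)
  have sc: "sc_fun ?\<kappa> w > 0" by (rule sc_fun_pos[OF w0 dw])
  have F0: "F 0 = (s_fun ?\<kappa> (w / 2))\<^sup>2" using states_posD(1)[OF \<rho>(1)] states_posD(1)[OF \<rho>(2)] by (simp add: F_def w_def)
  define Q where "Q = (s + t) * c_fun ?\<kappa> w - 2 * sqrt (s * t)"
  define k where "k = 2 * N' * (Q / sc_fun ?\<kappa> w)"
  have sq: "(sqrt t - sqrt s)\<^sup>2 = s + t - 2 * sqrt (s * t)"
    using st by (simp add: power2_diff real_sqrt_mult)
  \<comment> \<open>At w = 0 the coefficient is a nonnegative multiple of
    \<open>(sqrt t - sqrt s)\<^sup>2\<close>, which keeps the radicand w^2 + k h
    nonnegative.\<close>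
  have k0: "w = 0 \<Longrightarrow> 0 \<le> k"
    using N' sq zero_le_power2[of "sqrt t - sqrt s"] by (simp add: k_def Q_def sc_fun_def)
  have kk: "k * sc_fun ?\<kappa> w / 4 = - (K' * (s + t)) * F 0 + N' / 2 * (sqrt t - sqrt s)\<^sup>2"
  proof -
    have "k * sc_fun ?\<kappa> w / 4 = N' / 2 * Q" using sc by (simp add: k_def)
    also have "\<dots> = N' / 2 * ((s + t) * (1 - 2 * ?\<kappa> * F 0) - 2 * sqrt (s * t))"
      by (simp add: Q_def F0 c_fun_half[of _ w])
    also have "\<dots> = - (K' * (s + t)) * F 0 + N' / 2 * (s + t - 2 * sqrt (s * t))"
      using N' by (simp add: field_simps)
    finally show ?thesis by (simp add: sq)
  qed
  have step: "\<forall>\<^sub>F h in at_right 0. (Wd (P (h * t) \<rho>\<^sub>0) (P (h * s) \<rho>\<^sub>1))\<^sup>2 \<le> w\<^sup>2 + k * h"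
    using W_step[OF GE ok \<rho> dom[OF \<rho>] st] eventually_at_right_less[of "0::real"]
  proof eventually_elim
    case (elim h)
    let ?u0 = "U \<tau> N' (P (h * t) \<rho>\<^sub>0)" and ?u1 = "U \<tau> N' (P (h * s) \<rho>\<^sub>1)"
    have u: "?u0 > 0" "?u1 > 0" by (simp_all add: U_pos)
    have "2 * sqrt (s * t) \<le> s * ?u0 / ?u1 + t * ?u1 / ?u0"
    proof -
      have "2 * sqrt (s * ?u0 / ?u1) * sqrt (t * ?u1 / ?u0) \<le> (sqrt (s * ?u0 / ?u1))\<^sup>2 + (sqrt (t * ?u1 / ?u0))\<^sup>2"
        by (rule sum_squares_bound)
      moreover have "sqrt (s * ?u0 / ?u1) * sqrt (t * ?u1 / ?u0) = sqrt (s * t)"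
        using u by (simp add: real_sqrt_mult[symmetric])
      ultimately show ?thesis using u st by (simp add: mult.assoc)
    qed
    then have "2 * N' * h * (((s + t) * c_fun ?\<kappa> w - s * ?u0 / ?u1 - t * ?u1 / ?u0) / sc_fun ?\<kappa> w) \<le> 2 * N' * h * (Q / sc_fun ?\<kappa> w)"
      using N' elim sc by (intro mult_left_mono divide_right_mono) (auto simp: Q_def)
    also have "\<dots> = k * h" by (simp add: k_def)
    finally show ?case using elim by (simp add: w_def)
  qed
  have lt: "\<forall>\<^sub>F h in at_right 0. s_dom ?\<kappa> (sqrt (w\<^sup>2 + k * h))"
  proof (cases "?\<kappa> > 0")
    case True
    have "((\<lambda>h. sqrt (w\<^sup>2 + k * h)) \<longlongrightarrow> sqrt (w\<^sup>2 + k * 0)) (at_right 0)" by (intro tendsto_intros)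
    then have "\<forall>\<^sub>F h in at_right 0. sqrt (w\<^sup>2 + k * h) < pi / sqrt ?\<kappa>"
      by (rule order_tendstoD) (use w0 dw True in \<open>simp add: s_dom_def\<close>)
    then show ?thesis by eventually_elim (simp add: s_dom_def)
  qed (simp add: s_dom_def)
  have "\<forall>\<^sub>F h in at_right 0. (s_fun ?\<kappa> (sqrt (w\<^sup>2 + k * h) / 2))\<^sup>2 \<le> (s_fun ?\<kappa> (w / 2))\<^sup>2 + h * (k * sc_fun ?\<kappa> w / 4 + \<epsilon>)"
    by (rule s_fun_sqrt_expansion[OF w0 dw k0 \<open>\<epsilon> > 0\<close>])
  with step lt show ?thesis
    using eventually_at_right_less[of "0::real"]
  proof eventually_elim
    case (elim h)
    let ?W = "Wd (P (h * t) \<rho>\<^sub>0) (P (h * s) \<rho>\<^sub>1)"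
    have PS: "P (h * t) \<rho>\<^sub>0 \<in> S" "P (h * s) \<rho>\<^sub>1 \<in> S" using elim st \<rho> P_states by auto
    have W0: "0 \<le> ?W" by (rule Wd_nonneg[OF PS])
    have "?W \<le> sqrt (w\<^sup>2 + k * h)" using elim(1) by (rule real_le_rsqrt)
    then have "s_fun ?\<kappa> (?W / 2) \<le> s_fun ?\<kappa> (sqrt (w\<^sup>2 + k * h) / 2)"
      by (rule s_fun_half_mono[OF W0 _ elim(2)])
    moreover have "0 \<le> s_fun ?\<kappa> (?W / 2)"
      using W0 by (intro s_fun_nonneg s_dom_mono[OF dom[OF PS]]) auto
    ultimately have "F h \<le> (s_fun ?\<kappa> (sqrt (w\<^sup>2 + k * h) / 2))\<^sup>2" unfolding F_def by (rule power_mono)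
    then show ?case using elim(3)[folded F0, unfolded kk] by linarith
  qed
qed

text \<open>The times h t and h s grow in a fixed ratio, so by the semigroup law the infinitesimal
  bound has the same coefficients at every point of the path.\<close>

lemma W_expansion_perturbed:
  assumes GE: "GE M \<tau> P d v K N" "N > 0" and ok: "step_ok K N K' N' \<delta>"
    and \<rho>: "\<rho>\<^sub>0 \<in> S" "\<rho>\<^sub>1 \<in> S" and st: "s \<ge> 0" "t \<ge> 0"
  shows "(s_fun (K' / N') (Wd (P t \<rho>\<^sub>0) (P s \<rho>\<^sub>1) / 2))\<^sup>2
    \<le> exp (- (K' * (s + t))) * (s_fun (K' / N') (Wd \<rho>\<^sub>0 \<rho>\<^sub>1 / 2))\<^sup>2 + N' / 2 * (sqrt t - sqrt s)\<^sup>2 * exp_quot (K' * (s + t)) 1"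
proof -
  define F where "F h = (s_fun (K' / N') (Wd (P (h * t) \<rho>\<^sub>0) (P (h * s) \<rho>\<^sub>1) / 2))\<^sup>2" for h
  note m = states_posD(1)[OF \<rho>(1)] states_posD(1)[OF \<rho>(2)]
  have "F 1 \<le> exp (- (K' * (s + t))) * F 0 + (N' / 2 * (sqrt t - sqrt s)\<^sup>2) * exp_quot (K' * (s + t)) 1"
  proof (rule Gronwall_Dini)
    have cs: "continuous_on UNIV (s_fun (K' / N'))" using isCont_s_fun by (simp add: continuous_at_imp_continuous_on)
    have "continuous_on {0..1} (\<lambda>h. Wd (P (h * t) \<rho>\<^sub>0) (P (h * s) \<rho>\<^sub>1) / 2)"
      by (intro continuous_on_divide continuous_on_const continuous_on_Wd_flow[OF GE \<rho> st]) simp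
    from continuous_on_power[OF continuous_on_compose2[OF cs this], of 2] show "continuous_on {0..1} F"
      by (simp add: F_def[abs_def])
    fix x \<epsilon> :: real assume x: "0 \<le> x" "x < 1" "0 < \<epsilon>"
    let ?\<rho>0 = "P (x * t) \<rho>\<^sub>0" and ?\<rho>1 = "P (x * s) \<rho>\<^sub>1"
    have S: "?\<rho>0 \<in> S" "?\<rho>1 \<in> S" using x st \<rho> P_states by auto
    have Fx: "(s_fun (K' / N') (Wd (P (h * t) ?\<rho>0) (P (h * s) ?\<rho>1) / 2))\<^sup>2 = F (x + h)" if "h \<ge> 0" for h
    proof -
      have "P ((x + h) * t) \<rho>\<^sub>0 = P (h * t) ?\<rho>0" "P ((x + h) * s) \<rho>\<^sub>1 = P (h * s) ?\<rho>1"
        using that x st m P_P[of "h * t" "x * t" \<rho>\<^sub>0] P_P[of "h * s" "x * s" \<rho>\<^sub>1]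
        by (simp_all add: distrib_right add.commute)
      then show ?thesis by (simp add: F_def)
    qed
    show "\<forall>\<^sub>F h in at_right 0. F (x + h) \<le> F x + h * (- (K' * (s + t)) * F x + N' / 2 * (sqrt t - sqrt s)\<^sup>2 + \<epsilon>)"
      using W_expansion_step[OF GE ok S st x(3)] eventually_at_right_less[of "0::real"]
    proof eventually_elim
      case (elim h)
      then show ?case using Fx[of h] Fx[of 0] by simp
    qed
  qed
  then show ?thesis using m by (simp add: F_def)
qed

end

subsection \<open>Removing the perturbation\<close>

lemma step_ok_0: "N > 0 \<Longrightarrow> step_ok 0 N 0 N 1"
  by (simp add: step_ok_def exp_quot_def)

lemma nonneg_right_of_0:
  fixes f :: "real \<Rightarrow> real"
  assumes "(f has_real_derivative l) (at 0)" "l > 0" "f 0 = 0"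
  obtains \<delta> where "\<delta> > 0" "\<And>x. x \<in> {0..\<delta>} \<Longrightarrow> 0 \<le> f x"
proof -
  obtain e where e: "e > 0" "\<And>h. 0 < h \<Longrightarrow> h < e \<Longrightarrow> f 0 < f (0 + h)"
    using DERIV_pos_inc_right[OF assms(1,2)] by blast
  show ?thesis
  proof (rule that[of "e / 2"])
    fix x assume "x \<in> {0..e / 2}"
    then show "0 \<le> f x" using e assms(3) by (cases "x = 0") (auto intro: less_imp_le)
  qed (use e in simp)
qed

text \<open>Both defects vanish at T = 0 and have the derivatives 2 (K - K') and 2 / N - 2 / N'
  there; their positivity outweighs the second order terms for small T.\<close>

lemma step_ok_perturbed:
  assumes "N > 0" "K \<noteq> 0" "K' < K" "N < N'"
  obtains \<delta> where "step_ok K N K' N' \<delta>"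
proof -
  have "((\<lambda>T. 1 - 2 * K' * T - exp (- 2 * K * T)) has_real_derivative 2 * (K - K')) (at 0)"
    by (auto intro!: derivative_eq_intros)
  then obtain d1 where d1: "d1 > 0" "\<And>x. x \<in> {0..d1} \<Longrightarrow> 0 \<le> 1 - 2 * K' * x - exp (- 2 * K * x)"
    by (rule nonneg_right_of_0) (use assms in auto)
  have "((\<lambda>T. (exp (2 * K * T) - 1) / (K * N) - 2 * T / N') has_real_derivative 2 / N - 2 / N') (at 0)"
    using assms by (auto intro!: derivative_eq_intros)
  moreover have "2 / N - 2 / N' > 0" using assms by (simp add: divide_strict_left_mono)
  ultimately obtain d2 where d2: "d2 > 0" "\<And>x. x \<in> {0..d2} \<Longrightarrow> 0 \<le> (exp (2 * K * x) - 1) / (K * N) - 2 * x / N'"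
    by (rule nonneg_right_of_0) auto
  have "exp (2 * K * T) * exp_quot K (2 * T) / N = (exp (2 * K * T) - 1) / (K * N)" for T
  proof -
    have "exp (2 * K * T) * (1 - exp (- K * (2 * T))) = exp (2 * K * T) - 1"
      by (simp add: right_diff_distrib exp_minus mult_ac)
    then show ?thesis using assms by (simp add: exp_quot_def)
  qed
  then have "step_ok K N K' N' (min d1 d2)"
    using d1 d2 assms by (fastforce simp: step_ok_def)
  then show ?thesis by (rule that)
qed

text \<open>Near a nonzero \<kappa> a single branch of the definition is in force. The value 0 does
  not arise as a limit, since K = 0 is treated without perturbation.\<close>

lemma isCont_s_fun_param: assumes "\<kappa> \<noteq> 0" shows "isCont (\<lambda>k. s_fun k x) \<kappa>"
proof (cases "\<kappa> > 0")
  case True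
  have "isCont (\<lambda>k. sin (sqrt k * x) / sqrt k) \<kappa>" using True by (intro continuous_intros) auto
  moreover have "\<forall>\<^sub>F k in nhds \<kappa>. s_fun k x = sin (sqrt k * x) / sqrt k"
    using eventually_nhds_in_open[of "{0<..}" \<kappa>] True by (auto simp: s_fun_def elim!: eventually_mono)
  ultimately show ?thesis using isCont_cong[of "\<lambda>k. s_fun k x" "\<lambda>k. sin (sqrt k * x) / sqrt k" \<kappa>] by blast
next
  case False
  then have neg: "\<kappa> < 0" using assms by simp
  have "isCont (\<lambda>k. sinh (sqrt (- k) * x) / sqrt (- k)) \<kappa>" using neg by (intro continuous_intros) auto
  moreover have "\<forall>\<^sub>F k in nhds \<kappa>. s_fun k x = sinh (sqrt (- k) * x) / sqrt (- k)"
    using eventually_nhds_in_open[of "{..<0}" \<kappa>] neg by (auto simp: s_fun_def elim!: eventually_mono)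
  ultimately show ?thesis using isCont_cong[of "\<lambda>k. s_fun k x" "\<lambda>k. sinh (sqrt (- k) * x) / sqrt (- k)" \<kappa>] by blast
qed

lemma isCont_c_fun_param: assumes "\<kappa> \<noteq> 0" shows "isCont (\<lambda>k. c_fun k x) \<kappa>"
proof -
  have "isCont (\<lambda>k. 1 - 2 * k * (s_fun k (x / 2))\<^sup>2) \<kappa>"
    by (intro continuous_intros isCont_s_fun_param assms)
  then show ?thesis by (simp add: c_fun_half[of _ x])
qed

context qms
begin

text \<open>The infinitesimal argument loses an arbitrarily small amount of \<open>K\<close> and \<open>N\<close>, which is recovered by
  continuity; for \<open>K = 0\<close> it loses nothing.\<close>

lemma perturbation_limit:
  assumes "N > 0" "\<And>K' N' \<delta>. step_ok K N K' N' \<delta> \<Longrightarrow> f K' N' \<le> (g K' N' :: real)"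
    and "K \<noteq> 0 \<Longrightarrow> ((\<lambda>e. f (K - \<bar>K\<bar> * e) (N + e)) \<longlongrightarrow> f K N) (at_right 0)"
    and "K \<noteq> 0 \<Longrightarrow> ((\<lambda>e. g (K - \<bar>K\<bar> * e) (N + e)) \<longlongrightarrow> g K N) (at_right 0)"
  shows "f K N \<le> g K N"
proof (cases "K = 0")
  case True
  then show ?thesis using assms(2) step_ok_0[OF assms(1)] by blast
next
  case False
  have ev: "\<forall>\<^sub>F e in at_right 0. f (K - \<bar>K\<bar> * e) (N + e) \<le> g (K - \<bar>K\<bar> * e) (N + e)"
    using eventually_at_right_less[of "0::real"]
  proof eventually_elim
    case (elim e)
    obtain \<delta> where "step_ok K N (K - \<bar>K\<bar> * e) (N + e) \<delta>"
      by (rule step_ok_perturbed[of N K "K - \<bar>K\<bar> * e" "N + e"]) (use assms(1) False elim in \<open>auto intro: that\<close>)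
    then show ?case by (rule assms(2))
  qed
  show ?thesis by (rule tendsto_le[OF _ assms(4)[OF False] assms(3)[OF False] ev]) simp
qed

lemma perturbed_tendsto:
  assumes "K \<noteq> 0" "N > 0"
  shows "((\<lambda>e. K - \<bar>K\<bar> * e) \<longlongrightarrow> K) (at_right 0)" "((\<lambda>e. N + e) \<longlongrightarrow> N) (at_right 0)"
    "((\<lambda>e. s_fun ((K - \<bar>K\<bar> * e) / (N + e)) x) \<longlongrightarrow> s_fun (K / N) x) (at_right 0)"
    "((\<lambda>e. c_fun ((K - \<bar>K\<bar> * e) / (N + e)) x) \<longlongrightarrow> c_fun (K / N) x) (at_right 0)"
proof -
  have "((\<lambda>e. K - \<bar>K\<bar> * e) \<longlongrightarrow> K - \<bar>K\<bar> * 0) (at_right 0)" by (intro tendsto_intros)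
  then show K: "((\<lambda>e. K - \<bar>K\<bar> * e) \<longlongrightarrow> K) (at_right 0)" by simp
  have "((\<lambda>e. N + e) \<longlongrightarrow> N + 0) (at_right 0)" by (intro tendsto_intros)
  then show N: "((\<lambda>e. N + e) \<longlongrightarrow> N) (at_right 0)" by simp
  have KN: "((\<lambda>e. (K - \<bar>K\<bar> * e) / (N + e)) \<longlongrightarrow> K / N) (at_right 0)"
    using assms(2) by (intro tendsto_divide K N) simp
  have "K / N \<noteq> 0" using assms by simp
  then show "((\<lambda>e. s_fun ((K - \<bar>K\<bar> * e) / (N + e)) x) \<longlongrightarrow> s_fun (K / N) x) (at_right 0)"
    "((\<lambda>e. c_fun ((K - \<bar>K\<bar> * e) / (N + e)) x) \<longlongrightarrow> c_fun (K / N) x) (at_right 0)"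
    by (auto intro: isCont_tendsto_compose[OF isCont_s_fun_param KN] isCont_tendsto_compose[OF isCont_c_fun_param KN])
qed

lemma W_expansion:
  assumes GE: "GE M \<tau> P d v K N" "N > 0" and \<rho>: "\<rho>\<^sub>0 \<in> S" "\<rho>\<^sub>1 \<in> S" and st: "s \<ge> 0" "t \<ge> 0"
  shows "(s_fun (K / N) (Wd (P t \<rho>\<^sub>0) (P s \<rho>\<^sub>1) / 2))\<^sup>2
    \<le> exp (- (K * (s + t))) * (s_fun (K / N) (Wd \<rho>\<^sub>0 \<rho>\<^sub>1 / 2))\<^sup>2 + N / 2 * (sqrt t - sqrt s)\<^sup>2 * exp_quot (K * (s + t)) 1"
    (is "?f K N \<le> ?g K N")
proof (rule perturbation_limit[of N K ?f ?g, OF GE(2)])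
  show "?f K' N' \<le> ?g K' N'" if "step_ok K N K' N' \<delta>" for K' N' \<delta>
    by (rule W_expansion_perturbed[OF GE that \<rho> st])
  assume K: "K \<noteq> 0"
  note l = perturbed_tendsto[OF K GE(2)]
  show "((\<lambda>e. ?f (K - \<bar>K\<bar> * e) (N + e)) \<longlongrightarrow> ?f K N) (at_right 0)"
    by (intro tendsto_power l)
  have "((\<lambda>e. exp_quot ((K - \<bar>K\<bar> * e) * (s + t)) 1) \<longlongrightarrow> exp_quot (K * (s + t)) 1) (at_right 0)"
  proof (cases "s + t = 0")
    case False
    then have n: "K * (s + t) \<noteq> 0" using K by simp
    have q: "((\<lambda>e. (1 - exp (- ((K - \<bar>K\<bar> * e) * (s + t)))) / ((K - \<bar>K\<bar> * e) * (s + t)))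
        \<longlongrightarrow> (1 - exp (- (K * (s + t)))) / (K * (s + t))) (at_right 0)"
      by (intro tendsto_intros l n)
    have "((\<lambda>e. (K - \<bar>K\<bar> * e) * (s + t)) \<longlongrightarrow> K * (s + t)) (at_right 0)" by (intro tendsto_intros l)
    then have "\<forall>\<^sub>F e in at_right 0. (K - \<bar>K\<bar> * e) * (s + t) \<noteq> 0"
      using n by (rule tendsto_imp_eventually_ne)
    then have "\<forall>\<^sub>F e in at_right 0. (1 - exp (- ((K - \<bar>K\<bar> * e) * (s + t)))) / ((K - \<bar>K\<bar> * e) * (s + t))
        = exp_quot ((K - \<bar>K\<bar> * e) * (s + t)) 1"
      by eventually_elim (simp add: exp_quot_def)
    from Lim_transform_eventually[OF q this] show ?thesis using n by (simp add: exp_quot_def)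
  qed simp
  then show "((\<lambda>e. ?g (K - \<bar>K\<bar> * e) (N + e)) \<longlongrightarrow> ?g K N) (at_right 0)"
    by (intro tendsto_intros l) simp_all
qed

lemma HWI:
  assumes GE: "GE M \<tau> P d v K N" "N > 0" and \<rho>: "\<rho>\<^sub>0 \<in> S" "\<rho>\<^sub>1 \<in> S"
  shows "U \<tau> N \<rho>\<^sub>1 / U \<tau> N \<rho>\<^sub>0 \<le> c_fun (K / N) (Wd \<rho>\<^sub>0 \<rho>\<^sub>1)
     + 1 / N * s_fun (K / N) (Wd \<rho>\<^sub>0 \<rho>\<^sub>1) * sqrt (Fisher \<tau> P \<rho>\<^sub>0)" (is "?f K N \<le> ?g K N")
proof (rule perturbation_limit[of N K ?f ?g, OF GE(2)])
  show "?f K' N' \<le> ?g K' N'" if "step_ok K N K' N' \<delta>" for K' N' \<delta>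
    by (rule HWI_local[OF GE that \<rho> Wd_diameter[OF GE that \<rho>]])
  assume K: "K \<noteq> 0"
  note l = perturbed_tendsto[OF K GE(2)]
  show "((\<lambda>e. ?f (K - \<bar>K\<bar> * e) (N + e)) \<longlongrightarrow> ?f K N) (at_right 0)"
    unfolding U_def using GE(2) by (intro tendsto_intros l(2)) auto
  show "((\<lambda>e. ?g (K - \<bar>K\<bar> * e) (N + e)) \<longlongrightarrow> ?g K N) (at_right 0)"
    using GE(2) by (intro tendsto_intros l) auto
qed

lemma Fisher_nonneg: "\<rho> \<in> S \<Longrightarrow> 0 \<le> Fisher \<tau> P \<rho>"
  using met_nonneg[OF _ L_M0[OF states_posD(1)]] by (simp add: Fisher_met)

text \<open>HWI towards the unit still contains the distance. Cauchy-Schwarz for the vectors (1, X)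
  and (cos a, sin a) eliminates it.\<close>

lemma MLSI:
  assumes GE: "GE M \<tau> P d v K N" "N > 0" and K: "K > 0" and \<rho>: "\<rho> \<in> S"
  shows "K * N * (U \<tau> N \<rho> powi (- 2) - 1) \<le> Fisher \<tau> P \<rho>"
proof -
  define a where "a = sqrt (K / N) * Wd \<rho> (mat 1)"
  define I where "I = Fisher \<tau> P \<rho>"
  define X where "X = sqrt (I / (K * N))"
  have I: "I \<ge> 0" using Fisher_nonneg[OF \<rho>] by (simp add: I_def)
  have X: "X\<^sup>2 = I / (K * N)" using I K GE by (simp add: X_def)
  have "1 / U \<tau> N \<rho> \<le> cos a + 1 / N * (sin a / sqrt (K / N)) * sqrt I"
    using HWI[OF GE \<rho> mat1_states_pos] K GE by (simp add: U_def c_fun_def s_fun_def a_def I_def)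
  also have "1 / N * (sin a / sqrt (K / N)) * sqrt I = X * sin a"
  proof -
    have "N * sqrt (K / N) = sqrt (K * N)"
    proof -
      have "N * sqrt (K / N) = (N / sqrt N) * sqrt K" by (simp add: real_sqrt_divide)
      also have "\<dots> = sqrt (K * N)" using GE by (simp add: real_div_sqrt real_sqrt_mult)
      finally show ?thesis .
    qed
    then show ?thesis by (simp add: X_def real_sqrt_divide[of I] mult.commute)
  qed
  finally have le: "1 / U \<tau> N \<rho> \<le> cos a + X * sin a" .
  have "(1 / U \<tau> N \<rho>)\<^sup>2 \<le> (cos a + X * sin a)\<^sup>2"
    using le U_pos[of N \<rho>] by (intro power_mono) auto
  also have "\<dots> \<le> (1 + X\<^sup>2) * ((cos a)\<^sup>2 + (sin a)\<^sup>2)"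
  proof -
    have "(1 + X\<^sup>2) * (x\<^sup>2 + y\<^sup>2) - (x + X * y)\<^sup>2 = (X * x - y)\<^sup>2" for x y
      by (simp add: power2_eq_square algebra_simps)
    from this[of "cos a" "sin a"] show ?thesis using zero_le_power2[of "X * cos a - sin a"] by linarith
  qed
  also have "\<dots> = 1 + I / (K * N)" by (simp add: X)
  finally have "(1 / U \<tau> N \<rho>)\<^sup>2 - 1 \<le> I / (K * N)" by simp
  then have "K * N * ((1 / U \<tau> N \<rho>)\<^sup>2 - 1) \<le> I"
    using K GE by (simp add: pos_le_divide_eq mult.commute)
  moreover have "U \<tau> N \<rho> powi (- 2) = (1 / U \<tau> N \<rho>)\<^sup>2"
    by (simp add: power_int_minus power_one_over inverse_eq_divide)
  ultimately show ?thesis by (simp add: I_def)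
qed

text \<open>The Fisher information of the unit vanishes, which removes the last term of HWI.
  Positivity of the cosine, without which \<open>ln\<close> would be a default value, comes from
  \<open>U\<close> being positive.\<close>

lemma Talagrand:
  assumes GE: "GE M \<tau> P d v K N" "N > 0" and K: "K > 0" and \<rho>: "\<rho> \<in> S"
  shows "0 < cos (sqrt (K / N) * Wd \<rho> (mat 1))"
    "- N * ln (cos (sqrt (K / N) * Wd \<rho> (mat 1))) \<le> Ent \<tau> \<rho>"
proof -
  let ?c = "cos (sqrt (K / N) * Wd \<rho> (mat 1))"
  have "L (mat 1) = 0" by (simp add: L_commutators commutator_simps)
  then have "Fisher \<tau> P (mat 1) = 0" by (simp add: Fisher_def mm.zero_left)
  then have le: "U \<tau> N \<rho> \<le> ?c"
    using HWI[OF GE mat1_states_pos \<rho>] K GE Wd_commute[OF \<rho> mat1_states_pos] by (simp add: U_def c_fun_def)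
  show c: "0 < ?c" using le U_pos[of N \<rho>] by linarith
  have "- Ent \<tau> \<rho> / N \<le> ln ?c" unfolding ln_U[symmetric] using le U_pos by (intro ln_mono) auto
  then show "- N * ln ?c \<le> Ent \<tau> \<rho>" using GE(2) by (simp add: field_simps)
qed

end

theorem proposition5p2:
  fixes M :: "(complex ^ 'n::finite ^ 'n) set"
    and \<tau> :: "complex ^ 'n ^ 'n \<Rightarrow> complex"
    and P :: "real \<Rightarrow> complex ^ 'n ^ 'n \<Rightarrow> complex ^ 'n ^ 'n"
    and d :: nat and v :: "nat \<Rightarrow> complex ^ 'n ^ 'n"
    and K N :: real
  assumes "fd_vN_algebra M"
    and "faithful_tracial_state M \<tau>"
    and "quantum_Markov_semigroup M P"
    and "tracially_symmetric M \<tau> P"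
    and "ergodic M \<tau> P"
    and "Lindblad_form M \<tau> P d v"
    and "N > 0"
    and "GE M \<tau> P d v K N"
  shows
    "(\<forall>\<rho>\<^sub>0\<in>states_pos M \<tau>. \<forall>\<rho>\<^sub>1\<in>states_pos M \<tau>. \<forall>s\<ge>0. \<forall>t\<ge>0.
        (s_fun (K / N) (1 / 2 * W M \<tau> d v (P t \<rho>\<^sub>0) (P s \<rho>\<^sub>1)))\<^sup>2
          \<le> exp (- K * (s + t)) * (s_fun (K / N) (1 / 2 * W M \<tau> d v \<rho>\<^sub>0 \<rho>\<^sub>1))\<^sup>2
            + (if s = 0 \<and> t = 0 then 0
               else N * exp_quot K (s + t) * ((sqrt t - sqrt s)\<^sup>2 / (2 * (s + t)))))
     \<and>
     (\<forall>\<rho>\<^sub>0\<in>states_pos M \<tau>. \<forall>\<rho>\<^sub>1\<in>states_pos M \<tau>.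
        U \<tau> N \<rho>\<^sub>1 / U \<tau> N \<rho>\<^sub>0
          \<le> c_fun (K / N) (W M \<tau> d v \<rho>\<^sub>0 \<rho>\<^sub>1)
            + 1 / N * s_fun (K / N) (W M \<tau> d v \<rho>\<^sub>0 \<rho>\<^sub>1) * sqrt (Fisher \<tau> P \<rho>\<^sub>0))
     \<and>
     (K > 0 \<longrightarrow>
        (\<forall>\<rho>\<in>states_pos M \<tau>. K * N * (U \<tau> N \<rho> powi (- 2) - 1) \<le> Fisher \<tau> P \<rho>)
        \<and>
        (\<forall>\<rho>\<in>states_pos M \<tau>.
           cos (sqrt (K / N) * W M \<tau> d v \<rho> (mat 1)) > 0 \<and>
           Ent \<tau> \<rho> \<ge> - N * ln (cos (sqrt (K / N) * W M \<tau> d v \<rho> (mat 1)))))"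
proof -
  interpret qms M \<tau> P d v
    by unfold_locales (fact assms)+
  note GE = assms(8,7)
  have a: "(s_fun (K / N) (1 / 2 * Wd (P t \<rho>\<^sub>0) (P s \<rho>\<^sub>1)))\<^sup>2
      \<le> exp (- K * (s + t)) * (s_fun (K / N) (1 / 2 * Wd \<rho>\<^sub>0 \<rho>\<^sub>1))\<^sup>2
        + (if s = 0 \<and> t = 0 then 0
           else N * exp_quot K (s + t) * ((sqrt t - sqrt s)\<^sup>2 / (2 * (s + t))))"
    if \<rho>: "\<rho>\<^sub>0 \<in> S" "\<rho>\<^sub>1 \<in> S" and st: "s \<ge> 0" "t \<ge> 0" for \<rho>\<^sub>0 \<rho>\<^sub>1 s t
  proof -
    \<comment> \<open>Gronwall's lemma produces \<open>exp_quot\<close> of K (s + t) at 1, which is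
      \<open>exp_quot K (s + t)\<close> divided by s + t. At s = t = 0 both sides vanish.\<close>
    have "N / 2 * (sqrt t - sqrt s)\<^sup>2 * exp_quot (K * (s + t)) 1 = (if s = 0 \<and> t = 0 then 0
           else N * exp_quot K (s + t) * ((sqrt t - sqrt s)\<^sup>2 / (2 * (s + t))))"
    proof (cases "s = 0 \<and> t = 0")
      case False
      then have "s + t > 0" using st by auto
      then have "exp_quot (K * (s + t)) 1 = exp_quot K (s + t) / (s + t)"
        by (simp add: exp_quot_def)
      then show ?thesis using False by simp
    qed auto
    then show ?thesis using W_expansion[OF GE \<rho> st] by simp
  qed
  show ?thesis
    using a HWI[OF GE] MLSI[OF GE] Talagrand[OF GE] by simp
qed

end
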